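(* Let $(M,\omega)$ be a connected symplectic 6-manifold and let $\varphi$ be a smooth primitive 3-form on $M$. If $\varphi$ is integrable ($d\varphi=0$) and $F$-integrable ($dF(\varphi)=0$), then it is also $K$-integrable (the Nijenhuis tensor $N_K$ of $K(\varphi)$ vanishes) and $Q$-integrable ($dQ(\varphi)=0$, i.e. $Q(\varphi)$ is a constant function on $M$). Moreover, $\varphi$ is either pointwise stable on all of $M$ or pointwise unstable on all of $M$: it is impossible for $\varphi$ to be stable at some points while unstable at other points.
   Context: A 3-form $\varphi$ on $(M,\omega)$ is primitive if $\omega\wedge\varphi=0$. For a primitive 3-form $\varphi$, the endomorphism $K=K(\varphi)$ of $TM$, the 3-form $F(\varphi)$ and the function $Q(\varphi)$ are defined by $$\iota_{KX}\frac{\omega^3}{3!}=-\iota_X\varphi\wedge\varphi,\qquad F(\varphi)(X,Y,Z)=-2\varphi(KX,Y,Z),\qquad \varphi\wedge F(\varphi)=-Q(\varphi)\frac{\omega^3}{3!}.$$ The Nijenhuis tensor of $K$ is $N_K(X,Y)=-K^2[X,Y]+K([KX,Y]+[X,KY])-[KX,KY]$. The form $\varphi$ is stable at $p\in M$ if $\varphi_p$ lies in an open orbit of the action of $\mathrm{GL}(T_pM)$ on $\bigwedge^3T_p^*M$ (equivalently, $Q(\varphi)(p)\neq0$), and unstable at $p$ otherwise. *)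

theory Defs
  imports "HOL-Analysis.Analysis" "HOL-Combinatorics.Permutations"
begin

section \<open>Exterior algebra\<close>

text \<open>
  A $k$-form on a real vector space is a function of a sequence of vectors of which only the
  entries with index \<open>< k\<close> matter.
\<close>

type_synonym 'v form = "(nat \<Rightarrow> 'v) \<Rightarrow> real"

definition alternating_form :: "nat \<Rightarrow> 'v::real_vector form \<Rightarrow> bool" where
  "alternating_form k \<alpha> \<longleftrightarrow>
     (\<forall>v w. (\<forall>i<k. v i = w i) \<longrightarrow> \<alpha> v = \<alpha> w) \<and>
     (\<forall>v. \<forall>i<k. linear (\<lambda>u. \<alpha> (v(i := u)))) \<and>
     (\<forall>v. \<forall>i<k. \<forall>j<k. i \<noteq> j \<and> v i = v j \<longrightarrow> \<alpha> v = 0)"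

definition zero_form :: "'v form" where
  "zero_form = (\<lambda>v. 0)"

definition pullback :: "('v \<Rightarrow> 'w) \<Rightarrow> 'w form \<Rightarrow> 'v form" where
  "pullback g \<alpha> = (\<lambda>v. \<alpha> (\<lambda>i. g (v i)))"

definition interior_product :: "'v \<Rightarrow> 'v form \<Rightarrow> 'v form" where
  "interior_product X \<alpha> = (\<lambda>v. \<alpha> (case_nat X v))"

text \<open>
  Wedge product of a $p$-form and a $q$-form, normalised so that
  $(e^1 \wedge \cdots \wedge e^k)(e_1, \ldots, e_k) = 1$.
\<close>

definition wedge :: "nat \<Rightarrow> nat \<Rightarrow> 'v form \<Rightarrow> 'v form \<Rightarrow> 'v form" where
  "wedge p q \<alpha> \<beta> = (\<lambda>v.
     (\<Sum>\<sigma> | \<sigma> permutes {..<p + q}.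
        of_int (sign \<sigma>) * \<alpha> (\<lambda>i. v (\<sigma> i)) * \<beta> (\<lambda>i. v (\<sigma> (p + i)))) / (fact p * fact q))"

definition symplectic_form :: "'v::real_vector form \<Rightarrow> bool" where
  "symplectic_form \<omega> \<longleftrightarrow>
     alternating_form 2 \<omega> \<and> (\<forall>u. interior_product u \<omega> = zero_form \<longrightarrow> u = 0)"

definition liouville_volume :: "'v form \<Rightarrow> 'v form" where
  "liouville_volume \<omega> = (\<lambda>v. wedge 4 2 (wedge 2 2 \<omega> \<omega>) \<omega> v / fact 3)"

definition primitive_form :: "'v form \<Rightarrow> 'v form \<Rightarrow> bool" where
  "primitive_form \<omega> \<phi> \<longleftrightarrow> wedge 2 3 \<omega> \<phi> = zero_form"

text \<open>
  On a 6-dimensional space with symplectic form \<open>\<omega>\<close> the two definite descriptions below are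
  well defined, since \<open>liouville_volume \<omega>\<close> is a nonzero form of top degree.
\<close>

definition K_form :: "'v form \<Rightarrow> 'v form \<Rightarrow> 'v \<Rightarrow> 'v" where
  "K_form \<omega> \<phi> X = (THE Y.
     interior_product Y (liouville_volume \<omega>) = (\<lambda>v. - wedge 2 3 (interior_product X \<phi>) \<phi> v))"

definition F_form :: "'v form \<Rightarrow> 'v form \<Rightarrow> 'v form" where
  "F_form \<omega> \<phi> = (\<lambda>v. - 2 * \<phi> (v(0 := K_form \<omega> \<phi> (v 0))))"

definition Q_form :: "'v form \<Rightarrow> 'v form \<Rightarrow> real" where
  "Q_form \<omega> \<phi> = (THE q.
     wedge 3 3 \<phi> (F_form \<omega> \<phi>) = (\<lambda>v. - q * liouville_volume \<omega> v))"

text \<open>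
  The function space carries the product topology; on the finite-dimensional subspace of
  alternating 3-forms this induces the usual vector space topology. The orbit of \<open>\<phi>\<close> under
  $g \cdot \phi = (g^{-1})^* \phi$ is the same as its orbit under pullback.
\<close>

definition stable_form :: "'v::real_vector form \<Rightarrow> bool" where
  "stable_form \<phi> \<longleftrightarrow>
     openin (top_of_set {\<alpha>. alternating_form 3 \<alpha>}) {pullback g \<phi> | g :: 'v \<Rightarrow> 'v. linear g \<and> bij g}"


section \<open>Smooth manifolds\<close>

primrec Ck_on :: "nat \<Rightarrow> 'v::real_normed_vector set \<Rightarrow> ('v \<Rightarrow> 'w::real_normed_vector) \<Rightarrow> bool" where
  "Ck_on 0 S f \<longleftrightarrow> continuous_on S f"
| "Ck_on (Suc k) S f \<longleftrightarrow>
     (\<forall>x\<in>S. f differentiable (at x)) \<and> (\<forall>v. Ck_on k S (\<lambda>x. frechet_derivative f (at x) v))"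

text \<open>Only used for open \<open>S\<close>.\<close>

definition smooth_on :: "'v::real_normed_vector set \<Rightarrow> ('v \<Rightarrow> 'w::real_normed_vector) \<Rightarrow> bool" where
  "smooth_on S f \<longleftrightarrow> (\<forall>k. Ck_on k S f)"

text \<open>A chart is a pair of its domain and its coordinate map.\<close>

type_synonym ('a, 'v) chart = "'a set \<times> ('a \<Rightarrow> 'v)"

definition parametrization :: "('a, 'v) chart \<Rightarrow> 'v \<Rightarrow> 'a" where
  "parametrization c = inv_into (fst c) (snd c)"

definition transition :: "('a, 'v) chart \<Rightarrow> ('a, 'v) chart \<Rightarrow> 'v \<Rightarrow> 'v" where
  "transition c c' = snd c' \<circ> parametrization c"

definition smooth_manifold :: "'a topology \<Rightarrow> ('a, 'v::euclidean_space) chart set \<Rightarrow> bool" where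
  "smooth_manifold M A \<longleftrightarrow>
     Hausdorff_space M \<and> second_countable M \<and> topspace M = (\<Union>c\<in>A. fst c) \<and>
     (\<forall>c\<in>A. openin M (fst c) \<and> open (snd c ` fst c) \<and>
        homeomorphic_map (subtopology M (fst c)) (top_of_set (snd c ` fst c)) (snd c)) \<and>
     (\<forall>c\<in>A. \<forall>c'\<in>A. smooth_on (snd c ` (fst c \<inter> fst c')) (transition c c'))"

text \<open>
  Tensor fields on the manifold are given by their expressions in all charts of the atlas,
  subject to the transformation law under change of charts. For a field \<open>\<tau>\<close>, the value \<open>\<tau> c p\<close>
  is \<open>\<tau>\<close> at the point \<open>p\<close>, expressed through the identification of the tangent space at \<open>p\<close>
  with the model space \<open>'v\<close> by the chart \<open>c\<close>; it is relevant only for \<open>c\<close> in the atlas and \<open>p\<close>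
  in the domain of \<open>c\<close>. Pointwise natural operations apply chartwise.
\<close>

type_synonym ('a, 'v, 't) field = "('a, 'v) chart \<Rightarrow> 'a \<Rightarrow> 't"

definition in_coords :: "('a, 'v, 't) field \<Rightarrow> ('a, 'v) chart \<Rightarrow> 'v \<Rightarrow> 't" where
  "in_coords \<tau> c x = \<tau> c (parametrization c x)"

definition jacobian ::
    "('a, 'v::real_normed_vector) chart \<Rightarrow> ('a, 'v) chart \<Rightarrow> 'a \<Rightarrow> 'v \<Rightarrow> 'v" where
  "jacobian c c' p = frechet_derivative (transition c c') (at (snd c p))"

definition smooth_form ::
    "('a, 'v::euclidean_space) chart set \<Rightarrow> nat \<Rightarrow> ('a, 'v, 'v form) field \<Rightarrow> bool" where
  "smooth_form A k \<alpha> \<longleftrightarrow>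
     (\<forall>c\<in>A. \<forall>p\<in>fst c. alternating_form k (\<alpha> c p)) \<and>
     (\<forall>c\<in>A. \<forall>v. smooth_on (snd c ` fst c) (\<lambda>x. in_coords \<alpha> c x v)) \<and>
     (\<forall>c\<in>A. \<forall>c'\<in>A. \<forall>p\<in>fst c \<inter> fst c'. \<alpha> c p = pullback (jacobian c c' p) (\<alpha> c' p))"

definition smooth_vector_field ::
    "('a, 'v::euclidean_space) chart set \<Rightarrow> 'a set \<Rightarrow> ('a, 'v, 'v) field \<Rightarrow> bool" where
  "smooth_vector_field A W X \<longleftrightarrow>
     (\<forall>c\<in>A. smooth_on (snd c ` (fst c \<inter> W)) (in_coords X c)) \<and>
     (\<forall>c\<in>A. \<forall>c'\<in>A. \<forall>p\<in>fst c \<inter> fst c' \<inter> W. X c' p = jacobian c c' p (X c p))"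

definition ext_deriv ::
    "nat \<Rightarrow> ('a, 'v::euclidean_space, 'v form) field \<Rightarrow> ('a, 'v, 'v form) field" where
  "ext_deriv k \<alpha> = (\<lambda>c p v. \<Sum>i\<le>k. (- 1) ^ i *
     frechet_derivative (\<lambda>x. in_coords \<alpha> c x (\<lambda>j. if j < i then v j else v (Suc j)))
       (at (snd c p)) (v i))"

definition closed_form ::
    "('a, 'v::euclidean_space) chart set \<Rightarrow> nat \<Rightarrow> ('a, 'v, 'v form) field \<Rightarrow> bool" where
  "closed_form A k \<alpha> \<longleftrightarrow> (\<forall>c\<in>A. \<forall>p\<in>fst c. ext_deriv k \<alpha> c p = zero_form)"

definition lie_bracket ::
    "('a, 'v::euclidean_space, 'v) field \<Rightarrow> ('a, 'v, 'v) field \<Rightarrow> ('a, 'v, 'v) field" where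
  "lie_bracket X Y = (\<lambda>c p.
     frechet_derivative (in_coords Y c) (at (snd c p)) (X c p) -
     frechet_derivative (in_coords X c) (at (snd c p)) (Y c p))"

definition nijenhuis ::
    "('a, 'v::euclidean_space, 'v \<Rightarrow> 'v) field \<Rightarrow> ('a, 'v, 'v) field \<Rightarrow> ('a, 'v, 'v) field
      \<Rightarrow> ('a, 'v, 'v) field" where
  "nijenhuis J X Y = (let JX = (\<lambda>c p. J c p (X c p)); JY = (\<lambda>c p. J c p (Y c p)) in
     (\<lambda>c p. - J c p (J c p (lie_bracket X Y c p))
            + J c p (lie_bracket JX Y c p + lie_bracket X JY c p)
            - lie_bracket JX JY c p))"


section \<open>Three-forms on symplectic 6-manifolds\<close>

definition symplectic_manifold ::
    "'a topology \<Rightarrow> ('a, 'v::euclidean_space) chart set \<Rightarrow> ('a, 'v, 'v form) field \<Rightarrow> bool" where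
  "symplectic_manifold M A \<omega> \<longleftrightarrow>
     smooth_manifold M A \<and> smooth_form A 2 \<omega> \<and>
     (\<forall>c\<in>A. \<forall>p\<in>fst c. symplectic_form (\<omega> c p)) \<and> closed_form A 2 \<omega>"

definition primitive ::
    "('a, 'v::euclidean_space) chart set \<Rightarrow> ('a, 'v, 'v form) field \<Rightarrow> ('a, 'v, 'v form) field \<Rightarrow> bool"
  where "primitive A \<omega> \<phi> \<longleftrightarrow> (\<forall>c\<in>A. \<forall>p\<in>fst c. primitive_form (\<omega> c p) (\<phi> c p))"

definition K_field ::
    "('a, 'v, 'v form) field \<Rightarrow> ('a, 'v, 'v form) field \<Rightarrow> ('a, 'v, 'v \<Rightarrow> 'v) field" where
  "K_field \<omega> \<phi> = (\<lambda>c p. K_form (\<omega> c p) (\<phi> c p))"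

definition F_field ::
    "('a, 'v, 'v form) field \<Rightarrow> ('a, 'v, 'v form) field \<Rightarrow> ('a, 'v, 'v form) field" where
  "F_field \<omega> \<phi> = (\<lambda>c p. F_form (\<omega> c p) (\<phi> c p))"

definition Q_field ::
    "('a, 'v, 'v form) field \<Rightarrow> ('a, 'v, 'v form) field \<Rightarrow> ('a, 'v, real) field" where
  "Q_field \<omega> \<phi> = (\<lambda>c p. Q_form (\<omega> c p) (\<phi> c p))"

definition integrable_form ::
    "('a, 'v::euclidean_space) chart set \<Rightarrow> ('a, 'v, 'v form) field \<Rightarrow> bool" where
  "integrable_form A \<phi> \<longleftrightarrow> closed_form A 3 \<phi>"

definition F_integrable ::
    "('a, 'v::euclidean_space) chart set \<Rightarrow> ('a, 'v, 'v form) field \<Rightarrow> ('a, 'v, 'v form) field \<Rightarrow> bool"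
  where "F_integrable A \<omega> \<phi> \<longleftrightarrow> closed_form A 3 (F_field \<omega> \<phi>)"

text \<open>Vector fields are allowed to be defined on any open subset, in particular on all of \<open>M\<close>.\<close>

definition K_integrable ::
    "'a topology \<Rightarrow> ('a, 'v::euclidean_space) chart set \<Rightarrow>
     ('a, 'v, 'v form) field \<Rightarrow> ('a, 'v, 'v form) field \<Rightarrow> bool" where
  "K_integrable M A \<omega> \<phi> \<longleftrightarrow>
     (\<forall>W X Y. openin M W \<and> smooth_vector_field A W X \<and> smooth_vector_field A W Y \<longrightarrow>
        (\<forall>c\<in>A. \<forall>p\<in>fst c \<inter> W. nijenhuis (K_field \<omega> \<phi>) X Y c p = 0))"

text \<open>The function \<open>Q\<close>, as a 0-form, is closed.\<close>

definition Q_integrable ::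
    "('a, 'v::euclidean_space) chart set \<Rightarrow> ('a, 'v, 'v form) field \<Rightarrow> ('a, 'v, 'v form) field \<Rightarrow> bool"
  where "Q_integrable A \<omega> \<phi> \<longleftrightarrow> closed_form A 0 (\<lambda>c p v. Q_field \<omega> \<phi> c p)"

text \<open>Stability is invariant under linear isomorphisms, so the choice of the chart is immaterial.\<close>

definition stable_at ::
    "('a, 'v::euclidean_space) chart set \<Rightarrow> ('a, 'v, 'v form) field \<Rightarrow> 'a \<Rightarrow> bool" where
  "stable_at A \<phi> p \<longleftrightarrow> (\<exists>c\<in>A. p \<in> fst c \<and> stable_form (\<phi> c p))"

end

(*
  Only the volume form vol = omega^3/3! matters.  Put psi(X,Y,Z) = phi(KX,Y,Z), so F = -2 psi.
  Linear algebra gives K^2 = kappa id with kappa = Q/4 and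
  i_X phi /\ psi = - i_X psi /\ phi = kappa i_X vol.

  Let d phi = d psi = 0.  Writing out [KX, KY] with i_{KX} vol = - i_X phi /\ phi and Cartan's
  formulas, everything cancels for constant X, Y except
    i_{N_K(X,Y)} vol = i_Y phi /\ L_X psi + i_Y psi /\ L_X phi.
  Comparing with the derivative of i_Y phi /\ psi = kappa i_Y vol turns the right-hand side into
  (1/2) X(kappa) i_Y vol, that is, N_K(X,Y) = (1/2) X(kappa) Y.  Since N_K(X,X) = 0, first
  d kappa = 0 and then N_K = 0.  This is a pointwise statement about first-order jets, so stable
  and unstable points need not be distinguished.

  Stability amounts to kappa /= 0.  If kappa /= 0, rescaling K gives J with J^2 = 1 or J^2 = -1,
  and a basis of the form X_i, J X_i puts phi into a normal form that depends only on the sign of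
  kappa; hence its orbit is {sgn kappa = const}, which is open.  If kappa(phi) = 0, then kappa
  vanishes on the whole orbit, but a quartic polynomial that is not identically zero vanishes on
  no nonempty open set.  So a constant Q makes stability constant on M.
*)

theory Submission
  imports Defs
begin

section \<open>Alternating forms and wedge products\<close>

text \<open>Exterior calculus is replaced by polynomial algebra: the wedge products in degrees 5 and
  6 are written out as \<open>wedge23\<close> and \<open>wedge33\<close> in the values of the forms,
  so that identities between forms become polynomial identities in these values. Dimension six acts
  through three facts about a volume form: top forms are proportional, contraction is an isomorphism
  onto 5-forms, and 7-forms vanish (\<open>V_seven\<close>). The last fact gives access to
  \<open>K\<close>, which is known only inside \<open>vol\<close>. K^2 is scalar because of two
  vanishing squares: \<eta> \<and> \<eta> = 0 for a 1-form makes \<psi> alternating, and \<phi>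
  \<and> \<phi> = 0 makes K traceless. No Darboux chart is chosen, so \<open>vol\<close> varies with
  the point and its logarithmic differential enters the first-order jets; these terms have to cancel
  in the Nijenhuis computation. For stability, denominators are cleared: \<kappa> times the square
  of a volume value is a quartic in the values of the form, which gives both openness and the
  polynomial argument.\<close>

lemma alternating_form_cong:
  assumes "alternating_form k \<alpha>" and "\<And>i. i < k \<Longrightarrow> v i = w i"
  shows "\<alpha> v = \<alpha> w"
proof -
  have "\<forall>v w. (\<forall>i<k. v i = w i) \<longrightarrow> \<alpha> v = \<alpha> w"
    using assms(1) unfolding alternating_form_def by (rule conjunct1)
  from this[rule_format, OF assms(2)] show ?thesis .
qed

lemma alternating_form_linear: "alternating_form k \<alpha> \<Longrightarrow> i < k \<Longrightarrow> linear (\<lambda>u. \<alpha> (v(i := u)))"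
  unfolding alternating_form_def by blast

lemma alternating_form_zero: "alternating_form k \<alpha> \<Longrightarrow> i < k \<Longrightarrow> j < k \<Longrightarrow> i \<noteq> j \<Longrightarrow> v i = v j \<Longrightarrow> \<alpha> v = 0"
  unfolding alternating_form_def by blast

lemma alternating_form_swap:
  assumes "alternating_form k \<alpha>" "i < k" "j < k" "i \<noteq> j"
  shows "\<alpha> (v(i := v j, j := v i)) = - \<alpha> v"
proof -
  let ?f = "\<lambda>x y. \<alpha> (v(i := x, j := y))"
  have l1: "?f (x + x') y = ?f x y + ?f x' y" for x x' y
    using linear_add[OF alternating_form_linear[OF assms(1,2), of "v(j:=y)"], of x x'] assms(4)
    by (simp add: fun_upd_twist)
  have l2: "?f x (y + y') = ?f x y + ?f x y'" for x y y'
    using linear_add[OF alternating_form_linear[OF assms(1,3), of "v(i:=x)"], of y y'] .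
  have z: "?f x x = 0" for x
    by (rule alternating_form_zero[OF assms]) (use assms(4) in auto)
  have "?f (x + y) (x + y) = ?f x x + ?f x y + (?f y x + ?f y y)" for x y
    by (simp only: l1 l2 ac_simps)
  then have "?f (v j) (v i) = - ?f (v i) (v j)"
    unfolding z by (metis add_0 add.right_neutral eq_neg_iff_add_eq_0 add.commute)
  then show ?thesis by simp
qed

lemma alternating_form_permute:
  assumes "alternating_form k \<alpha>" "\<sigma> permutes {..<k}"
  shows "\<alpha> (\<lambda>i. v (\<sigma> i)) = of_int (sign \<sigma>) * \<alpha> v"
  using finite_lessThan[of k] assms(2)
proof (induction arbitrary: v rule: permutes_rev_induct)
  case id
  then show ?case by simp
next
  case (swap a b p)
  have "(\<lambda>i. v ((p \<circ> Transposition.transpose a b) i)) = (\<lambda>i. v (p i))(a := v (p b), b := v (p a))"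
    by (auto simp: Transposition.transpose_def)
  moreover have "sign (p \<circ> Transposition.transpose a b) = sign p * sign (Transposition.transpose a b)"
    using swap permutation_permutes permutation_swap_id finite_lessThan sign_compose by metis
  ultimately show ?case
    using alternating_form_swap[OF assms(1), of a b "\<lambda>i. v (p i)"] swap
    by (simp only: sign_swap_id) simp
qed

text \<open>Kept apart from the factorials of \<open>wedge\<close> so that it can be evaluated by
  recursion on the number of permuted arguments; the recursion stops as soon as a factor is already
  alternating in the arguments that are left.\<close>

definition alternation :: "nat \<Rightarrow> 'v form \<Rightarrow> 'v form" where
  "alternation n f v = (\<Sum>\<sigma> | \<sigma> permutes {..<n}. of_int (sign \<sigma>) * f (\<lambda>i. v (\<sigma> i)))"

lemma wedge_alternation:
  "wedge p q \<alpha> \<beta> v = alternation (p + q) (\<lambda>u. \<alpha> u * \<beta> (\<lambda>i. u (p + i))) v / (fact p * fact q)"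
  by (simp add: wedge_def alternation_def mult.assoc)

text \<open>Coset decomposition: a permutation of n + 1 points is uniquely a transposition of
  \<open>n\<close> with some \<open>b \<le> n\<close> after a permutation \<open>q\<close> that
  fixes \<open>n\<close>. The case \<open>b = n\<close> is the identity, all others flip the
  sign.\<close>

lemma alternation_Suc:
  "alternation (Suc n) f v = alternation n f v - (\<Sum>b<n. alternation n f (v(b := v n, n := v b)))"
proof -
  have *: "{..<Suc n} = insert n {..<n}" by auto
  have "alternation (Suc n) f v = (\<Sum>b\<in>insert n {..<n}. \<Sum>q | q permutes {..<n}.
      of_int (sign (Transposition.transpose n b \<circ> q)) * f (\<lambda>i. v ((Transposition.transpose n b \<circ> q) i)))"
    unfolding alternation_def * by (rule sum_over_permutations_insert) auto
  also have "\<dots> = (\<Sum>b\<in>insert n {..<n}. (if b = n then 1 else - 1) * alternation n f (v(b := v n, n := v b)))"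
  proof (rule sum.cong[OF refl])
    fix b assume "b \<in> insert n {..<n}"
    have sg: "sign (Transposition.transpose n b \<circ> q) = (if b = n then 1 else - 1) * sign q" if "q permutes {..<n}" for q
      using that by (subst sign_compose)
        (auto simp: sign_swap_id intro: permutation_swap_id permutation_permutes[THEN iffD2])
    have cmp: "(\<lambda>i. v ((Transposition.transpose n b \<circ> q) i)) = (\<lambda>i. (v(b := v n, n := v b)) (q i))" for q
      by (auto simp: Transposition.transpose_def)
    have "of_int (sign (Transposition.transpose n b \<circ> q)) * f (\<lambda>i. v ((Transposition.transpose n b \<circ> q) i)) =
        (if b = n then 1 else - 1) * (of_int (sign q) * f (\<lambda>i. (v(b := v n, n := v b)) (q i)))"
      if "q permutes {..<n}" for q
      by (simp only: cmp sg[OF that]) simp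
    then show "(\<Sum>q | q permutes {..<n}.
        of_int (sign (Transposition.transpose n b \<circ> q)) * f (\<lambda>i. v ((Transposition.transpose n b \<circ> q) i))) =
        (if b = n then 1 else - 1) * alternation n f (v(b := v n, n := v b))"
      unfolding alternation_def sum_distrib_left
by (intro sum.cong refl) (simp only: mem_Collect_eq)
  qed
  also have "\<dots> = alternation n f v - (\<Sum>b<n. alternation n f (v(b := v n, n := v b)))"
    by (subst sum.insert) (auto simp: sum_negf intro!: sum.cong)
  finally show ?thesis .
qed

lemma alternating_form_wedge:
  assumes "alternating_form p \<alpha>" "alternating_form q \<beta>"
  shows "alternating_form (p + q) (wedge p q \<alpha> \<beta>)"
proof -
  let ?P = "{\<sigma>. \<sigma> permutes {..<p + q}}"
  let ?t = "\<lambda>v \<sigma>. of_int (sign \<sigma>) * \<alpha> (\<lambda>i. v (\<sigma> i)) * \<beta> (\<lambda>i. v (\<sigma> (p + i)))"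
  have w: "wedge p q \<alpha> \<beta> v = (\<Sum>\<sigma>\<in>?P. ?t v \<sigma>) / (fact p * fact q)" for v
    by (simp add: wedge_def)
  have 1: "wedge p q \<alpha> \<beta> v = wedge p q \<alpha> \<beta> w" if "\<forall>i<p + q. v i = w i" for v w
  proof -
    have eq: "v (\<sigma> i) = w (\<sigma> i)" if "\<sigma> \<in> ?P" "i < p + q" for \<sigma> i
      using that \<open>\<forall>i<p + q. v i = w i\<close> permutes_in_image[of \<sigma> "{..<p + q}"] by simp
    have "\<alpha> (\<lambda>i. v (\<sigma> i)) = \<alpha> (\<lambda>i. w (\<sigma> i))" if "\<sigma> \<in> ?P" for \<sigma>
      by (rule alternating_form_cong[OF assms(1)], rule eq[OF that]) simp
    moreover have "\<beta> (\<lambda>i. v (\<sigma> (p + i))) = \<beta> (\<lambda>i. w (\<sigma> (p + i)))" if "\<sigma> \<in> ?P" for \<sigma>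
      by (rule alternating_form_cong[OF assms(2)], rule eq[OF that]) simp
    ultimately have "(\<Sum>\<sigma>\<in>?P. ?t v \<sigma>) = (\<Sum>\<sigma>\<in>?P. ?t w \<sigma>)"
      by (intro sum.cong) simp_all
    then show ?thesis by (simp only: w)
  qed
  have 2: "linear (\<lambda>u. wedge p q \<alpha> \<beta> (v(i := u)))" if "i < p + q" for v i
  proof -
    have "linear (\<lambda>u. ?t (v(i := u)) \<sigma>)" if \<sigma>: "\<sigma> \<in> ?P" for \<sigma>
    proof -
      \<comment> \<open>A summand sees argument \<open>i\<close> in exactly one slot, the preimage
        \<open>j\<close> of \<open>i\<close>; it belongs to \<alpha> or to \<beta> according to
        \<open>j < p\<close>.\<close>
      obtain j where j: "j < p + q" "\<sigma> j = i"
        using \<sigma> \<open>i < p + q\<close> permutes_surj[of \<sigma>] permutes_in_image[of \<sigma> "{..<p + q}"]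
        by (metis lessThan_iff mem_Collect_eq surjD)
      have eq: "\<sigma> k = i \<longleftrightarrow> k = j" for k
        using j \<sigma> permutes_inj[of \<sigma>] by (auto dest: injD)
      show ?thesis
      proof (cases "j < p")
        case True
        have "(\<lambda>u. ?t (v(i := u)) \<sigma>) =
          (\<lambda>u. (of_int (sign \<sigma>) * \<beta> (\<lambda>k. v (\<sigma> (p + k)))) *\<^sub>R \<alpha> ((\<lambda>k. v (\<sigma> k))(j := u)))"
        proof
          fix u
          have "(\<lambda>k. (v(i := u)) (\<sigma> k)) = (\<lambda>k. v (\<sigma> k))(j := u)"
            using eq by auto
          moreover have "(\<lambda>k. (v(i := u)) (\<sigma> (p + k))) = (\<lambda>k. v (\<sigma> (p + k)))"
            using eq True by auto
          ultimately show "?t (v(i := u)) \<sigma> =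
            (of_int (sign \<sigma>) * \<beta> (\<lambda>k. v (\<sigma> (p + k)))) *\<^sub>R \<alpha> ((\<lambda>k. v (\<sigma> k))(j := u))" by simp
        qed
        then show ?thesis
          using alternating_form_linear[OF assms(1) True]
          by (simp only:) (rule linear_compose_scale_right)
      next
        case False
        then obtain l where l: "j = p + l" "l < q" using j by (metis add_less_cancel_left le_iff_add not_less)
        have "(\<lambda>u. ?t (v(i := u)) \<sigma>) =
          (\<lambda>u. (of_int (sign \<sigma>) * \<alpha> (\<lambda>k. v (\<sigma> k))) *\<^sub>R \<beta> ((\<lambda>k. v (\<sigma> (p + k)))(l := u)))"
        proof
          fix u
          have "\<alpha> (\<lambda>k. (v(i := u)) (\<sigma> k)) = \<alpha> (\<lambda>k. v (\<sigma> k))"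
            using eq False by (intro alternating_form_cong[OF assms(1)]) auto
          moreover have "(\<lambda>k. (v(i := u)) (\<sigma> (p + k))) = (\<lambda>k. v (\<sigma> (p + k)))(l := u)"
            using eq l by auto
          ultimately show "?t (v(i := u)) \<sigma> =
            (of_int (sign \<sigma>) * \<alpha> (\<lambda>k. v (\<sigma> k))) *\<^sub>R \<beta> ((\<lambda>k. v (\<sigma> (p + k)))(l := u))" by simp
        qed
        then show ?thesis
          using alternating_form_linear[OF assms(2) l(2)]
          by (simp only:) (rule linear_compose_scale_right)
      qed
    qed
    then have "linear (\<lambda>u. (1 / (fact p * fact q)) *\<^sub>R (\<Sum>\<sigma>\<in>?P. ?t (v(i := u)) \<sigma>))"
      by (intro linear_compose_scale_right linear_compose_sum) auto
    then show ?thesis unfolding w by simp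
  qed
  have 3: "wedge p q \<alpha> \<beta> v = 0" if "i < p + q" "j < p + q" "i \<noteq> j" "v i = v j" for v i j
  proof -
    \<comment> \<open>Composition with the transposition of \<open>i\<close> and \<open>j\<close> is
      a sign-reversing involution of the index set, so the sum equals its own negative.\<close>
    have "(\<Sum>\<sigma>\<in>?P. ?t v \<sigma>) = (\<Sum>\<sigma>\<in>?P. - ?t v \<sigma>)"
    proof (rule sum.reindex_bij_witness[where i = "\<lambda>\<sigma>. Transposition.transpose i j \<circ> \<sigma>" and j = "\<lambda>\<sigma>. Transposition.transpose i j \<circ> \<sigma>"])
      fix \<sigma> assume \<sigma>: "\<sigma> \<in> ?P"
      show "Transposition.transpose i j \<circ> (Transposition.transpose i j \<circ> \<sigma>) = \<sigma>" by (simp add: o_assoc)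
      then show "Transposition.transpose i j \<circ> (Transposition.transpose i j \<circ> \<sigma>) = \<sigma>" .
      have sw: "Transposition.transpose i j permutes {..<p + q}"
        using that by (intro permutes_swap_id) auto
      then show "Transposition.transpose i j \<circ> \<sigma> \<in> ?P" using \<sigma> permutes_compose by blast
      then show "Transposition.transpose i j \<circ> \<sigma> \<in> ?P" .
      have "sign (Transposition.transpose i j \<circ> \<sigma>) = - sign \<sigma>"
        using \<sigma> that by (subst sign_compose)
          (auto simp: sign_swap_id intro: permutation_swap_id permutation_permutes[THEN iffD2])
      moreover have "v (Transposition.transpose i j k) = v k" for k
        using that(4) by (auto simp: Transposition.transpose_def)
      ultimately show "- ?t v (Transposition.transpose i j \<circ> \<sigma>) = ?t v \<sigma>" by simp
    qed
    then show ?thesis unfolding w by (simp add: sum_negf)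
  qed
  show ?thesis unfolding alternating_form_def using 1 2 3 by blast
qed

lemma alternating_form_scale:
  assumes "alternating_form k \<alpha>"
  shows "alternating_form k (\<lambda>v. c * \<alpha> v)"
proof -
  have "linear (\<lambda>u. c * \<alpha> (v(i := u)))" if "i < k" for v i
    using linear_compose_scale_right[OF alternating_form_linear[OF assms that], of c] by simp
  then show ?thesis
    using assms unfolding alternating_form_def by (metis mult_zero_right)
qed

section \<open>Evaluation on explicit arguments and wedge products in low degree\<close>

definition curry2 :: "'v form \<Rightarrow> 'v \<Rightarrow> 'v \<Rightarrow> real" where
  "curry2 \<alpha> a b = \<alpha> ((!) [a, b])"

definition curry3 :: "'v form \<Rightarrow> 'v \<Rightarrow> 'v \<Rightarrow> 'v \<Rightarrow> real" where
  "curry3 \<alpha> a b c = \<alpha> ((!) [a, b, c])"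

definition curry6 :: "'v form \<Rightarrow> 'v \<Rightarrow> 'v \<Rightarrow> 'v \<Rightarrow> 'v \<Rightarrow> 'v \<Rightarrow> 'v \<Rightarrow> real" where
  "curry6 \<alpha> a b c d e f = \<alpha> ((!) [a, b, c, d, e, f])"

lemma less_numeral_cases:
  "i < (2::nat) \<longleftrightarrow> i = 0 \<or> i = 1"
  "i < (3::nat) \<longleftrightarrow> i = 0 \<or> i = 1 \<or> i = 2"
  "i < (4::nat) \<longleftrightarrow> i = 0 \<or> i = 1 \<or> i = 2 \<or> i = 3"
  "i < (5::nat) \<longleftrightarrow> i = 0 \<or> i = 1 \<or> i = 2 \<or> i = 3 \<or> i = 4"
  "i < (6::nat) \<longleftrightarrow> i = 0 \<or> i = 1 \<or> i = 2 \<or> i = 3 \<or> i = 4 \<or> i = 5"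
  by auto

text \<open>Beyond the end of the list \<open>(!)\<close> takes unspecified values; a form of
  matching degree does not see them.\<close>

lemma curry2_eq: "alternating_form 2 \<alpha> \<Longrightarrow> \<alpha> v = curry2 \<alpha> (v 0) (v 1)"
  unfolding curry2_def by (rule alternating_form_cong) (auto simp: less_numeral_cases)

lemma curry3_eq: "alternating_form 3 \<alpha> \<Longrightarrow> \<alpha> v = curry3 \<alpha> (v 0) (v 1) (v 2)"
  unfolding curry3_def by (rule alternating_form_cong) (auto simp: less_numeral_cases)

lemma curry6_eq: "alternating_form 6 \<alpha> \<Longrightarrow> \<alpha> v = curry6 \<alpha> (v 0) (v 1) (v 2) (v 3) (v 4) (v 5)"
  unfolding curry6_def by (rule alternating_form_cong) (auto simp: less_numeral_cases)

lemma sum_lessThan_numeral: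
  fixes g :: "nat \<Rightarrow> 'b::comm_monoid_add"
  shows "(\<Sum>b<1. g b) = g 0" "(\<Sum>b<2. g b) = g 0 + g 1" "(\<Sum>b<3. g b) = g 0 + g 1 + g 2"
    "(\<Sum>b<4. g b) = g 0 + g 1 + g 2 + g 3" "(\<Sum>b<5. g b) = g 0 + g 1 + g 2 + g 3 + g 4"
  by (simp_all add: eval_nat_numeral)

lemma alternation_numeral:
  "alternation 3 f v = alternation 2 f v - (\<Sum>b<2. alternation 2 f (v(b := v 2, 2 := v b)))"
  "alternation 4 f v = alternation 3 f v - (\<Sum>b<3. alternation 3 f (v(b := v 3, 3 := v b)))"
  "alternation 5 f v = alternation 4 f v - (\<Sum>b<4. alternation 4 f (v(b := v 4, 4 := v b)))"
  "alternation 6 f v = alternation 5 f v - (\<Sum>b<5. alternation 5 f (v(b := v 5, 5 := v b)))"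
  using alternation_Suc[of 2 f v]
    alternation_Suc[of 3 f v] alternation_Suc[of 4 f v] alternation_Suc[of 5 f v]
  by simp_all

text \<open>A factor that only sees the later arguments can be pulled out of the alternation.\<close>

lemma alternation_alternating:
  assumes \<alpha>: "alternating_form n \<alpha>" and \<beta>: "\<And>u u'. (\<And>i. n \<le> i \<Longrightarrow> u i = u' i) \<Longrightarrow> \<beta> u = \<beta> u'"
  shows "alternation n (\<lambda>u. \<alpha> u * \<beta> u) v = fact n * \<alpha> v * \<beta> v"
proof -
  have "of_int (sign \<sigma>) * (\<alpha> (\<lambda>i. v (\<sigma> i)) * \<beta> (\<lambda>i. v (\<sigma> i))) = \<alpha> v * \<beta> v"
    if "\<sigma> permutes {..<n}" for \<sigma>
  proof -
    have "\<beta> (\<lambda>i. v (\<sigma> i)) = \<beta> v"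
      by (rule \<beta>) (use that in \<open>auto simp: permutes_def\<close>)
    moreover have "of_int (sign \<sigma>) * (of_int (sign \<sigma>) :: real) = 1"
      by (auto simp: sign_def)
    ultimately show ?thesis
      by (simp add: alternating_form_permute[OF \<alpha> that] flip: mult.assoc)
  qed
  then have "alternation n (\<lambda>u. \<alpha> u * \<beta> u) v = (\<Sum>\<sigma> | \<sigma> permutes {..<n}. \<alpha> v * \<beta> v)"
    unfolding alternation_def by (intro sum.cong) auto
  then show ?thesis by (simp add: card_permutations[OF refl])
qed

lemma curry2_alt:
  assumes "alternating_form 2 \<alpha>"
  shows "curry2 \<alpha> b a = - curry2 \<alpha> a b" "curry2 \<alpha> a a = 0"
proof -
  have "((!) [a, b])(0 := b, 1 := a) = (!) [b, a]" if "True" for a b :: 'a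
    by (auto simp: fun_eq_iff nth_Cons split: nat.split)
  then show "curry2 \<alpha> b a = - curry2 \<alpha> a b"
    using alternating_form_swap[OF assms, of 0 1 "(!) [a, b]"] by (simp add: curry2_def)
  show "curry2 \<alpha> a a = 0"
    unfolding curry2_def by (rule alternating_form_zero[OF assms, of 0 1]) auto
qed

definition alt3 :: "('v::real_vector \<Rightarrow> 'v \<Rightarrow> 'v \<Rightarrow> real) \<Rightarrow> bool" where
  "alt3 \<gamma> \<longleftrightarrow> (\<forall>b c. linear (\<lambda>a. \<gamma> a b c)) \<and> (\<forall>a c. linear (\<lambda>b. \<gamma> a b c)) \<and> (\<forall>a b. linear (\<lambda>c. \<gamma> a b c)) \<and>
     (\<forall>a b. \<gamma> a a b = 0) \<and> (\<forall>a b. \<gamma> a b a = 0) \<and> (\<forall>a b. \<gamma> a b b = 0)"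

lemma nth_upd:
  "((!) [a, b, c])(0 := x) = (!) [x, b, c]" "((!) [a, b, c])(1 := x) = (!) [a, x, c]"
  "((!) [a, b, c])(Suc 0 := x) = (!) [a, x, c]"
  "((!) [a, b, c])(2 := x) = (!) [a, b, x]"
  by (auto simp: fun_eq_iff nth_Cons numeral_eq_Suc split: nat.split)

lemma alt3_curry3:
  assumes "alternating_form 3 \<alpha>"
  shows "alt3 (curry3 \<alpha>)"
proof -
  have "linear (\<lambda>a. curry3 \<alpha> a b c)" "linear (\<lambda>a. curry3 \<alpha> b a c)" "linear (\<lambda>a. curry3 \<alpha> b c a)" for b c
    using alternating_form_linear[OF assms, of 0 "(!) [b, b, c]"]
      alternating_form_linear[OF assms, of 1 "(!) [b, b, c]"]
      alternating_form_linear[OF assms, of 2 "(!) [b, c, c]"]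
    by (simp_all add: curry3_def nth_upd)
  moreover have "curry3 \<alpha> a a b = 0" "curry3 \<alpha> a b a = 0" "curry3 \<alpha> a b b = 0" for a b
    unfolding curry3_def
    by (rule alternating_form_zero[OF assms, of 0 1] alternating_form_zero[OF assms, of 0 2]
        alternating_form_zero[OF assms, of 1 2]; simp)+
  ultimately show ?thesis unfolding alt3_def by blast
qed

lemma alt3_linear:
  assumes "alt3 \<gamma>"
  shows "linear (\<lambda>a. \<gamma> a b c)" "linear (\<lambda>a. \<gamma> b a c)" "linear (\<lambda>a. \<gamma> b c a)"
  using assms unfolding alt3_def by auto

lemma alt3_zero:
  assumes "alt3 \<gamma>"
  shows "\<gamma> a a b = 0" "\<gamma> a b a = 0" "\<gamma> a b b = 0"
  using assms unfolding alt3_def by auto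

lemma alt3_swap:
  assumes "alt3 \<gamma>"
  shows "\<gamma> b a c = - \<gamma> a b c" "\<gamma> a c b = - \<gamma> a b c" "\<gamma> c b a = - \<gamma> a b c"
    "\<gamma> b c a = \<gamma> a b c" "\<gamma> c a b = \<gamma> a b c"
proof -
  note l = linear_add[OF alt3_linear(1)[OF assms]] linear_add[OF alt3_linear(2)[OF assms]]
    linear_add[OF alt3_linear(3)[OF assms]]
  note z = alt3_zero[OF assms]
  have "\<gamma> (a + b) (a + b) c = \<gamma> a a c + \<gamma> a b c + (\<gamma> b a c + \<gamma> b b c)" for a b c
    by (simp only: l ac_simps)
  then have 1: "\<gamma> b a c = - \<gamma> a b c" for a b c
    using z(1)[of "a + b" c] by (simp add: z eq_neg_iff_add_eq_0 add.commute)
  have "\<gamma> a (b + c) (b + c) = \<gamma> a b b + \<gamma> a b c + (\<gamma> a c b + \<gamma> a c c)" for a b c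
    by (simp only: l ac_simps)
  then have 2: "\<gamma> a c b = - \<gamma> a b c" for a b c
    using z(3)[of a "b + c"] by (simp add: z eq_neg_iff_add_eq_0 add.commute)
  show "\<gamma> b a c = - \<gamma> a b c" "\<gamma> a c b = - \<gamma> a b c" by (rule 1 2)+
  show "\<gamma> c b a = - \<gamma> a b c" "\<gamma> b c a = \<gamma> a b c" "\<gamma> c a b = \<gamma> a b c"
    using 1[of c b a] 2[of b c a] 1[of a b c] 1[of c a b] 2[of a b c] by simp_all
qed

text \<open>The ten terms are the (2,3)-shuffles of the five arguments with their signs, so no
  factorials remain. Both factors are curried, which makes a partial application such as
  \<open>\<phi> x\<close> the contraction i_x \<phi>.\<close>

definition wedge23 :: "('v \<Rightarrow> 'v \<Rightarrow> real) \<Rightarrow> ('v \<Rightarrow> 'v \<Rightarrow> 'v \<Rightarrow> real) \<Rightarrow> 'v \<Rightarrow> 'v \<Rightarrow> 'v \<Rightarrow> 'v \<Rightarrow> 'v \<Rightarrow> real" where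
  "wedge23 \<beta> \<gamma> a b c d e =
     \<beta> a b * \<gamma> c d e - \<beta> a c * \<gamma> b d e + \<beta> a d * \<gamma> b c e - \<beta> a e * \<gamma> b c d + \<beta> b c * \<gamma> a d e
     - \<beta> b d * \<gamma> a c e + \<beta> b e * \<gamma> a c d + \<beta> c d * \<gamma> a b e - \<beta> c e * \<gamma> a b d + \<beta> d e * \<gamma> a b c"

lemma wedge_2_3:
  assumes \<alpha>: "alternating_form 2 \<alpha>" and \<beta>: "alternating_form 3 \<beta>"
  shows "wedge 2 3 \<alpha> \<beta> v = wedge23 (curry2 \<alpha>) (curry3 \<beta>) (v 0) (v 1) (v 2) (v 3) (v 4)"
proof -
  have 2: "alternation 2 (\<lambda>u. \<alpha> u * \<beta> (\<lambda>i. u (2 + i))) u = 2 * (curry2 \<alpha> (u 0) (u 1) * curry3 \<beta> (u 2) (u 3) (u 4))"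
    for u
    by (subst alternation_alternating[OF \<alpha>])
      (auto simp: curry2_eq[OF \<alpha>] curry3_eq[OF \<beta>] simp flip: numeral_2_eq_2 numeral_3_eq_3)
  \<comment> \<open>Specialised to increasing indices, the antisymmetry equations become rewrite
    rules directed towards sorted arguments; the sixty products left by the recursion then collapse
    to the ten shuffles.\<close>
  note s = alt3_swap[OF alt3_curry3[OF \<beta>]]
  note p = curry2_alt(1)[OF \<alpha>, of "v 1" "v 0"] curry2_alt(1)[OF \<alpha>, of "v 2" "v 0"]
    curry2_alt(1)[OF \<alpha>, of "v 3" "v 0"] curry2_alt(1)[OF \<alpha>, of "v 4" "v 0"]
    curry2_alt(1)[OF \<alpha>, of "v 2" "v 1"] curry2_alt(1)[OF \<alpha>, of "v 3" "v 1"]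
    curry2_alt(1)[OF \<alpha>, of "v 4" "v 1"] curry2_alt(1)[OF \<alpha>, of "v 3" "v 2"]
    curry2_alt(1)[OF \<alpha>, of "v 4" "v 2"] curry2_alt(1)[OF \<alpha>, of "v 4" "v 3"]
  note q = s[where a = "v 0" and b = "v 1" and c = "v 2"] s[where a = "v 0" and b = "v 1" and c = "v 3"]
    s[where a = "v 0" and b = "v 1" and c = "v 4"]
    s[where a = "v 0" and b = "v 2" and c = "v 3"] s[where a = "v 0" and b = "v 2" and c = "v 4"] s[where a = "v 0" and b = "v 3" and c = "v 4"]
    s[where a = "v 1" and b = "v 2" and c = "v 3"] s[where a = "v 1" and b = "v 2" and c = "v 4"]
      s[where a = "v 1" and b = "v 3" and c = "v 4"] s[where a = "v 2" and b = "v 3" and c = "v 4"]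
  show ?thesis
    unfolding wedge_alternation numeral_plus_numeral add_num_simps
    unfolding alternation_numeral sum_lessThan_numeral 2
    by (simp add: p q wedge23_def fact_numeral del: One_nat_def)
qed

text \<open>Contraction with \<open>v 0\<close> is an antiderivation: \<alpha> \<and> i \<beta>
  enters with the sign of the odd degree of \<alpha> and equals i \<beta> \<and> \<alpha>, because a
  2-form commutes with every form.\<close>

lemma wedge_3_3:
  assumes \<alpha>: "alternating_form 3 \<alpha>" and \<beta>: "alternating_form 3 \<beta>"
  shows "wedge 3 3 \<alpha> \<beta> v =
    wedge23 (curry3 \<alpha> (v 0)) (curry3 \<beta>) (v 1) (v 2) (v 3) (v 4) (v 5)
    - wedge23 (curry3 \<beta> (v 0)) (curry3 \<alpha>) (v 1) (v 2) (v 3) (v 4) (v 5)"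
proof -
  have 3: "alternation 3 (\<lambda>u. \<alpha> u * \<beta> (\<lambda>i. u (3 + i))) u = 6 * (curry3 \<alpha> (u 0) (u 1) (u 2) * curry3 \<beta> (u 3) (u 4) (u 5))"
    for u
    by (subst alternation_alternating[OF \<alpha>])
      (auto simp: curry3_eq[OF \<alpha>] curry3_eq[OF \<beta>] fact_numeral simp flip: numeral_2_eq_2 numeral_3_eq_3)
  note s = alt3_swap[OF alt3_curry3[OF \<alpha>]] alt3_swap[OF alt3_curry3[OF \<beta>]]
  note q = s[where a = "v 0" and b = "v 1" and c = "v 2"] s[where a = "v 0" and b = "v 1" and c = "v 3"]
    s[where a = "v 0" and b = "v 1" and c = "v 4"] s[where a = "v 0" and b = "v 1" and c = "v 5"]
    s[where a = "v 0" and b = "v 2" and c = "v 3"] s[where a = "v 0" and b = "v 2" and c = "v 4"]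
    s[where a = "v 0" and b = "v 2" and c = "v 5"] s[where a = "v 0" and b = "v 3" and c = "v 4"]
    s[where a = "v 0" and b = "v 3" and c = "v 5"] s[where a = "v 0" and b = "v 4" and c = "v 5"]
    s[where a = "v 1" and b = "v 2" and c = "v 3"] s[where a = "v 1" and b = "v 2" and c = "v 4"]
    s[where a = "v 1" and b = "v 2" and c = "v 5"] s[where a = "v 1" and b = "v 3" and c = "v 4"]
    s[where a = "v 1" and b = "v 3" and c = "v 5"] s[where a = "v 1" and b = "v 4" and c = "v 5"]
    s[where a = "v 2" and b = "v 3" and c = "v 4"] s[where a = "v 2" and b = "v 3" and c = "v 5"]
    s[where a = "v 2" and b = "v 4" and c = "v 5"] s[where a = "v 3" and b = "v 4" and c = "v 5"]
  show ?thesis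
    unfolding wedge_alternation numeral_plus_numeral add_num_simps
    unfolding alternation_numeral(2-) sum_lessThan_numeral 3
    by (simp add: q wedge23_def fact_numeral del: One_nat_def)
qed

lemma wedge_2_2:
  assumes \<alpha>: "alternating_form 2 \<alpha>" and \<beta>: "alternating_form 2 \<beta>"
  shows "wedge 2 2 \<alpha> \<beta> v =
    curry2 \<alpha> (v 0) (v 1) * curry2 \<beta> (v 2) (v 3) - curry2 \<alpha> (v 0) (v 2) * curry2 \<beta> (v 1) (v 3)
    + curry2 \<alpha> (v 0) (v 3) * curry2 \<beta> (v 1) (v 2) + curry2 \<alpha> (v 1) (v 2) * curry2 \<beta> (v 0) (v 3)
    - curry2 \<alpha> (v 1) (v 3) * curry2 \<beta> (v 0) (v 2) + curry2 \<alpha> (v 2) (v 3) * curry2 \<beta> (v 0) (v 1)"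
proof -
  have 2: "alternation 2 (\<lambda>u. \<alpha> u * \<beta> (\<lambda>i. u (2 + i))) u = 2 * (curry2 \<alpha> (u 0) (u 1) * curry2 \<beta> (u 2) (u 3))"
    for u
    by (subst alternation_alternating[OF \<alpha>])
      (auto simp: curry2_eq[OF \<alpha>] curry2_eq[OF \<beta>] simp flip: numeral_2_eq_2 numeral_3_eq_3)
  note p = curry2_alt(1)[OF \<alpha>, of "v 1" "v 0"] curry2_alt(1)[OF \<alpha>, of "v 2" "v 0"]
    curry2_alt(1)[OF \<alpha>, of "v 3" "v 0"] curry2_alt(1)[OF \<alpha>, of "v 2" "v 1"]
    curry2_alt(1)[OF \<alpha>, of "v 3" "v 1"] curry2_alt(1)[OF \<alpha>, of "v 3" "v 2"]
    curry2_alt(1)[OF \<beta>, of "v 1" "v 0"] curry2_alt(1)[OF \<beta>, of "v 2" "v 0"]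
    curry2_alt(1)[OF \<beta>, of "v 3" "v 0"] curry2_alt(1)[OF \<beta>, of "v 2" "v 1"]
    curry2_alt(1)[OF \<beta>, of "v 3" "v 1"] curry2_alt(1)[OF \<beta>, of "v 3" "v 2"]
  show ?thesis
    unfolding wedge_alternation numeral_plus_numeral add_num_simps
    unfolding alternation_numeral sum_lessThan_numeral 2
    by (simp add: p fact_numeral del: One_nat_def)
qed

text \<open>On a symplectic basis only the pairing 01, 23, 45 contributes to \<omega>^3. It does so
  in 3! ways, one for each order of the three factors, which is exactly the normalising
  constant.\<close>

lemma liouville_volume_symplectic_basis:
  assumes \<omega>: "alternating_form 2 \<omega>"
    and h: "curry2 \<omega> (v 0) (v 1) = 1" "curry2 \<omega> (v 2) (v 3) = 1" "curry2 \<omega> (v 4) (v 5) = 1"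
      "curry2 \<omega> (v 0) (v 2) = 0" "curry2 \<omega> (v 0) (v 3) = 0" "curry2 \<omega> (v 0) (v 4) = 0" "curry2 \<omega> (v 0) (v 5) = 0"
      "curry2 \<omega> (v 1) (v 2) = 0" "curry2 \<omega> (v 1) (v 3) = 0" "curry2 \<omega> (v 1) (v 4) = 0" "curry2 \<omega> (v 1) (v 5) = 0"
      "curry2 \<omega> (v 2) (v 4) = 0" "curry2 \<omega> (v 2) (v 5) = 0"
      "curry2 \<omega> (v 3) (v 4) = 0" "curry2 \<omega> (v 3) (v 5) = 0"

  shows "liouville_volume \<omega> v = 1"
proof -
  let ?\<alpha> = "wedge 2 2 \<omega> \<omega>"
  have \<alpha>: "alternating_form 4 ?\<alpha>"
    using alternating_form_wedge[OF \<omega> \<omega>] by simp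
  have 4: "alternation 4 (\<lambda>u. ?\<alpha> u * \<omega> (\<lambda>i. u (4 + i))) u = 24 * (?\<alpha> u * curry2 \<omega> (u 4) (u 5))" for u
    by (subst alternation_alternating[OF \<alpha>])
      (auto simp: curry2_eq[OF \<omega>] fact_numeral simp flip: numeral_2_eq_2 numeral_3_eq_3)
  note p = curry2_alt(1)[OF \<omega>, of "v 1" "v 0"] curry2_alt(1)[OF \<omega>, of "v 2" "v 0"]
    curry2_alt(1)[OF \<omega>, of "v 3" "v 0"] curry2_alt(1)[OF \<omega>, of "v 4" "v 0"]
    curry2_alt(1)[OF \<omega>, of "v 5" "v 0"] curry2_alt(1)[OF \<omega>, of "v 2" "v 1"]
    curry2_alt(1)[OF \<omega>, of "v 3" "v 1"] curry2_alt(1)[OF \<omega>, of "v 4" "v 1"]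
    curry2_alt(1)[OF \<omega>, of "v 5" "v 1"] curry2_alt(1)[OF \<omega>, of "v 3" "v 2"]
    curry2_alt(1)[OF \<omega>, of "v 4" "v 2"] curry2_alt(1)[OF \<omega>, of "v 5" "v 2"]
    curry2_alt(1)[OF \<omega>, of "v 4" "v 3"] curry2_alt(1)[OF \<omega>, of "v 5" "v 3"]
    curry2_alt(1)[OF \<omega>, of "v 5" "v 4"]
  have "wedge 4 2 ?\<alpha> \<omega> v = 6"
    unfolding wedge_alternation[of 4 2] numeral_plus_numeral add_num_simps
    unfolding alternation_numeral(3-) sum_lessThan_numeral 4
    unfolding wedge_2_2[OF \<omega> \<omega>]
    by (simp add: h p curry2_alt(2)[OF \<omega>] fact_numeral del: One_nat_def)
  then show ?thesis by (simp add: liouville_volume_def fact_numeral)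
qed

section \<open>Forms of top degree\<close>

lemma alternating_form_eqI:
  fixes U W :: "'v::real_vector form"
  assumes U: "alternating_form k U" and W: "alternating_form k W" and B: "span B = UNIV"
    and eq: "\<And>v. inj_on v {..<k} \<Longrightarrow> v ` {..<k} \<subseteq> B \<Longrightarrow> U v = W v"
  shows "U = W"
proof
  \<comment> \<open>\<open>n\<close> counts the leading arguments not yet restricted to
    \<open>B\<close>; linearity in one argument moves the bound by one. Tuples with a repetition are
    settled by alternation.\<close>
  have *: "U v = W v" if "n \<le> k" "\<And>i. n \<le> i \<Longrightarrow> i < k \<Longrightarrow> v i \<in> B" for n v
    using that
  proof (induction n arbitrary: v)
    case 0
    show ?case
    proof (cases "inj_on v {..<k}")
      case True
      then show ?thesis using 0 by (intro eq) auto
    next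
      case False
      then obtain i j where "i < k" "j < k" "i \<noteq> j" "v i = v j" by (auto simp: inj_on_def)
      then show ?thesis using alternating_form_zero[OF U] alternating_form_zero[OF W] by metis
    qed
  next
    case (Suc n)
    have "U (v(n := u)) = W (v(n := u))" if "u \<in> B" for u
      using Suc.prems that by (intro Suc.IH) (auto simp: le_less_Suc_eq Suc_le_eq)
    then have "U (v(n := u)) = W (v(n := u))" for u
      using linear_eq_on_span[OF alternating_form_linear[OF U] alternating_form_linear[OF W], of n n B v v u] B Suc.prems(1)
      by (metis Suc_le_lessD UNIV_I)
    from this[of "v n"] show ?case by simp
  qed
  show "U v = W v" for v by (rule *[of k]) auto
qed

text \<open>The permutation is the inverse of \<open>b\<close> after \<open>v\<close> and depends
  only on the two enumerations. Quantifying over \<open>W\<close> under the existential provides one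
  sign for all forms, so that it cancels when two of them are compared.\<close>

lemma alternating_form_basis_permute:
  assumes U: "alternating_form k U" and b: "bij_betw b {..<k} B" and v: "bij_betw v {..<k} B"
  shows "\<exists>\<sigma>. \<sigma> permutes {..<k} \<and> (\<forall>W. alternating_form k W \<longrightarrow> W v = of_int (sign \<sigma>) * W b)"
proof -
  define \<sigma> where "\<sigma> i = (if i < k then inv_into {..<k} b (v i) else i)" for i
  have "bij_betw (inv_into {..<k} b \<circ> v) {..<k} {..<k}"
    using bij_betw_trans[OF v bij_betw_inv_into[OF b]] .
  then have "bij_betw \<sigma> {..<k} {..<k}"
    by (subst bij_betw_cong[where g = "inv_into {..<k} b \<circ> v"]) (auto simp: \<sigma>_def)
  then have \<sigma>: "\<sigma> permutes {..<k}"
    by (rule bij_imp_permutes) (auto simp: \<sigma>_def)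
  have "b (\<sigma> i) = v i" if "i < k" for i
    using that v b by (auto simp: \<sigma>_def bij_betw_def intro!: f_inv_into_f)
  then have "W v = of_int (sign \<sigma>) * W b" if "alternating_form k W" for W
    using alternating_form_permute[OF that \<sigma>, of b] alternating_form_cong[OF that, of v "\<lambda>i. b (\<sigma> i)"] by simp
  with \<sigma> show ?thesis by blast
qed

lemma top_form_basis:
  fixes V :: "'v::euclidean_space form"
  assumes V: "alternating_form DIM('v) V" and V0: "V v0 \<noteq> 0" and b: "bij_betw b {..<DIM('v)} Basis"
  shows "V b \<noteq> 0"
proof
  assume "V b = 0"
  have "V = (\<lambda>v. 0 * V v)"
  proof (rule alternating_form_eqI[OF V alternating_form_scale[OF V] span_Basis])
    fix v assume "inj_on v {..<DIM('v)}" "v ` {..<DIM('v)} \<subseteq> (Basis :: 'v set)"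
    then have "bij_betw v {..<DIM('v)} Basis"
      by (simp add: bij_betw_def card_image card_subset_eq)
    from alternating_form_basis_permute[OF V b this] V \<open>V b = 0\<close> show "V v = 0 * V v" by force
  qed
  then show False using V0 by (metis mult_zero_left)
qed

lemma top_form_multiple:
  fixes U V :: "'v::euclidean_space form"
  assumes U: "alternating_form DIM('v) U" and V: "alternating_form DIM('v) V" and V0: "V v0 \<noteq> 0"
  shows "\<exists>c. \<forall>v. U v = c * V v"
proof -
  obtain b :: "nat \<Rightarrow> 'v" where b: "bij_betw b {..<DIM('v)} Basis"
    using ex_bij_betw_nat_finite[of "Basis :: 'v set"] by (auto simp: atLeast0LessThan)
  have ext: "W = W'" if W: "alternating_form DIM('v) W" and W': "alternating_form DIM('v) W'" and "W b = W' b"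
    for W W' :: "'v form"
  proof (rule alternating_form_eqI[OF W W' span_Basis])
    fix v assume "inj_on v {..<DIM('v)}" "v ` {..<DIM('v)} \<subseteq> (Basis :: 'v set)"
    then have "bij_betw v {..<DIM('v)} Basis"
      by (simp add: bij_betw_def card_image card_subset_eq)
    from alternating_form_basis_permute[OF W b this] W W' \<open>W b = W' b\<close> show "W v = W' v" by metis
  qed
  have "V b \<noteq> 0" by (rule top_form_basis[OF V V0 b])
  then have "U = (\<lambda>v. U b / V b * V v)"
    by (intro ext U alternating_form_scale V) simp
  then show ?thesis by metis
qed

text \<open>Otherwise \<open>V\<close> would vanish on every frame containing \<open>a\<close>.
  Replacing in an enumerated basis a vector \<open>c\<close> with
  \<open>a \<bullet> c \<noteq> 0\<close> by \<open>a\<close>, multilinear expansion leaves only the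
  multiple \<open>a \<bullet> c\<close> of the value on the basis, which is not zero.\<close>

lemma top_form_nondegenerate:
  fixes V :: "'v::euclidean_space form"
  assumes V: "alternating_form DIM('v) V" and V0: "V v0 \<noteq> 0" and a: "a \<noteq> 0"
  shows "\<exists>w. w 0 = a \<and> V w \<noteq> 0"
proof (rule ccontr)
  assume "\<not> ?thesis"
  then have z: "V w = 0" if "w 0 = a" for w using that by blast
  have z': "V w = 0" if "w i = a" "i < DIM('v)" for w i
  proof (cases "i = 0")
    case False
    then have "V (w(0 := w i, i := w 0)) = - V w"
      using that by (intro alternating_form_swap[OF V]) auto
    then show ?thesis using z[of "w(0 := w i, i := w 0)"] that False by simp
  qed (use that z in auto)
  obtain b :: "nat \<Rightarrow> 'v" where b: "bij_betw b {..<DIM('v)} Basis"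
    using ex_bij_betw_nat_finite[of "Basis :: 'v set"] by (auto simp: atLeast0LessThan)
  obtain c where c: "c \<in> Basis" "a \<bullet> c \<noteq> 0" using a euclidean_all_zero_iff by blast
  have "c \<in> b ` {..<DIM('v)}" using b c by (simp add: bij_betw_def)
  then obtain j where j: "j < DIM('v)" "b j = c" by blast
  have "V (b(j := a)) = V (b(j := \<Sum>e\<in>Basis. (a \<bullet> e) *\<^sub>R e))" by (simp add: euclidean_representation)
  also have "\<dots> = (\<Sum>e\<in>Basis. (a \<bullet> e) * V (b(j := e)))"
    by (simp add: linear_sum[OF alternating_form_linear[OF V j(1)]] linear_cmul[OF alternating_form_linear[OF V j(1)]])
  also have "\<dots> = (\<Sum>e\<in>Basis. if e = c then (a \<bullet> c) * V b else 0)"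
  proof (rule sum.cong[OF refl])
    fix e :: 'v assume "e \<in> Basis"
    then have "e \<in> b ` {..<DIM('v)}" using b by (simp add: bij_betw_def)
    then obtain i where i: "i < DIM('v)" "b i = e" by blast
    show "(a \<bullet> e) * V (b(j := e)) = (if e = c then (a \<bullet> c) * V b else 0)"
    proof (cases "e = c")
      case False
      then have "V (b(j := e)) = 0"
        using i j by (intro alternating_form_zero[OF V, of i j]) auto
      then show ?thesis using False by simp
    qed (use j in auto)
  qed
  also have "\<dots> = (a \<bullet> c) * V b" using c by simp
  finally have "V b = 0" using z'[of "b(j := a)" j] j c by simp
  moreover have "V b \<noteq> 0" by (rule top_form_basis[OF V V0 b])
  ultimately show False by simp
qed

lemma alternating_form_interior:
  assumes V: "alternating_form (Suc k) V"
  shows "alternating_form k (interior_product X V)"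
proof -
  have upd: "case_nat X (v(i := u)) = (case_nat X v)(Suc i := u)" for v i u
    by (auto simp: fun_eq_iff split: nat.split)
  have "interior_product X V v = interior_product X V w" if "\<forall>i<k. v i = w i" for v w
    unfolding interior_product_def using that
    by (intro alternating_form_cong[OF V]) (auto split: nat.split)
  moreover have "linear (\<lambda>u. interior_product X V (v(i := u)))" if "i < k" for v i
    unfolding interior_product_def upd using that by (intro alternating_form_linear[OF V]) simp
  moreover have "interior_product X V v = 0" if "i < k" "j < k" "i \<noteq> j" "v i = v j" for v i j
    unfolding interior_product_def
    using that by (intro alternating_form_zero[OF V, of "Suc i" "Suc j"]) auto
  ultimately show ?thesis unfolding alternating_form_def by blast
qed

lemma interior_product_linear:
  assumes V: "alternating_form (Suc k) V"
  shows "linear (\<lambda>X. interior_product X V v)"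
proof -
  have "(\<lambda>X. interior_product X V v) = (\<lambda>X. V ((case_nat 0 v)(0 := X)))"
    unfolding interior_product_def by (intro ext arg_cong[where f = V]) (auto split: nat.split)
  then show ?thesis using alternating_form_linear[OF V, of 0 "case_nat 0 v"] by simp
qed

text \<open>On a tuple enumerating \<open>Basis - {c}\<close> only the \<open>c\<close>-component of
  \<open>Y\<close> contributes to the contraction, so the coefficient \<open>y c\<close> is forced
  to be a quotient of two values. Another enumeration changes numerator and denominator by the same
  sign.\<close>

lemma interior_product_top_form:
  fixes V :: "'v::euclidean_space form"
  assumes dim: "DIM('v) = Suc k" and V: "alternating_form (Suc k) V" and V0: "V v0 \<noteq> 0"
    and \<theta>: "alternating_form k \<theta>"
  shows "\<exists>!Y. interior_product Y V = \<theta>"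
proof -
  have V': "alternating_form DIM('v) V" using V dim by simp
  have nd: "Y = 0" if "interior_product Y V = (\<lambda>_. 0)" for Y
  proof (rule ccontr)
    assume "Y \<noteq> 0"
    from top_form_nondegenerate[OF V' V0 this] obtain w where w: "w 0 = Y" "V w \<noteq> 0" by blast
    have "w = case_nat Y (\<lambda>i. w (Suc i))" using w by (auto split: nat.split)
    then show False using fun_cong[OF that, of "\<lambda>i. w (Suc i)"] w by (simp add: interior_product_def)
  qed
  have "\<exists>u. bij_betw u {..<k} (Basis - {c})" if "c \<in> Basis" for c :: 'v
    using ex_bij_betw_nat_finite[of "Basis - {c} :: 'v set"] that dim by (auto simp: atLeast0LessThan)
  then obtain u :: "'v \<Rightarrow> nat \<Rightarrow> 'v" where u: "\<And>c. c \<in> Basis \<Longrightarrow> bij_betw (u c) {..<k} (Basis - {c})"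
    by metis
  define y where "y c = \<theta> (u c) / interior_product c V (u c)" for c
  define Y where "Y = (\<Sum>c\<in>Basis. y c *\<^sub>R c)"
  have on_basis: "interior_product Y V v = y c * interior_product c V v"
    if "c \<in> Basis" "bij_betw v {..<k} (Basis - {c})" for v c
  proof -
    have "interior_product Y V v = (\<Sum>e\<in>Basis. y e * interior_product e V v)"
      unfolding Y_def
      by (simp add: linear_sum[OF interior_product_linear[OF V]] linear_cmul[OF interior_product_linear[OF V]])
    also have "\<dots> = (\<Sum>e\<in>Basis. if e = c then y c * interior_product c V v else 0)"
    proof (rule sum.cong[OF refl])
      fix e :: 'v assume "e \<in> Basis"
      show "y e * interior_product e V v = (if e = c then y c * interior_product c V v else 0)"
      proof (cases "e = c")
        case False
        then have "e \<in> v ` {..<k}" using that \<open>e \<in> Basis\<close> by (simp add: bij_betw_def)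
        then obtain i where "i < k" "v i = e" by blast
        then have "interior_product e V v = 0"
          unfolding interior_product_def by (intro alternating_form_zero[OF V, of 0 "Suc i"]) auto
        then show ?thesis using False by simp
      qed auto
    qed
    finally show ?thesis using that by simp
  qed
  have nz: "interior_product c V (u c) \<noteq> 0" if c: "c \<in> Basis" for c
  proof -
    have "case_nat c (u c) ` {..<Suc k} = insert c (u c ` {..<k})"
      by (auto simp: lessThan_Suc_eq_insert_0 image_image)
    then have "case_nat c (u c) ` {..<DIM('v)} = Basis"
      using u[OF c] c dim by (auto simp: bij_betw_def)
    then have "bij_betw (case_nat c (u c)) {..<DIM('v)} Basis"
      by (simp add: bij_betw_def eq_card_imp_inj_on)
    then show ?thesis
      using top_form_basis[OF V' V0] by (simp add: interior_product_def)
  qed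
  have "interior_product Y V = \<theta>"
  proof (rule alternating_form_eqI[OF alternating_form_interior[OF V] \<theta> span_Basis])
    fix v assume v: "inj_on v {..<k}" "v ` {..<k} \<subseteq> (Basis :: 'v set)"
    have "card (Basis - v ` {..<k}) = 1"
      using v dim by (subst card_Diff_subset) (auto simp: card_image)
    then obtain c where c: "Basis - v ` {..<k} = {c}" by (auto simp: card_1_singleton_iff)
    then have cB: "c \<in> Basis" and vc: "bij_betw v {..<k} (Basis - {c})"
      using v by (auto simp: bij_betw_def)
    obtain \<sigma> :: "nat \<Rightarrow> nat" where \<sigma>: "\<forall>W. alternating_form k W \<longrightarrow> W v = of_int (sign \<sigma>) * W (u c)"
      using alternating_form_basis_permute[OF \<theta> u[OF cB] vc] by blast
    show "interior_product Y V v = \<theta> v"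
      using on_basis[OF cB vc] \<sigma>[rule_format, OF \<theta>]
        \<sigma>[rule_format, OF alternating_form_interior[OF V, of c]] nz[OF cB]
      by (simp add: y_def)
  qed
  moreover have "Y' = Y" if "interior_product Y' V = \<theta>" "interior_product Y V = \<theta>" for Y' Y
  proof -
    have "interior_product (Y' - Y) V = (\<lambda>_. 0)"
      using that linear_diff[OF interior_product_linear[OF V]] by (auto simp: fun_eq_iff)
    then show ?thesis using nd by force
  qed
  ultimately show ?thesis by blast
qed

section \<open>Volume forms in dimension six\<close>

lemma nth_upd6:
  "((!) [a, b, c, d, e, f])(0 := x) = (!) [x, b, c, d, e, f]"
  "((!) [a, b, c, d, e, f])(1 := x) = (!) [a, x, c, d, e, f]"
  "((!) [a, b, c, d, e, f])(2 := x) = (!) [a, b, x, d, e, f]"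
  "((!) [a, b, c, d, e, f])(3 := x) = (!) [a, b, c, x, e, f]"
  "((!) [a, b, c, d, e, f])(4 := x) = (!) [a, b, c, d, x, f]"
  "((!) [a, b, c, d, e, f])(5 := x) = (!) [a, b, c, d, e, x]"
  by (auto simp: fun_eq_iff nth_Cons numeral_eq_Suc split: nat.split)

lemma case_nat_nth: "case_nat a ((!) xs) = (!) (a # xs)"
  by (auto simp: fun_eq_iff nth_Cons split: nat.split)

lemma alternating_form_uncurry3:
  assumes "alt3 \<gamma>"
  shows "alternating_form 3 (\<lambda>v. \<gamma> (v 0) (v 1) (v 2))"
  unfolding alternating_form_def less_numeral_cases
  using alt3_linear[OF assms] alt3_zero[OF assms] by (auto simp del: One_nat_def)

lemma curry3_uncurry3: "curry3 (\<lambda>v. \<gamma> (v 0) (v 1) (v 2)) = \<gamma>"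
  by (simp add: curry3_def fun_eq_iff)

definition wedge33 :: "('v \<Rightarrow> 'v \<Rightarrow> 'v \<Rightarrow> real) \<Rightarrow> ('v \<Rightarrow> 'v \<Rightarrow> 'v \<Rightarrow> real) \<Rightarrow> 'v \<Rightarrow> 'v \<Rightarrow> 'v \<Rightarrow> 'v \<Rightarrow> 'v \<Rightarrow> 'v \<Rightarrow> real" where
  "wedge33 \<gamma> \<delta> a b c d e f = wedge23 (\<gamma> a) \<delta> b c d e f - wedge23 (\<delta> a) \<gamma> b c d e f"

locale volume6 =
  fixes vol :: "(real ^ 6) form"
  assumes alternating: "alternating_form 6 vol" and nonzero: "\<exists>v. vol v \<noteq> 0"
begin

abbreviation "V \<equiv> curry6 vol"

lemma V_swap:
  "V b a c d e f = - V a b c d e f" "V a c b d e f = - V a b c d e f" "V a b d c e f = - V a b c d e f"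
  "V a b c e d f = - V a b c d e f" "V a b c d f e = - V a b c d e f"
  using alternating_form_swap[OF alternating, of 0 1 "(!) [a, b, c, d, e, f]"]
    alternating_form_swap[OF alternating, of 1 2 "(!) [a, b, c, d, e, f]"]
    alternating_form_swap[OF alternating, of 2 3 "(!) [a, b, c, d, e, f]"]
    alternating_form_swap[OF alternating, of 3 4 "(!) [a, b, c, d, e, f]"]
    alternating_form_swap[OF alternating, of 4 5 "(!) [a, b, c, d, e, f]"]
  by (simp_all add: curry6_def nth_upd6 del: One_nat_def)

lemma V_front:
  "V a b c d e f = V c a b d e f" "V a b c d e f = - V d a b c e f"
  "V a b c d e f = V e a b c d f" "V a b c d e f = - V f a b c d e"
proof -
  show 1: "V a b c d e f = V c a b d e f" for a b c d e f
    using V_swap(2)[of a c b d e f] V_swap(1)[of a c b d e f] by simp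
  show 2: "V a b c d e f = - V d a b c e f" for a b c d e f
    using V_swap(3)[of a b d c e f] 1[of a b d c e f] by simp
  show 3: "V a b c d e f = V e a b c d f" for a b c d e f
    using V_swap(4)[of a b c e d f] 2[of a b c e d f] by simp
  show "V a b c d e f = - V f a b c d e"
    using V_swap(5)[of a b c d f e] 3[of a b c d f e] by simp
qed

lemma V_linear: "linear (\<lambda>x. V x b c d e f)" "linear (\<lambda>x. V a x c d e f)"
  using alternating_form_linear[OF alternating, of 0 "(!) [a, b, c, d, e, f]"]
    alternating_form_linear[OF alternating, of 1 "(!) [a, b, c, d, e, f]"]
  by (simp_all add: curry6_def nth_upd6 del: One_nat_def)

lemma ex1_interior:
  assumes "alternating_form 5 \<theta>"
  shows "\<exists>!Y. interior_product Y vol = \<theta>"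
proof -
  obtain v0 where v0: "vol v0 \<noteq> 0" using nonzero by blast
  show ?thesis
    by (rule interior_product_top_form[of 5 vol v0, OF _ _ v0 assms]) (use alternating in auto)
qed

lemma V_nondegenerate:
  assumes "\<And>b c d e f. V a b c d e f = 0"
  shows "a = 0"
proof (rule ccontr)
  assume "a \<noteq> 0"
  obtain v0 where v0: "vol v0 \<noteq> 0" using nonzero by blast
  obtain w where "w 0 = a" "vol w \<noteq> 0"
    using top_form_nondegenerate[of vol v0 a] alternating v0 \<open>a \<noteq> 0\<close> by auto
  then show False using curry6_eq[OF alternating, of w] assms by simp
qed

lemma V_cancel:
  assumes "\<And>b c d e f. V x b c d e f = V y b c d e f"
  shows "x = y"
  using V_nondegenerate[of "x - y"] assms by (simp add: linear_diff[OF V_linear(1)])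

lemma V_multiple:
  assumes "alternating_form 6 U"
  shows "\<exists>r. \<forall>v. U v = r * vol v"
proof -
  obtain v0 where v0: "vol v0 \<noteq> 0" using nonzero by blast
  show ?thesis using top_form_multiple[of U vol v0] alternating assms v0 by simp
qed

lemma wedge33_multiple:
  assumes "alt3 \<gamma>" "alt3 \<delta>"
  shows "\<exists>r. \<forall>a b c d e f. wedge33 \<gamma> \<delta> a b c d e f = r * V a b c d e f"
proof -
  note g = alternating_form_uncurry3[OF assms(1)] and d = alternating_form_uncurry3[OF assms(2)]
  obtain r where r: "wedge 3 3 (\<lambda>v. \<gamma> (v 0) (v 1) (v 2)) (\<lambda>v. \<delta> (v 0) (v 1) (v 2)) v = r * vol v" for v
    using V_multiple[OF alternating_form_wedge[OF g d, unfolded numeral_plus_numeral add_num_simps]] by blast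
  have "wedge33 \<gamma> \<delta> a b c d e f = r * V a b c d e f" for a b c d e f
    using r[of "(!) [a, b, c, d, e, f]"] unfolding wedge_3_3[OF g d] curry3_uncurry3
    by (simp add: wedge33_def curry6_def)
  then show ?thesis by blast
qed

text \<open>The wedge product of a linear form with \<open>vol\<close> is a 7-form, hence zero.\<close>

lemma V_seven:
  assumes \<eta>: "linear \<eta>"
  shows "\<eta> x * V a b c d e f = \<eta> a * V x b c d e f - \<eta> b * V x a c d e f + \<eta> c * V x a b d e f
    - \<eta> d * V x a b c e f + \<eta> e * V x a b c d f - \<eta> f * V x a b c d e"
proof (cases "x = 0")
  case True
  then show ?thesis using linear_0[OF \<eta>] by (simp add: linear_0[OF V_linear(1)])
next
  case False
  \<comment> \<open>For fixed \<open>x\<close>, the other six terms form an alternating 6-form in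
    the remaining arguments, hence a multiple of \<open>vol\<close>. Evaluation on a frame that
    starts with \<open>x\<close> shows that the factor is \<open>\<eta> x\<close>.\<close>
  define U where "U v = (\<Sum>i<6. \<eta> (v i) * vol (v(i := x)))" for v :: "nat \<Rightarrow> real ^ 6"
  have U: "alternating_form 6 U"
  proof -
    have "U v = U w" if "\<forall>i<6. v i = w i" for v w
      unfolding U_def using that
      by (intro sum.cong refl arg_cong2[where f = "(*)"] alternating_form_cong[OF alternating]) auto
    moreover have "linear (\<lambda>u. U (v(i := u)))" if "i < 6" for v i
      unfolding U_def
    proof (intro linear_compose_sum ballI)
      fix k :: nat assume k: "k \<in> {..<6}"
      show "linear (\<lambda>u. \<eta> ((v(i := u)) k) * vol ((v(i := u))(k := x)))"
      proof (cases "k = i")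
        case True
        then show ?thesis
          using linear_compose_scale_right[OF \<eta>, of "vol (v(i := x))"] by (simp add: mult.commute)
      next
        case False
        then show ?thesis
          using linear_compose_scale_right[OF alternating_form_linear[OF alternating that, of "v(k := x)"], of "\<eta> (v k)"]
          by (simp add: fun_upd_twist[of k i])
      qed
    qed
    moreover have "U v = 0" if "i < 6" "j < 6" "i \<noteq> j" "v i = v j" for v i j
    proof -
      have "vol (v(k := x)) = 0" if "k \<notin> {i, j}" for k
        using that \<open>i < 6\<close> \<open>j < 6\<close> \<open>i \<noteq> j\<close> \<open>v i = v j\<close>
        by (intro alternating_form_zero[OF alternating, of i j]) auto
      then have "U v = (\<Sum>k\<in>{i, j}. \<eta> (v k) * vol (v(k := x)))"
        unfolding U_def using that by (intro sum.mono_neutral_right) auto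
      also have "\<dots> = \<eta> (v i) * (vol (v(i := x)) + vol (v(j := x)))"
        using that by (simp add: algebra_simps)
      also have "vol (v(j := x)) = - vol (v(i := x))"
      proof -
        have "(v(i := x))(i := (v(i := x)) j, j := (v(i := x)) i) = v(j := x)"
          using that by (auto simp: fun_eq_iff)
        then show ?thesis using alternating_form_swap[OF alternating that(1-3), of "v(i := x)"] by simp
      qed
      finally show ?thesis by (simp only: add.right_inverse mult_zero_right)
    qed
    ultimately show ?thesis unfolding alternating_form_def by blast
  qed
  obtain r where r: "U v = r * vol v" for v using V_multiple[OF U] by blast
  obtain w where w: "w 0 = x" "vol w \<noteq> 0"
    using top_form_nondegenerate[of vol _ x] alternating nonzero False by auto
  have "vol (w(k := x)) = 0" if "k \<in> {..<6} - {0}" for k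
    using that w by (intro alternating_form_zero[OF alternating, of 0 k]) auto
  then have "U w = (\<Sum>k\<in>{0}. \<eta> (w k) * vol (w(k := x)))"
    unfolding U_def by (intro sum.mono_neutral_right) auto
  also have "\<dots> = \<eta> x * vol w" using w by (simp flip: w(1))
  finally have "r = \<eta> x" using r[of w] w by simp
  then have "\<eta> x * V a b c d e f = U ((!) [a, b, c, d, e, f])" using r by (simp add: curry6_def)
  also have "\<dots> = \<eta> a * V x b c d e f + \<eta> b * V a x c d e f + \<eta> c * V a b x d e f
    + \<eta> d * V a b c x e f + \<eta> e * V a b c d x f + \<eta> f * V a b c d e x"
  proof -
    have "(\<Sum>i<6. g i) = g 0 + g 1 + g 2 + g 3 + g 4 + g 5" for g :: "nat \<Rightarrow> real"
      by (simp add: eval_nat_numeral)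
    then show ?thesis unfolding U_def by (simp add: nth_upd6 curry6_def del: One_nat_def)
  qed
  finally show ?thesis
    using V_swap(1)[of a x c d e f] V_front(1)[of a b x d e f] V_front(2)[of a b c x e f]
      V_front(3)[of a b c d x f] V_front(4)[of a b c d e x] by simp
qed

text \<open>With the inner product by \<open>a\<close> as linear form in \<open>V_seven\<close>, all
  terms containing both \<open>a\<close> and \<open>b\<close> drop out; what is left says that
  \<open>(a \<bullet> a) *\<^sub>R b\<close> and \<open>(a \<bullet> b) *\<^sub>R a\<close> have the
  same contraction with \<open>vol\<close>.\<close>

lemma V_two_nondegenerate:
  assumes "\<And>c d e f. V a b c d e f = 0" and "a \<noteq> 0"
  shows "\<exists>r. b = r *\<^sub>R a"
proof -
  let ?\<eta> = "\<lambda>y. a \<bullet> y"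
  have \<eta>: "linear ?\<eta>" by (rule bounded_linear.linear[OF bounded_linear_inner_right])
  have "V ((?\<eta> a) *\<^sub>R b) c d e f g = V ((?\<eta> b) *\<^sub>R a) c d e f g" for c d e f g
    using V_seven[OF \<eta>, of a b c d e f g] by (simp add: assms(1) linear_cmul[OF V_linear(1)])
  then have "(a \<bullet> a) *\<^sub>R b = (a \<bullet> b) *\<^sub>R a" by (rule V_cancel)
  moreover have "b = (1 / (a \<bullet> a)) *\<^sub>R (a \<bullet> a) *\<^sub>R b" using assms(2) by simp
  ultimately have "b = (1 / (a \<bullet> a)) *\<^sub>R (a \<bullet> b) *\<^sub>R a" by simp
  then show ?thesis by (metis scaleR_scaleR)
qed

end

section \<open>The endomorphism of a three-form\<close>

text \<open>\<open>K\<close> is characterised by its equation instead of being the function chosen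
  by a definite description. Conjugated or rescaled endomorphisms can then be recognised as the
  \<open>K\<close> of other data by checking that equation.\<close>

locale three_form = volume6 +
  fixes \<phi> :: "real ^ 6 \<Rightarrow> real ^ 6 \<Rightarrow> real ^ 6 \<Rightarrow> real" and K :: "real ^ 6 \<Rightarrow> real ^ 6"
  assumes alt: "alt3 \<phi>"
    and V_K: "V (K x) a b c d e = - wedge23 (\<phi> x) \<phi> a b c d e"
begin

lemmas lin = alt3_linear[OF alt]
lemmas zero = alt3_zero[OF alt]
lemmas swap = alt3_swap[OF alt]

lemma linear_K: "linear K"
proof (rule linearI)
  show "K (x + y) = K x + K y" for x y
    by (rule V_cancel)
      (simp add: linear_add[OF V_linear(1)] V_K wedge23_def linear_add[OF lin(1)] algebra_simps)
  show "K (r *\<^sub>R x) = r *\<^sub>R K x" for r x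
    by (rule V_cancel)
      (simp add: linear_cmul[OF V_linear(1)] V_K wedge23_def linear_cmul[OF lin(1)] algebra_simps)
qed

text \<open>Let \<eta> = i_z i_x \<phi>. Contracting i_x \<phi> \<and> \<phi> with \<open>x\<close>
  and \<open>z\<close> gives 2 \<eta> \<and> i_x \<phi>, and \<open>V_seven\<close> wedges this with
  \<eta> once more, so the result vanishes. The factor \<open>V x z c d e f\<close> can be made
  nonzero unless \<open>x\<close> and \<open>z\<close> are dependent, and then the claim is
  immediate.\<close>

lemma K_skew_self: "\<phi> (K x) x z = 0"
proof (cases "x = 0 \<or> (\<exists>r. z = r *\<^sub>R x)")
  case True
  then show ?thesis
    by (auto simp: linear_0[OF lin(2)] linear_cmul[OF lin(3)] zero)
next
  case False
  then obtain c d e f where nz: "V x z c d e f \<noteq> 0"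
    using V_two_nondegenerate[of x z] by blast
  have "\<phi> x z (K x) * V x z c d e f = 0"
    unfolding V_seven[OF lin(3)[of x z], of "K x" x z c d e f] V_K wedge23_def
    by (simp add: zero swap(1)[where a = x and b = z] swap(2)[where a = x and b = z and c = c]
        swap(2)[where a = x and b = z and c = d] swap(2)[where a = x and b = z and c = e]
        swap(2)[where a = x and b = z and c = f] algebra_simps)
  then show ?thesis using nz swap(4)[where a = "K x" and b = x and c = z] by simp
qed

text \<open>Polarisation of \<open>K_skew_self\<close>: \<open>K\<close> slides freely between the
  arguments of \<phi>.\<close>

lemma K_shift: "\<phi> a (K b) c = \<phi> (K a) b c" "\<phi> a b (K c) = \<phi> (K a) b c"
proof -
  have 1: "\<phi> a (K b) c = \<phi> (K a) b c" for a b c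
  proof -
    have "\<phi> (K (a + b)) (a + b) c = \<phi> (K a) a c + \<phi> (K a) b c + (\<phi> (K b) a c + \<phi> (K b) b c)"
      by (simp only: linear_add[OF linear_K] linear_add[OF lin(1)] linear_add[OF lin(2)] ac_simps)
    then have "\<phi> (K a) b c + \<phi> (K b) a c = 0"
      unfolding K_skew_self by simp
    then show ?thesis using swap(1)[where a = a and b = "K b" and c = c] by simp
  qed
  show "\<phi> a (K b) c = \<phi> (K a) b c" by (rule 1)
  show "\<phi> a b (K c) = \<phi> (K a) b c"
    using 1[of c a b] swap(5)[where a = "K a" and b = b and c = c]
      swap(5)[where a = a and b = b and c = "K c"] by argo
qed

definition \<psi> where "\<psi> a b c = \<phi> (K a) b c"

lemma alt_\<psi>: "alt3 \<psi>"
proof -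
  have l: "linear (\<lambda>a. \<psi> a b c)" "linear (\<lambda>a. \<psi> b a c)" "linear (\<lambda>a. \<psi> b c a)" for b c
    using linear_compose[OF linear_K lin(1)[of b c]] lin(2)[of "K b" c] lin(3)[of "K b" c]
    by (simp_all add: o_def \<psi>_def)
  have z: "\<psi> a a b = 0" "\<psi> a b a = 0" "\<psi> a b b = 0" for a b
    unfolding \<psi>_def using swap(2)[where a = "K a" and b = b and c = a]
    by (simp_all add: K_skew_self zero)
  show ?thesis
    unfolding alt3_def by (intro conjI allI l z)
qed

text \<open>The left-hand side is the trace of \<open>K\<close> times V. Inserting the equation for
  \<open>K\<close> turns it, up to sign, into 3 \<phi> \<and> \<phi>, which vanishes because \<phi>
  has odd degree.\<close>

lemma K_trace: "V (K a) b c d e f + V a (K b) c d e f + V a b (K c) d e f + V a b c (K d) e f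
    + V a b c d (K e) f + V a b c d e (K f) = 0"
  unfolding V_swap(1)[of a "K b"] V_front(1)[of a b "K c"] V_front(2)[of a b c "K d"]
    V_front(3)[of a b c d "K e"] V_front(4)[of a b c d e "K f"] V_K wedge23_def
  by (simp add: swap(1)[where a = a and b = b and c = c] swap(5)[where a = a and b = b and c = c]
    swap(1)[where a = a and b = b and c = d] swap(5)[where a = a and b = b and c = d]
    swap(1)[where a = a and b = b and c = e] swap(5)[where a = a and b = b and c = e]
    swap(1)[where a = a and b = b and c = f] swap(5)[where a = a and b = b and c = f]
    swap(1)[where a = a and b = c and c = d] swap(5)[where a = a and b = c and c = d]
    swap(1)[where a = a and b = c and c = e] swap(5)[where a = a and b = c and c = e]
    swap(1)[where a = a and b = c and c = f] swap(5)[where a = a and b = c and c = f]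
    swap(1)[where a = a and b = d and c = e] swap(5)[where a = a and b = d and c = e]
    swap(1)[where a = a and b = d and c = f] swap(5)[where a = a and b = d and c = f]
    swap(1)[where a = a and b = e and c = f] swap(5)[where a = a and b = e and c = f]
    swap(1)[where a = b and b = c and c = d] swap(5)[where a = b and b = c and c = d]
    swap(1)[where a = b and b = c and c = e] swap(5)[where a = b and b = c and c = e]
    swap(1)[where a = b and b = c and c = f] swap(5)[where a = b and b = c and c = f]
    swap(1)[where a = b and b = d and c = e] swap(5)[where a = b and b = d and c = e]
    swap(1)[where a = b and b = d and c = f] swap(5)[where a = b and b = d and c = f]
    swap(1)[where a = b and b = e and c = f] swap(5)[where a = b and b = e and c = f]
    swap(1)[where a = c and b = d and c = e] swap(5)[where a = c and b = d and c = e]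
    swap(1)[where a = c and b = d and c = f] swap(5)[where a = c and b = d and c = f]
    swap(1)[where a = c and b = e and c = f] swap(5)[where a = c and b = e and c = f]
    swap(1)[where a = d and b = e and c = f] swap(5)[where a = d and b = e and c = f] algebra_simps)

text \<open>\<open>K_trace\<close> is applied with \<open>K x\<close> as first argument. The
  derivation given by \<open>K\<close> meets two slots of i_x \<phi> and three of \<phi> in the
  product i_x \<phi> \<and> \<phi>, which yields 2 i_x \<psi> \<and> \<phi> + 3 i_x \<phi> \<and>
  \<psi>; the term with \<open>K (K x)\<close> raises the first coefficient to 3.\<close>

lemma V_K_K:
  "V (K (K x)) a b c d e = wedge23 (\<phi> x) \<psi> a b c d e"
  "wedge23 (\<psi> x) \<phi> a b c d e = - wedge23 (\<phi> x) \<psi> a b c d e"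
proof -
  have 1: "V (K (K x)) a b c d e = - wedge23 (\<psi> x) \<phi> a b c d e"
    unfolding V_K wedge23_def \<psi>_def by simp
  have "V (K (K x)) a b c d e + V (K x) (K a) b c d e + V (K x) a (K b) c d e + V (K x) a b (K c) d e
    + V (K x) a b c (K d) e + V (K x) a b c d (K e) = 0"
    by (rule K_trace)
  then have "- wedge23 (\<psi> x) \<phi> a b c d e - (2 * wedge23 (\<psi> x) \<phi> a b c d e + 3 * wedge23 (\<phi> x) \<psi> a b c d e) = 0"
    unfolding 1 V_K[of x] by (simp add: wedge23_def K_shift flip: \<psi>_def)
  with 1 show "V (K (K x)) a b c d e = wedge23 (\<phi> x) \<psi> a b c d e"
    "wedge23 (\<psi> x) \<phi> a b c d e = - wedge23 (\<phi> x) \<psi> a b c d e" by linarith+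
qed

text \<open>The 6-form \<phi> \<and> \<psi> is a multiple of \<open>vol\<close>. Its contraction
  with \<open>x\<close> is i_x \<phi> \<and> \<psi> - i_x \<psi> \<and> \<phi>, twice the
  contraction of \<open>vol\<close> with \<open>K (K x)\<close>; hence the factor 2 between the two
  scalars.\<close>

lemma K_K: "\<exists>r. (\<forall>x. K (K x) = r *\<^sub>R x) \<and> (\<forall>a b c d e f. wedge33 \<phi> \<psi> a b c d e f = 2 * r * V a b c d e f)"
proof -
  obtain r where r: "wedge33 \<phi> \<psi> a b c d e f = r * V a b c d e f" for a b c d e f
    using wedge33_multiple[OF alt alt_\<psi>] by blast
  have "V (K (K x)) a b c d e = V ((r / 2) *\<^sub>R x) a b c d e" for x a b c d e
    using r[of x a b c d e, unfolded wedge33_def V_K_K(2)] unfolding V_K_K(1) linear_cmul[OF V_linear(1)]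
    by simp
  then have "\<forall>x. K (K x) = (r / 2) *\<^sub>R x" by (blast intro: V_cancel)
  moreover have "\<forall>a b c d e f. wedge33 \<phi> \<psi> a b c d e f = 2 * (r / 2) * V a b c d e f"
    unfolding r by simp
  ultimately show ?thesis by blast
qed

end

section \<open>First-order jets\<close>

text \<open>Derivatives at one point, treated as algebraic data: \<open>T z\<close>,
  \<open>S z\<close>, \<open>M z\<close> and \<open>\<mu> z\<close> stand for the derivatives of
  \<phi>, \<psi>, \<open>K\<close> and \<kappa> in direction \<open>z\<close>, and
  \<open>\<eta> z\<close> for the logarithmic derivative of \<open>vol\<close>. The equations are
  product rules for the identities of \<open>three_form\<close>; \<open>closed_T\<close> and
  \<open>closed_S\<close> say d \<phi> = 0 and d \<psi> = 0.\<close>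

locale three_form_jet = three_form +
  fixes T S :: "real ^ 6 \<Rightarrow> real ^ 6 \<Rightarrow> real ^ 6 \<Rightarrow> real ^ 6 \<Rightarrow> real"
    and M :: "real ^ 6 \<Rightarrow> real ^ 6 \<Rightarrow> real ^ 6"
    and \<eta> \<mu> :: "real ^ 6 \<Rightarrow> real" and \<kappa> :: real
  assumes alt_T: "alt3 (T x)" and alt_S: "alt3 (S x)" and linear_\<eta>: "linear \<eta>"
    and V_M: "V (M z x) a b c d e + \<eta> z * V (K x) a b c d e =
      - wedge23 (T z x) \<phi> a b c d e - wedge23 (\<phi> x) (T z) a b c d e"
    and S_eq: "S z a b c = T z (K a) b c + \<phi> (M z a) b c"
    and K_K: "K (K x) = \<kappa> *\<^sub>R x"
    and K_M: "K (M z x) + M z (K x) = \<mu> z *\<^sub>R x"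
    and wedge_\<psi>': "wedge23 (T z x) \<psi> a b c d e + wedge23 (\<phi> x) (S z) a b c d e = (\<mu> z + \<kappa> * \<eta> z) * V x a b c d e"
    and closed_T: "T a b c d - T b a c d + T c a b d - T d a b c = 0"
    and closed_S: "S a b c d - S b a c d + S c a b d - S d a b c = 0"
begin

text \<open>For constant fields [K x, y] = - M y x, [x, K y] = M x y and [K x, K y] = M (K x) y - M
  (K y) x, so the vector on the left is the Nijenhuis tensor.\<close>

lemma V_nijenhuis:
  "V (K (M x y) - K (M y x) - M (K x) y + M (K y) x) a b c d e =
    wedge23 (\<phi> y) (S x) a b c d e + wedge23 (\<psi> y) (T x) a b c d e"
proof -
  \<comment> \<open>This disposes of \<eta>. The terms with \<eta> (K x) and \<eta> (K y) are traded
    by \<open>V_seven\<close> for \<eta> at the free arguments times V (K x) (K y); by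
    \<open>P\<close>, which is \<open>V_M\<close> with a free argument as direction, these are again
    wedge products.\<close>
  have P: "\<eta> z * V (K x) (K y) b c d e = - wedge23 (T z x) \<phi> (K y) b c d e - wedge23 (\<phi> x) (T z) (K y) b c d e
      - wedge23 (\<phi> y) \<phi> (M z x) b c d e" for z b c d e
    using V_M[of z x "K y" b c d e] V_K[of y "M z x" b c d e] V_swap(1)[of "K y" "M z x" b c d e] by linarith
  have f\<phi>: "\<phi> (M x y) p q = S x y p q - T x (K y) p q" for x y p q
    using S_eq[of x y p q] by simp
  have closed_T': "T a b c d = T b a c d - T c a b d + T d a b c" for a b c d
    using closed_T[of a b c d] by simp
  have closed_S': "S a b c d = S b a c d - S c a b d + S d a b c" for a b c d
    using closed_S[of a b c d] by simp
  \<comment> \<open>Closedness of \<phi> exchanges the derivative in direction \<open>K x\<close>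
    for derivatives in the directions of the arguments, where \<open>K x\<close> has become an
    argument and the product rule applies.\<close>
  have TK: "T (K x) p q r = T p (K x) q r - S q x p r + \<phi> (M q x) p r + S r x p q - \<phi> (M r x) p q" for x p q r
    using closed_T[of "K x" p q r] S_eq[of q x p r] S_eq[of r x p q] by linarith
  have TS: "T z (K x) p q = S z x p q - \<phi> (M z x) p q" for z x p q
    using S_eq[of z x p q] by simp
  have TS': "T z x (K y) p = S z x y p + \<phi> (M z y) x p" for z p
    using S_eq[of z y x p] alt3_swap(1)[OF alt_S, where a = x and b = y] alt3_swap(1)[OF alt_T, where a = x and b = "K y"]
    by simp
  have SS: "S z y x p = - S z x y p" for z p
    by (rule alt3_swap(1)[OF alt_S])
  have \<phi>M: "\<phi> y (M z x) p = - \<phi> (M z x) y p" for z p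
    by (rule swap(1))
  have "V (K (M x y) - K (M y x) - M (K x) y + M (K y) x) a b c d e =
      V (K (M x y)) a b c d e - V (K (M y x)) a b c d e - V (M (K x) y) a b c d e + V (M (K y) x) a b c d e"
    by (simp add: linear_add[OF V_linear(1)] linear_diff[OF V_linear(1)])
  also have "\<dots> = - wedge23 (\<phi> (M x y)) \<phi> a b c d e + wedge23 (\<phi> (M y x)) \<phi> a b c d e
      + wedge23 (T (K x) y) \<phi> a b c d e + wedge23 (\<phi> y) (T (K x)) a b c d e
      - wedge23 (T (K y) x) \<phi> a b c d e - wedge23 (\<phi> x) (T (K y)) a b c d e
      - \<eta> a * V (K x) (K y) b c d e + \<eta> b * V (K x) (K y) a c d e - \<eta> c * V (K x) (K y) a b d e
      + \<eta> d * V (K x) (K y) a b c e - \<eta> e * V (K x) (K y) a b c d"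
    using V_K[of "M x y" a b c d e] V_K[of "M y x" a b c d e] V_M[of "K x" y a b c d e] V_M[of "K y" x a b c d e]
      V_seven[OF linear_\<eta>, of "K x" "K y" a b c d e]
    by linarith
  also have "\<dots> = wedge23 (\<phi> y) (S x) a b c d e + wedge23 (\<psi> y) (T x) a b c d e"
    unfolding P wedge23_def \<psi>_def
    \<comment> \<open>For each quadruple listed, closedness eliminates the value whose derivative
      direction comes first in the order x, y, a, ..., e. \<open>TS\<close> and \<open>TS'\<close>
      then trade the values of T at \<open>K x\<close> and \<open>K y\<close> for S and M, which
      leaves a polynomial identity.\<close>
    by (simp only: TK[of x y a b] TK[of y x a b] closed_S'[of x y a b] f\<phi>[of x y a b] f\<phi>[of y x a b]
    TK[of x y a c] TK[of y x a c] closed_S'[of x y a c] f\<phi>[of x y a c] f\<phi>[of y x a c]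
    TK[of x y a d] TK[of y x a d] closed_S'[of x y a d] f\<phi>[of x y a d] f\<phi>[of y x a d]
    TK[of x y a e] TK[of y x a e] closed_S'[of x y a e] f\<phi>[of x y a e] f\<phi>[of y x a e]
    TK[of x y b c] TK[of y x b c] closed_S'[of x y b c] f\<phi>[of x y b c] f\<phi>[of y x b c]
    TK[of x y b d] TK[of y x b d] closed_S'[of x y b d] f\<phi>[of x y b d] f\<phi>[of y x b d]
    TK[of x y b e] TK[of y x b e] closed_S'[of x y b e] f\<phi>[of x y b e] f\<phi>[of y x b e]
    TK[of x y c d] TK[of y x c d] closed_S'[of x y c d] f\<phi>[of x y c d] f\<phi>[of y x c d]
    TK[of x y c e] TK[of y x c e] closed_S'[of x y c e] f\<phi>[of x y c e] f\<phi>[of y x c e]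
    TK[of x y d e] TK[of y x d e] closed_S'[of x y d e] f\<phi>[of x y d e] f\<phi>[of y x d e]
    TK[of x a b c] TK[of y a b c] closed_T'[of x a b c] closed_S'[of x a b c]
    TK[of x a b d] TK[of y a b d] closed_T'[of x a b d] closed_S'[of x a b d]
    TK[of x a b e] TK[of y a b e] closed_T'[of x a b e] closed_S'[of x a b e]
    TK[of x a c d] TK[of y a c d] closed_T'[of x a c d] closed_S'[of x a c d]
    TK[of x a c e] TK[of y a c e] closed_T'[of x a c e] closed_S'[of x a c e]
    TK[of x a d e] TK[of y a d e] closed_T'[of x a d e] closed_S'[of x a d e]
    TK[of x b c d] TK[of y b c d] closed_T'[of x b c d] closed_S'[of x b c d]
    TK[of x b c e] TK[of y b c e] closed_T'[of x b c e] closed_S'[of x b c e]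
    TK[of x b d e] TK[of y b d e] closed_T'[of x b d e] closed_S'[of x b d e]
    TK[of x c d e] TK[of y c d e] closed_T'[of x c d e] closed_S'[of x c d e]
    closed_T'[of a b c d]
    closed_T'[of a b c e]
    closed_T'[of a b d e]
    closed_T'[of a c d e]
    closed_T'[of b c d e],
      simp only: K_shift TS TS' SS \<phi>M, simp add: algebra_simps)
  finally show ?thesis .
qed

end

section \<open>Traces of the jets and the value of the Nijenhuis tensor\<close>

context three_form_jet
begin

text \<open>The argument for \<open>K_trace\<close>, differentiated: as \<phi> and T z have odd
  degree, T z \<and> \<phi> + \<phi> \<and> T z = 0, and the \<eta>-terms cancel because
  \<open>K\<close> is traceless.\<close>

lemma M_trace:
  "V (M z a) b c d e f
      + V a (M z b) c d e f
      + V a b (M z c) d e f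
      + V a b c (M z d) e f
      + V a b c d (M z e) f
      + V a b c d e (M z f) = 0"
proof -
  have 1: "V (M z x) p q r s t = - wedge23 (T z x) \<phi> p q r s t - wedge23 (\<phi> x) (T z) p q r s t - \<eta> z * V (K x) p q r s t"
    for x p q r s t
    using V_M[of z x p q r s t] by simp
  note sT = alt3_swap[OF alt_T[of z]]
  show ?thesis
    unfolding V_swap(1)[of a "M z b"] V_front(1)[of a b "M z c"] V_front(2)[of a b c "M z d"]
      V_front(3)[of a b c d "M z e"] V_front(4)[of a b c d e "M z f"] 1 V_K wedge23_def
    by (simp add: swap(1)[where a = a and b = b and c = c] swap(5)[where a = a and b = b and c = c]
      swap(1)[where a = a and b = b and c = d] swap(5)[where a = a and b = b and c = d]
      swap(1)[where a = a and b = b and c = e] swap(5)[where a = a and b = b and c = e]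
      swap(1)[where a = a and b = b and c = f] swap(5)[where a = a and b = b and c = f]
      swap(1)[where a = a and b = c and c = d] swap(5)[where a = a and b = c and c = d]
      swap(1)[where a = a and b = c and c = e] swap(5)[where a = a and b = c and c = e]
      swap(1)[where a = a and b = c and c = f] swap(5)[where a = a and b = c and c = f]
      swap(1)[where a = a and b = d and c = e] swap(5)[where a = a and b = d and c = e]
      swap(1)[where a = a and b = d and c = f] swap(5)[where a = a and b = d and c = f]
      swap(1)[where a = a and b = e and c = f] swap(5)[where a = a and b = e and c = f]
      swap(1)[where a = b and b = c and c = d] swap(5)[where a = b and b = c and c = d]
      swap(1)[where a = b and b = c and c = e] swap(5)[where a = b and b = c and c = e]
      swap(1)[where a = b and b = c and c = f] swap(5)[where a = b and b = c and c = f]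
      swap(1)[where a = b and b = d and c = e] swap(5)[where a = b and b = d and c = e]
      swap(1)[where a = b and b = d and c = f] swap(5)[where a = b and b = d and c = f]
      swap(1)[where a = b and b = e and c = f] swap(5)[where a = b and b = e and c = f]
      swap(1)[where a = c and b = d and c = e] swap(5)[where a = c and b = d and c = e]
      swap(1)[where a = c and b = d and c = f] swap(5)[where a = c and b = d and c = f]
      swap(1)[where a = c and b = e and c = f] swap(5)[where a = c and b = e and c = f]
      swap(1)[where a = d and b = e and c = f] swap(5)[where a = d and b = e and c = f]
      sT(1)[where a = a and b = b and c = c] sT(5)[where a = a and b = b and c = c]
        sT(1)[where a = a and b = b and c = d] sT(5)[where a = a and b = b and c = d]
        sT(1)[where a = a and b = b and c = e] sT(5)[where a = a and b = b and c = e]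
        sT(1)[where a = a and b = b and c = f] sT(5)[where a = a and b = b and c = f]
        sT(1)[where a = a and b = c and c = d] sT(5)[where a = a and b = c and c = d]
        sT(1)[where a = a and b = c and c = e] sT(5)[where a = a and b = c and c = e]
        sT(1)[where a = a and b = c and c = f] sT(5)[where a = a and b = c and c = f]
        sT(1)[where a = a and b = d and c = e] sT(5)[where a = a and b = d and c = e]
        sT(1)[where a = a and b = d and c = f] sT(5)[where a = a and b = d and c = f]
        sT(1)[where a = a and b = e and c = f] sT(5)[where a = a and b = e and c = f]
        sT(1)[where a = b and b = c and c = d] sT(5)[where a = b and b = c and c = d]
        sT(1)[where a = b and b = c and c = e] sT(5)[where a = b and b = c and c = e]
        sT(1)[where a = b and b = c and c = f] sT(5)[where a = b and b = c and c = f]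
        sT(1)[where a = b and b = d and c = e] sT(5)[where a = b and b = d and c = e]
        sT(1)[where a = b and b = d and c = f] sT(5)[where a = b and b = d and c = f]
        sT(1)[where a = b and b = e and c = f] sT(5)[where a = b and b = e and c = f]
        sT(1)[where a = c and b = d and c = e] sT(5)[where a = c and b = d and c = e]
        sT(1)[where a = c and b = d and c = f] sT(5)[where a = c and b = d and c = f]
        sT(1)[where a = c and b = e and c = f] sT(5)[where a = c and b = e and c = f]
        sT(1)[where a = d and b = e and c = f] sT(5)[where a = d and b = e and c = f] algebra_simps)
qed

lemma V_first_diff:
  "V a b c d e f + V a' b c d e f = V (a + a') b c d e f" "r * V a b c d e f = V (r *\<^sub>R a) b c d e f"
  by (simp_all add: linear_add[OF V_linear(1)] linear_cmul[OF V_linear(1)])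

text \<open>Inserting \<open>M z\<close> into one slot of \<open>K_trace\<close> and
  \<open>K\<close> into one slot of \<open>M_trace\<close> produces the same mixed terms; their
  comparison is the equality of the traces of K M and M K. The sum of the two is 6 \<mu> by
  \<open>K_M\<close>, so each is 3 \<mu>.\<close>

lemma V_K_M_trace:
  "V (K (M z a)) b c d e f
      + V a (K (M z b)) c d e f
      + V a b (K (M z c)) d e f
      + V a b c (K (M z d)) e f
      + V a b c d (K (M z e)) f
      + V a b c d e (K (M z f)) = 3 * \<mu> z * V a b c d e f"
proof -
  have 1: "V (K (M z x)) p q r s t + V (M z (K x)) p q r s t = \<mu> z * V x p q r s t" for x p q r s t
    using K_M[of z x] by (simp add: V_first_diff)
  have s1: "V a (K (M z b)) c d e f + V a (M z (K b)) c d e f = \<mu> z * V a b c d e f"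
    using 1[of b a c d e f] V_swap(1)[of a "K (M z b)" c d e f] V_swap(1)[of a "M z (K b)" c d e f]
      V_swap(1)[of a "b" c d e f] by simp
  have s2: "V a b (K (M z c)) d e f + V a b (M z (K c)) d e f = \<mu> z * V a b c d e f"
    using 1[of c a b d e f] V_front(1)[of a b "K (M z c)" d e f] V_front(1)[of a b "M z (K c)" d e f]
      V_front(1)[of a b "c" d e f] by simp
  have s3: "V a b c (K (M z d)) e f + V a b c (M z (K d)) e f = \<mu> z * V a b c d e f"
    using 1[of d a b c e f] V_front(2)[of a b c "K (M z d)" e f] V_front(2)[of a b c "M z (K d)" e f]
      V_front(2)[of a b c "d" e f] by simp
  have s4: "V a b c d (K (M z e)) f + V a b c d (M z (K e)) f = \<mu> z * V a b c d e f"
    using 1[of e a b c d f] V_front(3)[of a b c d "K (M z e)" f] V_front(3)[of a b c d "M z (K e)" f]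
      V_front(3)[of a b c d "e" f] by simp
  have s5: "V a b c d e (K (M z f)) + V a b c d e (M z (K f)) = \<mu> z * V a b c d e f"
    using 1[of f a b c d e] V_front(4)[of a b c d e "K (M z f)"] V_front(4)[of a b c d e "M z (K f)"]
      V_front(4)[of a b c d e "f"] by simp
  show ?thesis
    using K_trace[of "M z a" b c d e f] K_trace[of a "M z b" c d e f] K_trace[of a b "M z c" d e f]
      K_trace[of a b c "M z d" e f] K_trace[of a b c d "M z e" f] K_trace[of a b c d e "M z f"]
      M_trace[of z "K a" b c d e f] M_trace[of z a "K b" c d e f] M_trace[of z a b "K c" d e f]
        M_trace[of z a b c "K d" e f] M_trace[of z a b c d "K e" f] M_trace[of z a b c d e "K f"]
      1[of a b c d e f] s1 s2 s3 s4 s5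
    by linarith
qed

text \<open>\<open>S_eq\<close> singles out one slot, so \<open>S3\<close> averages it over all
  three. Then 3 \<phi> \<and> S splits into 3 T \<and> \<psi>, the trace of K M, and the derivation
  of \<open>K\<close> applied to the top form \<phi> \<and> T, which vanishes since \<open>K\<close>
  is traceless.\<close>

lemma wedge_\<phi>_S: "wedge33 \<phi> (S z) a b c d e f = wedge33 (T z) \<psi> a b c d e f + \<mu> z * V a b c d e f"
proof -
  obtain r where r: "wedge33 \<phi> (T z) a b c d e f = r * V a b c d e f" for a b c d e f
    using wedge33_multiple[OF alt alt_T] by blast
  have 0: "wedge33 \<phi> (T z) (K a) b c d e f
      + wedge33 \<phi> (T z) a (K b) c d e f
      + wedge33 \<phi> (T z) a b (K c) d e f
      + wedge33 \<phi> (T z) a b c (K d) e f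
      + wedge33 \<phi> (T z) a b c d (K e) f
      + wedge33 \<phi> (T z) a b c d e (K f) = 0"
    using K_trace[of a b c d e f] unfolding r by (simp flip: distrib_left)
  have S3: "S z p q r = (T z (K p) q r - T z (K q) p r + T z (K r) p q + \<phi> (M z p) q r - \<phi> (M z q) p r + \<phi> (M z r) p q) / 3"
    for p q r
    using S_eq[of z p q r] S_eq[of z q p r] S_eq[of z r p q] alt3_swap(1)[OF alt_S, where a = p and b = q and c = r]
      alt3_swap(5)[OF alt_S, where a = p and b = q and c = r] by simp
  have TK: "T z p (K q) r = - T z (K q) p r" "T z p q (K r) = T z (K r) p q" for p q r
    using alt3_swap(1)[OF alt_T, where a = p and b = "K q"] alt3_swap(4)[OF alt_T, where a = "K r" and b = p and c = q]
    by simp_all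
  have V_K_M: "V (K (M z x)) p q r s t = - wedge23 (\<phi> (M z x)) \<phi> p q r s t" for x p q r s t
    by (rule V_K)
  have "3 * wedge33 \<phi> (S z) a b c d e f = 3 * wedge33 (T z) \<psi> a b c d e f + (V (K (M z a)) b c d e f
      + V a (K (M z b)) c d e f
      + V a b (K (M z c)) d e f
      + V a b c (K (M z d)) e f
      + V a b c d (K (M z e)) f
      + V a b c d e (K (M z f)))
     + (wedge33 \<phi> (T z) (K a) b c d e f
      + wedge33 \<phi> (T z) a (K b) c d e f
      + wedge33 \<phi> (T z) a b (K c) d e f
      + wedge33 \<phi> (T z) a b c (K d) e f
      + wedge33 \<phi> (T z) a b c d (K e) f
      + wedge33 \<phi> (T z) a b c d e (K f))"
    unfolding V_swap(1)[of a "K (M z b)"] V_front(1)[of a b "K (M z c)"] V_front(2)[of a b c "K (M z d)"]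
      V_front(3)[of a b c d "K (M z e)"] V_front(4)[of a b c d e "K (M z f)"] V_K_M wedge33_def wedge23_def
    by (simp only: S3[of a b c] S3[of a b d] S3[of a b e] S3[of a b f] S3[of a c d] S3[of a c e] S3[of a c f]
      S3[of a d e] S3[of a d f] S3[of a e f] S3[of b c d] S3[of b c e] S3[of b c f] S3[of b d e] S3[of b d f]
      S3[of b e f] S3[of c d e] S3[of c d f] S3[of c e f] S3[of d e f],
      simp only: K_shift TK flip: \<psi>_def, simp add: field_simps)
  then show ?thesis using 0 V_K_M_trace[of z a b c d e f] by simp
qed

text \<open>\<open>V_M\<close> at \<open>K a\<close> gives the derivative of i_a \<psi> \<and>
  \<phi> = - \<kappa> i_a vol, the mirror image of \<open>wedge_\<psi>'\<close>. The difference of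
  the two evaluates T \<and> \<psi> + \<phi> \<and> S as 2 (\<mu> + \<kappa> \<eta>) vol, and
  \<open>wedge_\<phi>_S\<close> separates the summands.\<close>

lemma wedge_T_\<psi>: "wedge33 (T z) \<psi> a b c d e f = (\<mu> z / 2 + \<kappa> * \<eta> z) * V a b c d e f"
proof -
  have "V (K (M z a)) b c d e f + V (M z (K a)) b c d e f = \<mu> z * V a b c d e f"
    using K_M[of z a] by (simp add: V_first_diff)
  moreover have "wedge23 (S z a) \<phi> b c d e f = wedge23 (T z (K a)) \<phi> b c d e f + wedge23 (\<phi> (M z a)) \<phi> b c d e f"
    unfolding wedge23_def S_eq by (simp add: algebra_simps)
  moreover have "wedge23 (\<phi> (K a)) (T z) b c d e f = wedge23 (\<psi> a) (T z) b c d e f"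
    unfolding wedge23_def \<psi>_def ..
  moreover have "V (K (K a)) b c d e f = \<kappa> * V a b c d e f"
    by (simp add: K_K V_first_diff)
  ultimately have "wedge23 (S z a) \<phi> b c d e f + wedge23 (\<psi> a) (T z) b c d e f = - (\<mu> z + \<kappa> * \<eta> z) * V a b c d e f"
    using V_M[of z "K a" b c d e f] V_K[of "M z a" b c d e f] by (simp add: algebra_simps)
  then show ?thesis
    using wedge_\<psi>'[of z a b c d e f] wedge_\<phi>_S[of z a b c d e f] unfolding wedge33_def
    by (simp add: field_simps)
qed

text \<open>Since the right-hand side need not vanish for \<open>x = y\<close>, antisymmetry forces \<open>\<mu> = 0\<close>.\<close>

lemma nijenhuis_eq:
  "K (M x y) - K (M y x) - M (K x) y + M (K y) x = (\<mu> x / 2) *\<^sub>R y"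
proof (rule V_cancel)
  fix a b c d e
  \<comment> \<open>The left-hand side is the expression of \<open>wedge_\<psi>'\<close> minus that
    of \<open>wedge_T_\<psi>\<close>; both contain \<kappa> \<eta>, so the variation of
    \<open>vol\<close> drops out and \<mu> - \<mu> / 2 remains.\<close>
  have "wedge23 (\<phi> y) (S x) a b c d e + wedge23 (\<psi> y) (T x) a b c d e = (\<mu> x / 2) * V y a b c d e"
    using wedge_T_\<psi>[of x y a b c d e] wedge_\<psi>'[of x y a b c d e]
    unfolding wedge33_def by (simp add: field_simps)
  then show "V (K (M x y) - K (M y x) - M (K x) y + M (K y) x) a b c d e = V ((\<mu> x / 2) *\<^sub>R y) a b c d e"
    unfolding V_nijenhuis by (simp add: linear_cmul[OF V_linear(1)])
qed

lemma \<mu>_zero: "\<mu> x = 0" if "linear \<mu>"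
proof (cases "x = 0")
  case False
  then show ?thesis using nijenhuis_eq[of x x] by simp
qed (use that linear_0 in auto)

lemma nijenhuis_zero:
  assumes "linear \<mu>"
  shows "K (M x y) - K (M y x) - M (K x) y + M (K y) x = 0"
  using nijenhuis_eq \<mu>_zero[OF assms] by simp

end

section \<open>The quartic invariant and stability\<close>

text \<open>\<open>K_form\<close> with the volume form as an independent argument, which can then be
  rescaled or pulled back separately from the 3-form.\<close>

definition endo :: "(real ^ 6) form \<Rightarrow> (real ^ 6) form \<Rightarrow> real ^ 6 \<Rightarrow> real ^ 6" where
  "endo vol \<alpha> X = (THE Y. interior_product Y vol = (\<lambda>v. - wedge 2 3 (interior_product X \<alpha>) \<alpha> v))"

lemma curry3_interior: "curry2 (interior_product X \<alpha>) = curry3 \<alpha> X"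
  by (simp add: fun_eq_iff curry2_def curry3_def interior_product_def case_nat_nth)

context volume6
begin

lemma endo_eq:
  assumes \<alpha>: "alternating_form 3 \<alpha>"
  shows "interior_product (endo vol \<alpha> X) vol = (\<lambda>v. - wedge 2 3 (interior_product X \<alpha>) \<alpha> v)"
proof -
  have 2: "alternating_form 2 (interior_product X \<alpha>)"
    using alternating_form_interior[of 2 \<alpha> X] \<alpha> by simp
  have "alternating_form 5 (\<lambda>v. - wedge 2 3 (interior_product X \<alpha>) \<alpha> v)"
    using alternating_form_scale[OF alternating_form_wedge[OF 2 \<alpha>], of "- 1"] by simp
  from ex1_interior[OF this] show ?thesis unfolding endo_def by (rule theI')
qed

lemma three_form_endo:
  assumes \<alpha>: "alternating_form 3 \<alpha>"
  shows "three_form vol (curry3 \<alpha>) (endo vol \<alpha>)"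
proof unfold_locales
  show "alt3 (curry3 \<alpha>)" by (rule alt3_curry3[OF \<alpha>])
  have 2: "alternating_form 2 (interior_product X \<alpha>)" for X
    using alternating_form_interior[of 2 \<alpha> X] \<alpha> by simp
  show "V (endo vol \<alpha> x) a b c d e = - wedge23 (curry3 \<alpha> x) (curry3 \<alpha>) a b c d e" for x a b c d e
    using fun_cong[OF endo_eq[OF \<alpha>, of x], of "(!) [a, b, c, d, e]"]
    unfolding wedge_2_3[OF 2 \<alpha>] curry3_interior
    by (simp add: interior_product_def case_nat_nth curry6_def)
qed

lemma three_form_unique:
  assumes "three_form vol \<phi> K" "three_form vol \<phi> K'"
  shows "K = K'"
proof
  fix x
  show "K x = K' x"
    by (rule V_cancel) (simp add: three_form.V_K[OF assms(1)] three_form.V_K[OF assms(2)])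
qed

end

text \<open>The scalar \<kappa>, well defined by \<open>K_K\<close> since the space is nonzero; it
  has degree 4 in the form and degree -2 in \<open>vol\<close>.\<close>

definition disc :: "(real ^ 6) form \<Rightarrow> (real ^ 6) form \<Rightarrow> real" where
  "disc vol \<alpha> = (THE r. \<forall>x. endo vol \<alpha> (endo vol \<alpha> x) = r *\<^sub>R x)"

context three_form
begin

lemma square_unique:
  assumes "\<forall>x. K (K x) = r *\<^sub>R x" "\<forall>x. K (K x) = s *\<^sub>R x"
  shows "r = s"
proof -
  obtain a :: "real ^ 6" where "a \<noteq> 0" using nonempty_Basis nonzero_Basis by blast
  then show ?thesis using assms by (metis scaleR_cancel_right)
qed

end

lemma (in volume6) disc_eqI:
  assumes "three_form vol (curry3 \<alpha>) K" "alternating_form 3 \<alpha>" "\<And>x. K (K x) = r *\<^sub>R x"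
  shows "disc vol \<alpha> = r"
proof -
  interpret f: three_form vol "curry3 \<alpha>" K by fact
  have "endo vol \<alpha> = K"
    using three_form_unique[OF three_form_endo[OF assms(2)] assms(1)] .
  then show ?thesis
    unfolding disc_def using assms(3) f.square_unique by (intro the_equality) auto
qed

lemma (in volume6) disc_eq:
  assumes \<alpha>: "alternating_form 3 \<alpha>"
  shows "endo vol \<alpha> (endo vol \<alpha> x) = disc vol \<alpha> *\<^sub>R x"
    "wedge33 (curry3 \<alpha>) (three_form.\<psi> (curry3 \<alpha>) (endo vol \<alpha>)) a b c d e f = 2 * disc vol \<alpha> * V a b c d e f"
proof -
  interpret f: three_form vol "curry3 \<alpha>" "endo vol \<alpha>" by (rule three_form_endo[OF \<alpha>])
  obtain r where r: "\<forall>x. endo vol \<alpha> (endo vol \<alpha> x) = r *\<^sub>R x"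
    "\<forall>a b c d e g. wedge33 (curry3 \<alpha>) f.\<psi> a b c d e g = 2 * r * V a b c d e g"
    using f.K_K by blast
  then have "disc vol \<alpha> = r"
    by (intro disc_eqI[OF f.three_form_axioms \<alpha>]) simp
  then show "endo vol \<alpha> (endo vol \<alpha> x) = disc vol \<alpha> *\<^sub>R x"
    "wedge33 (curry3 \<alpha>) f.\<psi> a b c d e f = 2 * disc vol \<alpha> * V a b c d e f" using r by simp_all
qed

section \<open>Behaviour of the discriminant under pullback and rescaling\<close>

lemma alternating_form_pullback:
  assumes "linear g" "alternating_form k \<alpha>"
  shows "alternating_form k (pullback g \<alpha>)"
proof -
  have upd: "(\<lambda>j. g ((v(i := u)) j)) = (\<lambda>j. g (v j))(i := g u)" for v i u by auto
  have "pullback g \<alpha> v = pullback g \<alpha> w" if "\<forall>i<k. v i = w i" for v w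
    unfolding pullback_def using that by (intro alternating_form_cong[OF assms(2)]) simp
  moreover have "linear (\<lambda>u. pullback g \<alpha> (v(i := u)))" if "i < k" for v i
    unfolding pullback_def upd
    using linear_compose[OF assms(1) alternating_form_linear[OF assms(2) that]] by (simp add: o_def)
  moreover have "pullback g \<alpha> v = 0" if "i < k" "j < k" "i \<noteq> j" "v i = v j" for v i j
    unfolding pullback_def using that by (intro alternating_form_zero[OF assms(2), of i j]) auto
  ultimately show ?thesis unfolding alternating_form_def by blast
qed

lemma wedge_pullback: "wedge p q (pullback g \<alpha>) (pullback g \<beta>) = pullback g (wedge p q \<alpha> \<beta>)"
  by (simp add: wedge_def pullback_def fun_eq_iff)

lemma curry3_pullback:
  assumes "alternating_form 3 \<alpha>"
  shows "curry3 (pullback g \<alpha>) a b c = curry3 \<alpha> (g a) (g b) (g c)"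
  by (subst curry3_def) (simp add: pullback_def curry3_eq[OF assms])

lemma curry6_pullback:
  assumes "alternating_form 6 \<alpha>"
  shows "curry6 (pullback g \<alpha>) a b c d e f = curry6 \<alpha> (g a) (g b) (g c) (g d) (g e) (g f)"
  by (subst curry6_def) (simp add: pullback_def curry6_eq[OF assms])

lemma volume6_pullback:
  assumes "volume6 vol" "linear g" "bij g"
  shows "volume6 (pullback g vol)"
proof -
  interpret volume6 vol by fact
  obtain v where "vol v \<noteq> 0" using nonzero by blast
  then have "pullback g vol (\<lambda>i. inv g (v i)) \<noteq> 0"
    by (simp add: pullback_def surj_f_inv_f[OF bij_is_surj[OF assms(3)]])
  then show ?thesis
    using alternating_form_pullback[OF assms(2) alternating] by unfold_locales blast+
qed

text \<open>Conjugating \<open>K\<close> by \<open>g\<close> solves the defining equation for the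
  pulled-back data, and the square of the conjugate is the same scalar.\<close>

lemma disc_pullback:
  assumes vol: "volume6 vol" and g: "linear g" "bij g" and \<alpha>: "alternating_form 3 \<alpha>"
  shows "disc (pullback g vol) (pullback g \<alpha>) = disc vol \<alpha>"
proof -
  interpret volume6 vol by fact
  interpret g: volume6 "pullback g vol" by (rule volume6_pullback[OF vol g])
  interpret f: three_form vol "curry3 \<alpha>" "endo vol \<alpha>" by (rule three_form_endo[OF \<alpha>])
  let ?K = "\<lambda>x. inv g (endo vol \<alpha> (g x))"
  have gi: "g (inv g x) = x" "inv g (g x) = x" for x
    using g(2) by (simp_all add: bij_is_surj surj_f_inv_f bij_is_inj)
  have p\<alpha>: "alternating_form 3 (pullback g \<alpha>)" by (rule alternating_form_pullback[OF g(1) \<alpha>])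
  show ?thesis
  proof (rule g.disc_eqI[of _ ?K])
    show "alternating_form 3 (pullback g \<alpha>)" by (rule p\<alpha>)
    show "three_form (pullback g vol) (curry3 (pullback g \<alpha>)) ?K"
    proof unfold_locales
      show "alt3 (curry3 (pullback g \<alpha>))" by (rule alt3_curry3[OF p\<alpha>])
      show "curry6 (pullback g vol) (?K x) a b c d e =
        - wedge23 (curry3 (pullback g \<alpha>) x) (curry3 (pullback g \<alpha>)) a b c d e" for x a b c d e
        unfolding curry6_pullback[OF alternating] gi f.V_K wedge23_def curry3_pullback[OF \<alpha>] ..
    qed
    show "?K (?K x) = disc vol \<alpha> *\<^sub>R x" for x
      using linear_cmul[OF g(1), of "disc vol \<alpha>" x] gi
      by (simp add: disc_eq(1)[OF \<alpha>]) metis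
  qed
qed

text \<open>Multiplying \<open>vol\<close> by \<open>c\<close> divides \<open>K\<close> by
  \<open>c\<close>; squaring contributes \<open>c\<^sup>2\<close>.\<close>

lemma disc_scale:
  assumes vol: "volume6 vol" and c: "c \<noteq> 0" and \<alpha>: "alternating_form 3 \<alpha>"
  shows "disc vol \<alpha> = c\<^sup>2 * disc (\<lambda>v. c * vol v) \<alpha>" "volume6 (\<lambda>v. c * vol v)"
proof -
  interpret volume6 vol by fact
  show g: "volume6 (\<lambda>v. c * vol v)"
    using nonzero c alternating_form_scale[OF alternating, of c] by unfold_locales auto
  interpret g: volume6 "\<lambda>v. c * vol v" by fact
  let ?K = "endo (\<lambda>v. c * vol v) \<alpha>"
  interpret f: three_form "\<lambda>v. c * vol v" "curry3 \<alpha>" ?K by (rule g.three_form_endo[OF \<alpha>])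
  show "disc vol \<alpha> = c\<^sup>2 * disc (\<lambda>v. c * vol v) \<alpha>"
  proof (rule disc_eqI[of _ "\<lambda>x. c *\<^sub>R ?K x"])
    show "three_form vol (curry3 \<alpha>) (\<lambda>x. c *\<^sub>R ?K x)"
    proof unfold_locales
      show "alt3 (curry3 \<alpha>)" by (rule alt3_curry3[OF \<alpha>])
      show "V (c *\<^sub>R ?K x) a b d e h = - wedge23 (curry3 \<alpha> x) (curry3 \<alpha>) a b d e h" for x a b d e h
        using f.V_K[of x a b d e h] by (simp add: linear_cmul[OF V_linear(1)]) (simp add: curry6_def)
    qed
    show "c *\<^sub>R ?K (c *\<^sub>R ?K x) = (c\<^sup>2 * disc (\<lambda>v. c * vol v) \<alpha>) *\<^sub>R x" for x
      by (simp add: linear_cmul[OF f.linear_K] g.disc_eq(1)[OF \<alpha>] power2_eq_square)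
  qed (rule \<alpha>)
qed

text \<open>Here \<open>vol\<close> stays fixed and \<open>c\<close> is the determinant of
  \<open>g\<close>; it enters squared, so orbits preserve the sign of \<kappa> even when
  \<open>g\<close> reverses the orientation.\<close>

lemma (in volume6) disc_pullback_sgn:
  assumes g: "linear g" "bij g" and \<alpha>: "alternating_form 3 \<alpha>"
  shows "sgn (disc vol (pullback g \<alpha>)) = sgn (disc vol \<alpha>)"
proof -
  interpret g: volume6 "pullback g vol" by (rule volume6_pullback[OF volume6_axioms g])
  obtain c where c: "pullback g vol v = c * vol v" for v
    using V_multiple[OF g.alternating] by blast
  have "c \<noteq> 0" using g.nonzero c by auto
  have "disc vol (pullback g \<alpha>) = c\<^sup>2 * disc (\<lambda>v. c * vol v) (pullback g \<alpha>)"
    by (rule disc_scale(1)[OF volume6_axioms \<open>c \<noteq> 0\<close> alternating_form_pullback[OF g(1) \<alpha>]])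
  also have "(\<lambda>v. c * vol v) = pullback g vol" using c by auto
  also have "disc (pullback g vol) (pullback g \<alpha>) = disc vol \<alpha>"
    by (rule disc_pullback[OF volume6_axioms g \<alpha>])
  finally have "disc vol (pullback g \<alpha>) = c\<^sup>2 * disc vol \<alpha>" .
  moreover have "sgn (c\<^sup>2) = 1" using \<open>c \<noteq> 0\<close> by (intro sgn_pos) simp
  ultimately show ?thesis by (simp only: sgn_mult mult_1)
qed

section \<open>Polynomial formulas for the discriminant\<close>

definition cubic :: "('v \<Rightarrow> 'v \<Rightarrow> 'v \<Rightarrow> real) \<Rightarrow> 'v \<Rightarrow> 'v \<Rightarrow> 'v \<Rightarrow> 'v \<Rightarrow> 'v \<Rightarrow> 'v \<Rightarrow> 'v \<Rightarrow> 'v \<Rightarrow> 'v \<Rightarrow> real" where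
  "cubic \<phi> a b c d e f x y z =
     - \<phi> a y z * wedge23 (\<phi> x) \<phi> b c d e f + \<phi> b y z * wedge23 (\<phi> x) \<phi> a c d e f
     - \<phi> c y z * wedge23 (\<phi> x) \<phi> a b d e f + \<phi> d y z * wedge23 (\<phi> x) \<phi> a b c e f
     - \<phi> e y z * wedge23 (\<phi> x) \<phi> a b c d f + \<phi> f y z * wedge23 (\<phi> x) \<phi> a b c d e"

text \<open>Both formulas eliminate \<open>K\<close> without division: \<open>cubic\<close> is
  \<psi> times the volume of the frame, by \<open>V_seven\<close> for the linear form \<phi> (_, y,
  z) at \<open>K x\<close>, and \<open>quartic\<close> is \<kappa> times the square of that volume.
  On a fixed frame, \<open>quartic\<close> is a polynomial in finitely many values of
  \<phi>.\<close>

definition quartic :: "('v \<Rightarrow> 'v \<Rightarrow> 'v \<Rightarrow> real) \<Rightarrow> 'v \<Rightarrow> 'v \<Rightarrow> 'v \<Rightarrow> 'v \<Rightarrow> 'v \<Rightarrow> 'v \<Rightarrow> real" where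
  "quartic \<phi> a b c d e f = wedge23 (\<phi> a) (cubic \<phi> a b c d e f) b c d e f"

lemma wedge23_scale:
  "wedge23 (\<lambda>x y. r * \<beta> x y) (\<lambda>x y z. s * \<gamma> x y z) a b c d e = r * s * wedge23 \<beta> \<gamma> a b c d e"
  by (simp add: wedge23_def algebra_simps)

lemma cubic_scale: "cubic (\<lambda>x y z. r * \<phi> x y z) a b c d e f = (\<lambda>x y z. r ^ 3 * cubic \<phi> a b c d e f x y z)"
  by (simp add: fun_eq_iff cubic_def wedge23_scale algebra_simps power3_eq_cube)

lemma (in three_form) \<psi>_cubic: "\<psi> x y z * V a b c d e f = cubic \<phi> a b c d e f x y z"
  unfolding \<psi>_def V_seven[OF lin(1), of "K x" y z a b c d e f] V_K cubic_def by simp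

lemma (in volume6) disc_quartic:
  assumes "alternating_form 3 \<alpha>"
  shows "disc vol \<alpha> * (V a b c d e f)\<^sup>2 = quartic (curry3 \<alpha>) a b c d e f"
proof -
  interpret f: three_form vol "curry3 \<alpha>" "endo vol \<alpha>" by (rule three_form_endo[OF assms])
  have "disc vol \<alpha> * V a b c d e f = wedge23 (curry3 \<alpha> a) f.\<psi> b c d e f"
    using f.V_K_K(1)[of a b c d e f] by (simp add: disc_eq(1)[OF assms] linear_cmul[OF V_linear(1)])
  moreover have cub: "cubic (curry3 \<alpha>) a b c d e f = (\<lambda>x y z. V a b c d e f * f.\<psi> x y z)"
    by (simp add: fun_eq_iff flip: f.\<psi>_cubic)
  ultimately show ?thesis
    using wedge23_scale[of 1 "curry3 \<alpha> a" "V a b c d e f" f.\<psi> b c d e f]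
    by (simp add: quartic_def power2_eq_square cub)
qed

lemma continuous_on_wedge23:
  assumes "\<And>x y. continuous_on S (\<lambda>t. \<beta> t x y)" "\<And>x y z. continuous_on S (\<lambda>t. \<gamma> t x y z)"
  shows "continuous_on S (\<lambda>t. wedge23 (\<beta> t) (\<gamma> t) a b c d e)"
  unfolding wedge23_def by (intro continuous_intros assms)

lemma continuous_on_quartic:
  assumes "\<And>x y z. continuous_on S (\<lambda>t. \<phi> t x y z)"
  shows "continuous_on S (\<lambda>t. quartic (\<phi> t) a b c d e f)"
  unfolding quartic_def cubic_def by (intro continuous_intros continuous_on_wedge23 assms)

definition polynomial_fun :: "(real \<Rightarrow> real) \<Rightarrow> bool" where
  "polynomial_fun f \<longleftrightarrow> (\<exists>p. \<forall>t. f t = poly p t)"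

lemma polynomial_fun_affine: "polynomial_fun (\<lambda>t. c + t * d)"
  unfolding polynomial_fun_def by (intro exI[of _ "[:c, d:]"]) simp

lemma polynomial_fun_add: "polynomial_fun f \<Longrightarrow> polynomial_fun g \<Longrightarrow> polynomial_fun (\<lambda>t. f t + g t)"
  unfolding polynomial_fun_def by (metis poly_add)

lemma polynomial_fun_diff: "polynomial_fun f \<Longrightarrow> polynomial_fun g \<Longrightarrow> polynomial_fun (\<lambda>t. f t - g t)"
  unfolding polynomial_fun_def by (metis poly_diff)

lemma polynomial_fun_mult: "polynomial_fun f \<Longrightarrow> polynomial_fun g \<Longrightarrow> polynomial_fun (\<lambda>t. f t * g t)"
  unfolding polynomial_fun_def by (metis poly_mult)

lemma polynomial_fun_minus: "polynomial_fun f \<Longrightarrow> polynomial_fun (\<lambda>t. - f t)"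
  unfolding polynomial_fun_def by (metis poly_minus)

lemmas polynomial_fun_intros =
  polynomial_fun_add polynomial_fun_diff polynomial_fun_mult polynomial_fun_minus

lemma polynomial_fun_wedge23:
  assumes "\<And>x y. polynomial_fun (\<lambda>t. \<beta> t x y)" "\<And>x y z. polynomial_fun (\<lambda>t. \<gamma> t x y z)"
  shows "polynomial_fun (\<lambda>t. wedge23 (\<beta> t) (\<gamma> t) a b c d e)"
  unfolding wedge23_def by (intro polynomial_fun_intros assms)

lemma polynomial_fun_quartic:
  assumes "\<And>x y z. polynomial_fun (\<lambda>t. \<phi> t x y z)"
  shows "polynomial_fun (\<lambda>t. quartic (\<phi> t) a b c d e f)"
  unfolding quartic_def cubic_def by (intro polynomial_fun_intros polynomial_fun_wedge23 assms)

lemma polynomial_fun_vanish: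
  assumes "polynomial_fun f" "infinite {t. f t = 0}"
  shows "f t = 0"
  using assms poly_roots_finite unfolding polynomial_fun_def by (metis (no_types, lifting) Collect_cong poly_0)

lemma quartic_scale: "quartic (\<lambda>x y z. r * \<phi> x y z) a b c d e f = r ^ 4 * quartic \<phi> a b c d e f"
  by (simp add: quartic_def cubic_scale wedge23_scale power4_eq_xxxx power3_eq_cube)

text \<open>The model e^0 \<and> e^1 \<and> e^2 + e^3 \<and> e^4 \<and> e^5 in the coordinates given
  by \<open>b\<close>; each summand is a 3 by 3 determinant expanded along its first
  coordinate.\<close>

definition split_form :: "(nat \<Rightarrow> 'v::real_inner) \<Rightarrow> 'v \<Rightarrow> 'v \<Rightarrow> 'v \<Rightarrow> real" where
  "split_form b x y z =
     (\<Sum>i\<in>{0,3}. x \<bullet> b i * (y \<bullet> b (i + 1) * (z \<bullet> b (i + 2)) - z \<bullet> b (i + 1) * (y \<bullet> b (i + 2)))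
       - y \<bullet> b i * (x \<bullet> b (i + 1) * (z \<bullet> b (i + 2)) - z \<bullet> b (i + 1) * (x \<bullet> b (i + 2)))
       + z \<bullet> b i * (x \<bullet> b (i + 1) * (y \<bullet> b (i + 2)) - y \<bullet> b (i + 1) * (x \<bullet> b (i + 2))))"

lemma alt3_split_form: "alt3 (split_form b)"
proof -
  have l: "linear (\<lambda>a. split_form b a x y)" "linear (\<lambda>a. split_form b x a y)" "linear (\<lambda>a. split_form b x y a)" for x y
    by (rule linearI; simp add: split_form_def inner_left_distrib algebra_simps)+
  have z: "split_form b x x y = 0" "split_form b x y x = 0" "split_form b x y y = 0" for x y
    by (simp_all add: split_form_def algebra_simps)
  show ?thesis unfolding alt3_def by (intro conjI allI l z)
qed

lemma (in volume6) ex_disc_nonzero: "\<exists>\<alpha>. alternating_form 3 \<alpha> \<and> disc vol \<alpha> \<noteq> 0"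
proof -
  obtain b :: "nat \<Rightarrow> real ^ 6" where b: "bij_betw b {..<6} Basis"
    using ex_bij_betw_nat_finite[of "Basis :: (real ^ 6) set"] by (auto simp: atLeast0LessThan)
  have v: "b i \<bullet> b j = (if i = j then 1 else 0)" if "i < 6" "j < 6" for i j
    using inner_Basis[of "b i" "b j"] bij_betwE[OF b] inj_onD[OF bij_betw_imp_inj_on[OF b], of i j] that
    by auto
  let ?\<alpha> = "\<lambda>v. split_form b (v 0) (v 1) (v 2)"
  have \<alpha>: "alternating_form 3 ?\<alpha>" by (rule alternating_form_uncurry3[OF alt3_split_form])
  have f: "split_form b (b 0) (b 1) (b 2) = 1"
    "split_form b (b 0) (b 1) (b 3) = 0"
    "split_form b (b 0) (b 1) (b 4) = 0"
    "split_form b (b 0) (b 1) (b 5) = 0"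
    "split_form b (b 0) (b 2) (b 3) = 0"
    "split_form b (b 0) (b 2) (b 4) = 0"
    "split_form b (b 0) (b 2) (b 5) = 0"
    "split_form b (b 0) (b 3) (b 4) = 0"
    "split_form b (b 0) (b 3) (b 5) = 0"
    "split_form b (b 0) (b 4) (b 5) = 0"
    "split_form b (b 1) (b 4) (b 5) = 0"
    "split_form b (b 2) (b 4) (b 5) = 0"
    "split_form b (b 3) (b 0) (b 1) = 0"
    "split_form b (b 3) (b 0) (b 2) = 0"
    "split_form b (b 3) (b 0) (b 4) = 0"
    "split_form b (b 3) (b 0) (b 5) = 0"
    "split_form b (b 3) (b 1) (b 2) = 0"
    "split_form b (b 3) (b 1) (b 4) = 0"
    "split_form b (b 3) (b 1) (b 5) = 0"
    "split_form b (b 3) (b 2) (b 4) = 0"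
    "split_form b (b 3) (b 2) (b 5) = 0"
    "split_form b (b 3) (b 4) (b 5) = 1"
    "split_form b (b 4) (b 4) (b 5) = 0"
    "split_form b (b 5) (b 4) (b 5) = 0"
    by (simp_all add: split_form_def v del: One_nat_def)
  \<comment> \<open>Contracted with \<open>b 0\<close>, the model only sees the pair
    \<open>b 1\<close>, \<open>b 2\<close>; the quartic therefore reduces to this single value of
    \<open>cubic\<close>.\<close>
  have "cubic (split_form b) (b 0) (b 1) (b 2) (b 3) (b 4) (b 5) (b 3) (b 4) (b 5) = 1"
    unfolding cubic_def f by (simp add: wedge23_def f del: One_nat_def)
  then have "quartic (split_form b) (b 0) (b 1) (b 2) (b 3) (b 4) (b 5) \<noteq> 0"
    unfolding quartic_def wedge23_def[of "split_form b (b 0)"] f by simp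
  then have "disc vol ?\<alpha> \<noteq> 0"
    using disc_quartic[OF \<alpha>, of "b 0" "b 1" "b 2" "b 3" "b 4" "b 5"] unfolding curry3_uncurry3 by auto
  with \<alpha> show ?thesis by blast
qed

lemma (in volume6) stable_imp_disc:
  assumes \<alpha>: "alternating_form 3 \<alpha>" and "stable_form \<alpha>"
  shows "disc vol \<alpha> \<noteq> 0"
proof
  assume 0: "disc vol \<alpha> = 0"
  let ?A = "{\<alpha>. alternating_form 3 \<alpha>} :: (real ^ 6) form set"
  let ?O = "{pullback g \<alpha> | g :: real ^ 6 \<Rightarrow> real ^ 6. linear g \<and> bij g}"
  obtain T where T: "open T" "?O = ?A \<inter> T"
    using assms(2) unfolding stable_form_def openin_open by auto
  obtain \<beta> where \<beta>: "alternating_form 3 \<beta>" "disc vol \<beta> \<noteq> 0" using ex_disc_nonzero by blast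
  obtain b :: "nat \<Rightarrow> real ^ 6" where "vol b \<noteq> 0" using nonzero by blast
  then have Vb: "V (b 0) (b 1) (b 2) (b 3) (b 4) (b 5) \<noteq> 0" using curry6_eq[OF alternating, of b] by simp
  let ?q = "\<lambda>\<phi>. quartic \<phi> (b 0) (b 1) (b 2) (b 3) (b 4) (b 5)"
  have q0: "?q (curry3 \<gamma>) = 0 \<longleftrightarrow> disc vol \<gamma> = 0" if "alternating_form 3 \<gamma>" for \<gamma>
    using disc_quartic[OF that, of "b 0" "b 1" "b 2" "b 3" "b 4" "b 5"] Vb by (metis mult_eq_0_iff power_eq_0_iff)
  \<comment> \<open>A line through \<alpha> towards a form with nonzero discriminant. Openness of
    the orbit keeps it in the orbit for small \<open>t\<close>, so the quartic has infinitely many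
    zeros along it.\<close>
  define \<gamma> where "\<gamma> t = (\<lambda>v. \<alpha> v + t * \<beta> v)" for t :: real
  have alt\<gamma>: "alternating_form 3 (\<gamma> t)" for t
  proof -
    have "linear (\<lambda>u. \<alpha> (v(i := u)) + t * \<beta> (v(i := u)))" if "i < 3" for v i
      using linear_compose_add[OF alternating_form_linear[OF \<alpha> that]
          alternating_form_linear[OF alternating_form_scale[OF \<beta>(1)] that]] .
    moreover have "\<alpha> v = \<alpha> w" "\<beta> v = \<beta> w" if "\<forall>i<3. v i = w i" for v w
      using that by (auto intro: alternating_form_cong[OF \<alpha>] alternating_form_cong[OF \<beta>(1)])
    moreover have "\<alpha> v = 0" "\<beta> v = 0" if "i < 3" "j < 3" "i \<noteq> j" "v i = v j" for v i j
      using that by (auto intro: alternating_form_zero[OF \<alpha>] alternating_form_zero[OF \<beta>(1)])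
    ultimately show ?thesis
      unfolding \<gamma>_def alternating_form_def by (metis (no_types, lifting) add_0 mult_zero_right)
  qed
  have curry\<gamma>: "curry3 (\<gamma> t) = (\<lambda>x y z. curry3 \<alpha> x y z + t * curry3 \<beta> x y z)" for t
    by (simp add: curry3_def \<gamma>_def fun_eq_iff)
  have "\<alpha> \<in> ?O" by (intro CollectI exI[of _ id]) (simp add: pullback_def linear_id)
  then have "\<gamma> 0 \<in> T" using T by (simp add: \<gamma>_def)
  moreover have "continuous_on UNIV \<gamma>"
    unfolding \<gamma>_def by (intro continuous_on_coordinatewise_then_product continuous_intros)
  ultimately have "open (\<gamma> -` T)" "0 \<in> \<gamma> -` T" using T(1) by (auto intro: open_vimage)
  then obtain r where r: "r > 0" "ball 0 r \<subseteq> \<gamma> -` T" using open_contains_ball by blast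
  have z: "?q (curry3 (\<gamma> t)) = 0" if "t \<in> ball 0 r" for t
  proof -
    have "\<gamma> t \<in> ?O" using that r(2) alt\<gamma>[of t] T(2) by auto
    then obtain g where "linear g" "bij g" "\<gamma> t = pullback g \<alpha>" by auto
    then have "disc vol (\<gamma> t) = 0" using disc_pullback_sgn[of g \<alpha>] \<alpha> 0 by (simp add: sgn_eq_0_iff)
    then show ?thesis by (rule q0[OF alt\<gamma>[of t], THEN iffD2])
  qed
  have "{0<..<r} \<subseteq> {t. ?q (curry3 (\<gamma> t)) = 0}" using z by auto
  then have "infinite {t. ?q (curry3 (\<gamma> t)) = 0}"
    using infinite_Ioo[OF r(1)] infinite_super by blast
  moreover have "polynomial_fun (\<lambda>t. ?q (curry3 (\<gamma> t)))"
    unfolding curry\<gamma> by (intro polynomial_fun_quartic polynomial_fun_affine)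
  ultimately have all: "?q (curry3 (\<gamma> t)) = 0" for t by (intro polynomial_fun_vanish)
  \<comment> \<open>The leading coefficient in \<open>t\<close> is the quartic of \<beta>. It is
    extracted by homogeneity of degree 4: put \<open>t = 1 / s\<close>, multiply by s^4 and let
    \<open>s\<close> tend to 0.\<close>
  have "?q (\<lambda>x y z. s * curry3 \<alpha> x y z + curry3 \<beta> x y z) = 0" if "s \<noteq> 0" for s
    using quartic_scale[of s "curry3 (\<gamma> (1 / s))" "b 0" "b 1" "b 2" "b 3" "b 4" "b 5"] all[of "1 / s"] that
    unfolding curry\<gamma> by (simp add: distrib_left)
  then have "((\<lambda>s. ?q (\<lambda>x y z. s * curry3 \<alpha> x y z + curry3 \<beta> x y z)) \<longlongrightarrow> 0) (at 0)"
    by (intro tendsto_eventually) (auto simp: eventually_at_filter)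
  moreover have "continuous_on UNIV (\<lambda>s. ?q (\<lambda>x y z. s * curry3 \<alpha> x y z + curry3 \<beta> x y z))"
    by (intro continuous_on_quartic continuous_intros)
  then have "((\<lambda>s. ?q (\<lambda>x y z. s * curry3 \<alpha> x y z + curry3 \<beta> x y z)) \<longlongrightarrow>
      ?q (\<lambda>x y z. 0 * curry3 \<alpha> x y z + curry3 \<beta> x y z)) (at 0)"
    unfolding continuous_on_def by blast
  ultimately have "?q (\<lambda>x y z. 0 * curry3 \<alpha> x y z + curry3 \<beta> x y z) = 0"
    using tendsto_unique[OF trivial_limit_at] by blast
  then show False using q0[OF \<beta>(1)] \<beta>(2) by simp
qed

section \<open>The open orbits and their normal forms\<close>

lemma (in volume6) disc_sgn_openin:
  "openin (top_of_set {\<alpha>. alternating_form 3 \<alpha>}) {\<alpha>. alternating_form 3 \<alpha> \<and> 0 < s * disc vol \<alpha>}"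
proof -
  obtain b :: "nat \<Rightarrow> real ^ 6" where "vol b \<noteq> 0" using nonzero by blast
  then have Vb: "V (b 0) (b 1) (b 2) (b 3) (b 4) (b 5) \<noteq> 0" (is "?V \<noteq> 0") using curry6_eq[OF alternating, of b] by simp
  \<comment> \<open>On a fixed frame the discriminant depends on finitely many evaluations of the
    form, each continuous in the product topology. The factor \<open>s\<close> lets one statement
    serve both signs.\<close>
  let ?q = "\<lambda>\<alpha>. s * (quartic (curry3 \<alpha>) (b 0) (b 1) (b 2) (b 3) (b 4) (b 5) / ?V\<^sup>2)"
  have "continuous_on {\<alpha>. alternating_form 3 \<alpha>} ?q"
    unfolding curry3_def
    by (intro continuous_intros continuous_on_quartic continuous_on_subset[OF continuous_on_product_coordinates]) (use Vb in auto)
  then have "openin (top_of_set {\<alpha>. alternating_form 3 \<alpha>}) ({\<alpha>. alternating_form 3 \<alpha>} \<inter> ?q -` {0<..})"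
    by (rule continuous_openin_preimage_gen) auto
  moreover have "?q \<alpha> = s * disc vol \<alpha>" if "alternating_form 3 \<alpha>" for \<alpha>
    using disc_quartic[OF that, of "b 0" "b 1" "b 2" "b 3" "b 4" "b 5"] Vb by (simp add: field_simps)
  ultimately show ?thesis
    by (elim back_subst[where P = "openin _"]) auto
qed

text \<open>
  The values of the normal form on the basis $X_0, X_1, X_2, J X_0, J X_1, J X_2$; the Vandermonde
  factor is the sign of \<open>(i mod 3, j mod 3, l mod 3)\<close>, or zero if two of these coincide.
\<close>

definition normal_value :: "real \<Rightarrow> nat \<Rightarrow> nat \<Rightarrow> nat \<Rightarrow> real" where
  "normal_value s i j l =
    (let m = i div 3 + j div 3 + l div 3 in if m = 0 then 1 else if m = 2 then s else 0) *
    ((real (j mod 3) - real (i mod 3)) * (real (l mod 3) - real (j mod 3)) * (real (l mod 3) - real (i mod 3)) / 2)"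

text \<open>
  The endomorphism \<open>J\<close> is \<open>K\<close> rescaled to a complex (\<open>s = - 1\<close>) or paracomplex (\<open>s = 1\<close>) structure;
  \<open>\<phi>\<close> is the real part of a form that is trilinear over the resulting algebra.
\<close>

locale stable_three_form = three_form +
  fixes s k :: real
  assumes k: "k \<noteq> 0" and s: "s = 1 \<or> s = - 1" and K_sq: "K (K x) = (s * k\<^sup>2) *\<^sub>R x"
begin

definition J where "J x = (1 / k) *\<^sub>R K x"

lemma linear_J: "linear J"
  unfolding J_def using linear_K by (rule linear_compose_scale_right)

lemma J_J: "J (J x) = s *\<^sub>R x"
  using k by (simp add: J_def linear_cmul[OF linear_K] K_sq power2_eq_square)

lemma J_shift: "\<phi> a (J b) c = \<phi> (J a) b c" "\<phi> a b (J c) = \<phi> (J a) b c"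
  by (simp_all add: J_def linear_cmul[OF lin(1)] linear_cmul[OF lin(2)] linear_cmul[OF lin(3)] K_shift)

lemma J_self: "\<phi> (J x) x y = 0" "\<phi> (J x) y x = 0" "\<phi> (J y) x x = 0"
  using K_skew_self[of x y] swap(2)[where a = "J x" and b = x and c = y]
  by (simp_all add: J_def linear_cmul[OF lin(1)] zero)

lemma J_sq: "s * s = 1" using s by auto

text \<open>An endomorphism equal to a scalar would contradict tracelessness of \<open>K\<close>.\<close>

lemma J_not_scalar: "\<exists>a b c. \<phi> (J a) b c \<noteq> r * \<phi> a b c"
proof (rule ccontr)
  assume "\<not> ?thesis"
  then have r: "\<phi> (J a) b c = r * \<phi> a b c" for a b c by blast
  \<comment> \<open>If i_{J x} \<phi> = r i_x \<phi>, then the equation for \<open>K\<close> gives K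
    J = r K, that is J^2 = r J. As J^2 = s is invertible, J = (s / r) id, and \<open>K = k J\<close>
    is multiplication by the scalar \<open>t\<close> below.\<close>
  have "K (J x) = r *\<^sub>R K x" for x
    by (rule V_cancel) (simp add: V_K linear_cmul[OF V_linear(1)] r wedge23_def algebra_simps)
  then have rJ: "s *\<^sub>R x = r *\<^sub>R J x" for x
    unfolding J_J[symmetric] by (simp add: J_def linear_cmul[OF linear_K])
  have "r \<noteq> 0"
  proof
    assume "r = 0"
    obtain a :: "real ^ 6" where "a \<noteq> 0" using nonempty_Basis nonzero_Basis by blast
    then show False using rJ[of a] s \<open>r = 0\<close> by auto
  qed
  define t where "t = k * s / r"
  have "t \<noteq> 0" using \<open>r \<noteq> 0\<close> k s by (auto simp: t_def)
  have "t *\<^sub>R x = (k / r) *\<^sub>R (s *\<^sub>R x)" for x :: "real ^ 6" by (simp add: t_def)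
  then have K: "K x = t *\<^sub>R x" for x
    unfolding rJ using \<open>r \<noteq> 0\<close> k by (simp add: J_def)
  have l: "V a b c d e (t *\<^sub>R f) = t * V a b c d e f" for a b c d e f t
    using V_front(4)[of a b c d e "t *\<^sub>R f"] V_front(4)[of a b c d e f] by (simp add: linear_cmul[OF V_linear(1)])
  have l3: "V a b (t *\<^sub>R c) d e f = t * V a b c d e f" for a b c d e f
    unfolding V_front(1)[of a b "t *\<^sub>R c" d e f] V_front(1)[of a b c d e f] by (simp add: linear_cmul[OF V_linear(1)])
  have l4: "V a b c (t *\<^sub>R d) e f = t * V a b c d e f" for a b c d e f
    unfolding V_front(2)[of a b c "t *\<^sub>R d" e f] V_front(2)[of a b c d e f] by (simp add: linear_cmul[OF V_linear(1)])
  have l5: "V a b c d (t *\<^sub>R e) f = t * V a b c d e f" for a b c d e f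
    unfolding V_front(3)[of a b c d "t *\<^sub>R e" f] V_front(3)[of a b c d e f] by (simp add: linear_cmul[OF V_linear(1)])
  have "6 * t * V a b c d e f = 0" for a b c d e f
    using K_trace[of a b c d e f] unfolding K l l3 l4 l5 linear_cmul[OF V_linear(1)] linear_cmul[OF V_linear(2)] by simp
  then have "V a b c d e f = 0" for a b c d e f using \<open>t \<noteq> 0\<close> by simp
  then show False using nonzero curry6_eq[OF alternating] by metis
qed

text \<open>Over R[j] with j^2 = s, the values \<phi> x y z + s j \<phi> (J x) y z define a form
  that is trilinear when J acts as j. Some value must be invertible, that is, have nonzero norm. For
  s = -1 any nonzero value will do; for s = 1 the algebra has zero divisors and both components must
  be nonzero on the same triple.\<close>

lemma ex_norm_nonzero: "\<exists>x y z. (\<phi> x y z)\<^sup>2 \<noteq> s * (\<phi> (J x) y z)\<^sup>2"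
proof (cases "s = 1")
  case True
  obtain a b c where abc: "\<phi> (J a) b c + \<phi> a b c \<noteq> 0"
    using J_not_scalar[of "- 1"] by (metis add.inverse_inverse add.right_inverse eq_neg_iff_add_eq_0 mult_minus1)
  obtain a' b' c' where abc': "\<phi> (J a') b' c' - \<phi> a' b' c' \<noteq> 0"
    using J_not_scalar[of 1] by auto
  define A where "A x y z = \<phi> (J x) y z + \<phi> x y z" for x y z
  define B where "B x y z = \<phi> (J x) y z - \<phi> x y z" for x y z
  \<comment> \<open>\<open>A\<close> and \<open>B\<close> are the two components for s = 1 (up to
    sign). \<open>B\<close> vanishes as soon as one argument is x + J x, and \<open>A\<close> as
    soon as one is x' - J x', so \<open>Z\<close> combines a triple good for \<open>A\<close> with a
    triple good for \<open>B\<close>.\<close>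
  define Z where "Z x x' = (x + J x) + (x' - J x')" for x x'
  have J: "J (J x) = x" for x using J_J True by simp
  note lin' = linear_add[OF lin(1)] linear_add[OF lin(2)] linear_add[OF lin(3)]
    linear_diff[OF lin(1)] linear_diff[OF lin(2)] linear_diff[OF lin(3)] linear_add[OF linear_J] linear_diff[OF linear_J]
  have AZ: "A (Z x x') y z = 2 * A x y z" "A x (Z y y') z = 2 * A x y z" "A x y (Z z z') = 2 * A x y z"
    for x x' y y' z z'
    by (simp_all add: A_def Z_def lin' J_shift J)
  have BZ: "B (Z x x') y z = 2 * B x' y z" "B x (Z y y') z = 2 * B x y' z" "B x y (Z z z') = 2 * B x y z'"
    for x x' y y' z z'
    by (simp_all add: B_def Z_def lin' J_shift J)
  have "A (Z a a') (Z b b') (Z c c') * B (Z a a') (Z b b') (Z c c') \<noteq> 0"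
    unfolding AZ BZ using abc abc' by (simp add: A_def B_def)
  then have "(\<phi> (Z a a') (Z b b') (Z c c'))\<^sup>2 \<noteq> s * (\<phi> (J (Z a a')) (Z b b') (Z c c'))\<^sup>2"
    by (simp add: A_def B_def True power2_eq_square algebra_simps)
  then show ?thesis by blast
next
  case False
  then have s': "s = - 1" using s by simp
  obtain a b c where "\<phi> (J a) b c \<noteq> 0" using J_not_scalar[of 0] by auto
  then have "0 < (\<phi> a b c)\<^sup>2 + (\<phi> (J a) b c)\<^sup>2" by (simp add: add_nonneg_pos)
  then show ?thesis using s' by (intro exI[of _ a] exI[of _ b] exI[of _ c]) auto
qed

lemma ex_normalised: "\<exists>x y z. \<phi> x y z = 1 \<and> \<phi> (J x) y z = 0"
proof -
  obtain x y z where n: "(\<phi> x y z)\<^sup>2 \<noteq> s * (\<phi> (J x) y z)\<^sup>2" using ex_norm_nonzero by blast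
  define u where "u = \<phi> x y z"
  define w where "w = \<phi> (J x) y z"
  define n where "n = u\<^sup>2 - s * w\<^sup>2"
  have "n \<noteq> 0" using n by (simp add: n_def u_def w_def)
  \<comment> \<open>The product of \<open>x\<close> with (u - s w J) / n, the inverse of the value u
    + s w J.\<close>
  define x' where "x' = (u / n) *\<^sub>R x - (s * w / n) *\<^sub>R J x"
  have "\<phi> x' y z = u / n * u - s * w / n * w"
    by (simp add: x'_def linear_diff[OF lin(1)] linear_cmul[OF lin(1)] u_def w_def)
  also have "\<dots> = (u\<^sup>2 - s * w\<^sup>2) / n" by (simp add: diff_divide_distrib power2_eq_square)
  also have "\<dots> = n / n" by (simp only: n_def)
  also have "\<dots> = 1" using \<open>n \<noteq> 0\<close> by simp
  finally have 1: "\<phi> x' y z = 1" .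
  have "\<phi> (J x') y z = u / n * w - s * w / n * (s * u)"
    by (simp add: x'_def linear_diff[OF lin(1)] linear_cmul[OF lin(1)] linear_diff[OF linear_J] linear_cmul[OF linear_J]
        J_J u_def w_def)
  also have "\<dots> = u * w / n - (s * s) * u * w / n" by (simp add: algebra_simps)
  also have "\<dots> = 0" by (simp add: J_sq)
  finally show ?thesis using 1 by blast
qed

text \<open>All \<open>J\<close> slide into the first slot and square to \<open>s\<close>. An odd
  number of them leaves a multiple of \<open>\<phi> (J x) y z = 0\<close>, two leave
  \<open>s\<close> times the sign of the arrangement, none leaves the sign itself.\<close>

lemma frame_values:
  assumes "\<phi> x y z = 1" "\<phi> (J x) y z = 0"
    and e: "e = (!) [x, y, z, J x, J y, J z]" and "i < 6" "j < 6" "l < 6"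
  shows "\<phi> (e i) (e j) (e l) =
    normal_value s i j l"
proof -
  have p: "\<phi> x z y = - 1" "\<phi> y x z = - 1" "\<phi> y z x = 1" "\<phi> z x y = 1" "\<phi> z y x = - 1"
    using swap[where a = x and b = y and c = z] assms(1) by simp_all
  have q: "\<phi> (J x) z y = 0" "\<phi> (J y) x z = 0" "\<phi> (J y) z x = 0" "\<phi> (J z) x y = 0" "\<phi> (J z) y x = 0"
    using swap[where a = "J x" and b = y and c = z] swap[where a = x and b = "J y" and c = z]
      swap[where a = x and b = y and c = "J z"] assms(2) by (simp_all add: J_shift)
  show ?thesis
    using assms(4-6) unfolding less_numeral_cases normal_value_def
    by (elim disjE; simp add: e J_shift J_J J_self zero linear_cmul[OF lin(1)] linear_cmul[OF lin(2)]
        linear_cmul[OF lin(3)] linear_cmul[OF linear_J] assms(1,2) p q)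
qed

text \<open>Each coefficient is, up to \<open>s\<close>, the value of \<phi> with the combination or
  its image under \<open>J\<close> placed in one slot.\<close>

lemma frame_independent:
  assumes 1: "\<phi> x y z = 1" "\<phi> (J x) y z = 0"
    and 0: "c0 *\<^sub>R x + c1 *\<^sub>R y + c2 *\<^sub>R z + c3 *\<^sub>R J x + c4 *\<^sub>R J y + c5 *\<^sub>R J z = 0" (is "?w = 0")
  shows "c0 = 0 \<and> c1 = 0 \<and> c2 = 0 \<and> c3 = 0 \<and> c4 = 0 \<and> c5 = 0"
proof -
  note l = linear_add[OF lin(1)] linear_add[OF lin(2)] linear_add[OF lin(3)]
    linear_cmul[OF lin(1)] linear_cmul[OF lin(2)] linear_cmul[OF lin(3)]
    linear_add[OF linear_J] linear_cmul[OF linear_J]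
  have "\<phi> ?w y z = c0" "\<phi> (J ?w) y z = s * c3" "\<phi> x ?w z = c1" "\<phi> x (J ?w) z = s * c4"
    "\<phi> x y ?w = c2" "\<phi> x y (J ?w) = s * c5"
    by (simp_all add: l J_shift J_J J_self zero 1)
  then show ?thesis
    unfolding 0 using s by (auto simp: linear_0[OF linear_J] linear_0[OF lin(1)] linear_0[OF lin(2)] linear_0[OF lin(3)])
qed

end

lemma (in volume6) ex_normal_form:
  assumes \<alpha>: "alternating_form 3 \<alpha>" and d: "disc vol \<alpha> \<noteq> 0" and b: "bij_betw b {..<6} (Basis :: (real ^ 6) set)"
  shows "\<exists>h. linear h \<and> bij h \<and> (\<forall>i<6. \<forall>j<6. \<forall>l<6. pullback h \<alpha> ((!) [b i, b j, b l]) =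
      normal_value (sgn (disc vol \<alpha>)) i j l)"
proof -
  interpret f: three_form vol "curry3 \<alpha>" "endo vol \<alpha>" by (rule three_form_endo[OF \<alpha>])
  let ?s = "sgn (disc vol \<alpha>)"
  interpret f: stable_three_form vol "curry3 \<alpha>" "endo vol \<alpha>" ?s "sqrt \<bar>disc vol \<alpha>\<bar>"
    using d by unfold_locales (auto simp: sgn_if disc_eq(1)[OF \<alpha>])
  obtain x y z where 1: "curry3 \<alpha> x y z = 1" "curry3 \<alpha> (f.J x) y z = 0" using f.ex_normalised by blast
  define e where "e = (!) [x, y, z, f.J x, f.J y, f.J z]"
  define h where "h v = (\<Sum>i<6. (v \<bullet> b i) *\<^sub>R e i)" for v
  have s6: "(\<Sum>i<6. g i) = g 0 + g 1 + g 2 + g 3 + g 4 + g 5" for g :: "nat \<Rightarrow> real ^ 6"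
    by (simp add: eval_nat_numeral)
  have "linear h"
    unfolding h_def by (rule linearI) (simp_all add: inner_left_distrib scaleR_left_distrib sum.distrib scaleR_sum_right)
  have "v = 0" if "h v = 0" for v
  proof -
    have "v \<bullet> b i = 0" if "i < 6" for i
      using f.frame_independent[OF 1, of "v \<bullet> b 0" "v \<bullet> b 1" "v \<bullet> b 2" "v \<bullet> b 3" "v \<bullet> b 4" "v \<bullet> b 5"]
        \<open>h v = 0\<close> that unfolding less_numeral_cases h_def s6 by (auto simp: e_def)
    then have "v \<bullet> c = 0" if "c \<in> Basis" for c
      using that b by (metis bij_betw_imp_surj_on imageE lessThan_iff)
    then show ?thesis using euclidean_all_zero_iff by blast
  qed
  then have "inj h" using linear_injective_0[OF \<open>linear h\<close>] by blast
  then have "bij h" using linear_injective_imp_surjective[OF \<open>linear h\<close>] by (simp add: bij_def)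
  have v: "b i \<bullet> b j = (if i = j then 1 else 0)" if "i < 6" "j < 6" for i j
    using inner_Basis[of "b i" "b j"] bij_betwE[OF b] inj_onD[OF bij_betw_imp_inj_on[OF b], of i j] that
    by auto
  have "h (b i) = e i" if "i < 6" for i
  proof -
    have "h (b i) = (\<Sum>j<6. if j = i then e j else 0)"
      unfolding h_def using that by (intro sum.cong) (auto simp: v)
    then show ?thesis using that by simp
  qed
  then have "pullback h \<alpha> ((!) [b i, b j, b l]) = curry3 \<alpha> (e i) (e j) (e l)" if "i < 6" "j < 6" "l < 6" for i j l
    using that unfolding pullback_def curry3_eq[OF \<alpha>, of "\<lambda>k. h ([b i, b j, b l] ! k)"] by simp
  then show ?thesis
    using f.frame_values[OF 1 e_def] \<open>linear h\<close> \<open>bij h\<close> by (intro exI[of _ h]) simp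
qed

text \<open>Equal signs give identical tables in \<open>ex_normal_form\<close>, so the pullbacks
  along \<open>h\<close> and \<open>h'\<close> coincide and \<open>h \<circ> inv h'\<close> carries
  one form to the other.\<close>

lemma (in volume6) same_sign_orbit:
  assumes \<alpha>: "alternating_form 3 \<alpha>" and d: "disc vol \<alpha> \<noteq> 0"
    and \<beta>: "alternating_form 3 \<beta>" and eq: "sgn (disc vol \<beta>) = sgn (disc vol \<alpha>)"
  shows "\<exists>g. linear g \<and> bij g \<and> \<beta> = pullback g \<alpha>"
proof -
  obtain b :: "nat \<Rightarrow> real ^ 6" where b: "bij_betw b {..<6} Basis"
    using ex_bij_betw_nat_finite[of "Basis :: (real ^ 6) set"] by (auto simp: atLeast0LessThan)
  have d': "disc vol \<beta> \<noteq> 0" using d eq by (metis sgn_eq_0_iff)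
  obtain h where h: "linear h" "bij h" "\<And>i j l. i < 6 \<Longrightarrow> j < 6 \<Longrightarrow> l < 6 \<Longrightarrow> pullback h \<alpha> ((!) [b i, b j, b l]) =
      normal_value (sgn (disc vol \<alpha>)) i j l"
    using ex_normal_form[OF \<alpha> d b] by blast
  obtain h' where h': "linear h'" "bij h'" "\<And>i j l. i < 6 \<Longrightarrow> j < 6 \<Longrightarrow> l < 6 \<Longrightarrow> pullback h' \<beta> ((!) [b i, b j, b l]) =
      normal_value (sgn (disc vol \<alpha>)) i j l"
    using ex_normal_form[OF \<beta> d' b] unfolding eq by blast
  have p: "alternating_form 3 (pullback h \<alpha>)" "alternating_form 3 (pullback h' \<beta>)"
    using alternating_form_pullback h h' \<alpha> \<beta> by blast+
  have "pullback h' \<beta> = pullback h \<alpha>"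
  proof (rule alternating_form_eqI[OF p(2,1) span_Basis])
    fix v :: "nat \<Rightarrow> real ^ 6" assume "v ` {..<3} \<subseteq> (Basis :: (real ^ 6) set)"
    then have "v 0 \<in> b ` {..<6}" "v 1 \<in> b ` {..<6}" "v 2 \<in> b ` {..<6}"
      using b by (auto simp: bij_betw_def)
    then obtain i j l where ijl: "i < 6" "j < 6" "l < 6" "v 0 = b i" "v 1 = b j" "v 2 = b l" by blast
    show "pullback h' \<beta> v = pullback h \<alpha> v"
      using h(3)[OF ijl(1-3)] h'(3)[OF ijl(1-3)]
      unfolding curry3_eq[OF p(1), of v] curry3_eq[OF p(2), of v] ijl curry3_def by simp
  qed
  then have "pullback (\<lambda>x. h' (inv h' x)) \<beta> = pullback (\<lambda>x. h (inv h' x)) \<alpha>"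
    by (simp add: pullback_def fun_eq_iff)
  moreover have "h' (inv h' x) = x" for x using h'(2) by (simp add: bij_is_surj surj_f_inv_f)
  ultimately have "\<beta> = pullback (h \<circ> inv h') \<alpha>" by (simp add: pullback_def o_def)
  moreover have "linear (h \<circ> inv h')"
    using h(1) h'(1,2) by (intro linear_compose) (auto simp: inj_linear_imp_inv_linear bij_is_inj)
  moreover have "bij (h \<circ> inv h')" using h(2) h'(2) by (intro bij_comp bij_imp_bij_inv)
  ultimately show ?thesis by blast
qed

lemma (in volume6) stable_iff_disc:
  assumes \<alpha>: "alternating_form 3 \<alpha>"
  shows "stable_form \<alpha> \<longleftrightarrow> disc vol \<alpha> \<noteq> 0"
proof
  assume d: "disc vol \<alpha> \<noteq> 0"
  have "{pullback g \<alpha> | g :: real ^ 6 \<Rightarrow> real ^ 6. linear g \<and> bij g} =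
    {\<beta>. alternating_form 3 \<beta> \<and> 0 < sgn (disc vol \<alpha>) * disc vol \<beta>}" (is "?O = ?S")
  proof (intro set_eqI iffI)
    fix \<beta> assume "\<beta> \<in> ?O"
    then obtain g where g: "linear g" "bij g" "\<beta> = pullback g \<alpha>" by blast
    have "sgn (disc vol \<beta>) = sgn (disc vol \<alpha>)" using disc_pullback_sgn[OF g(1,2) \<alpha>] g(3) by simp
    then show "\<beta> \<in> ?S"
      using alternating_form_pullback[OF g(1) \<alpha>] g(3) d by (auto simp: sgn_if split: if_splits)
  next
    fix \<beta> assume \<beta>: "\<beta> \<in> ?S"
    then have "sgn (disc vol \<beta>) = sgn (disc vol \<alpha>)"
      by (auto simp: sgn_if split: if_splits)
    then show "\<beta> \<in> ?O" using same_sign_orbit[OF \<alpha> d, of \<beta>] \<beta> by blast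
  qed
  then show "stable_form \<alpha>" unfolding stable_form_def using disc_sgn_openin by simp
qed (rule stable_imp_disc[OF \<alpha>])

section \<open>Differentiation in a chart\<close>

abbreviation fderiv :: "'a::real_normed_vector \<Rightarrow> ('a \<Rightarrow> 'b::real_normed_vector) \<Rightarrow> 'a \<Rightarrow> 'b" where
  "fderiv x f \<equiv> frechet_derivative f (at x)"

lemma fderiv_works: "f differentiable (at x) \<Longrightarrow> (f has_derivative fderiv x f) (at x)"
  by (simp add: frechet_derivative_works)

lemma fderiv_eq: "(f has_derivative f') (at x) \<Longrightarrow> fderiv x f = f'"
  by (rule frechet_derivative_at[symmetric])

lemma fderiv_cong:
  assumes "open S" "x \<in> S" "\<And>y. y \<in> S \<Longrightarrow> f y = g y" "f differentiable (at x)"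
  shows "fderiv x f = fderiv x g"
  using has_derivative_transform_within_open[OF fderiv_works[OF assms(4)] assms(1,2,3)]
  by (simp add: frechet_derivative_at)

lemma differentiable_cong_open:
  assumes "open S" "x \<in> S" "\<And>y. y \<in> S \<Longrightarrow> f y = g y" "f differentiable (at x)"
  shows "g differentiable (at x)"
  using has_derivative_transform_within_open[OF fderiv_works[OF assms(4)] assms(1,2,3)]
  by (auto simp: differentiable_def)

text \<open>A product rule under pointwise hypotheses: differentiability is given only for
  \<open>G y u\<close> with \<open>u\<close> fixed, so the moving argument is expanded into a finite
  sum over the standard basis.\<close>

lemma has_derivative_linear_apply:
  fixes G :: "'a::real_normed_vector \<Rightarrow> 'v::euclidean_space \<Rightarrow> 'b::real_normed_vector"
  assumes S: "open S" "x \<in> S" and lin: "\<And>y. y \<in> S \<Longrightarrow> linear (G y)"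
    and G: "\<And>u. (\<lambda>y. G y u) differentiable (at x)" and Y: "Y differentiable (at x)"
  shows "((\<lambda>y. G y (Y y)) has_derivative (\<lambda>z. fderiv x (\<lambda>y. G y (Y x)) z + G x (fderiv x Y z))) (at x)"
proof -
  have ex: "G y u = (\<Sum>e\<in>Basis. (u \<bullet> e) *\<^sub>R G y e)" if "y \<in> S" for y u
    using linear_sum[OF lin[OF that], of "\<lambda>e. (u \<bullet> e) *\<^sub>R e" Basis]
    by (simp add: euclidean_representation linear_cmul[OF lin[OF that]])
  have 1: "((\<lambda>y. \<Sum>e\<in>Basis. (Y y \<bullet> e) *\<^sub>R G y e) has_derivative
      (\<lambda>z. \<Sum>e\<in>Basis. (Y x \<bullet> e) *\<^sub>R fderiv x (\<lambda>y. G y e) z + (fderiv x Y z \<bullet> e) *\<^sub>R G x e)) (at x)"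
    by (intro has_derivative_sum has_derivative_scaleR fderiv_works G has_derivative_inner_left Y)
  have 2: "((\<lambda>y. \<Sum>e\<in>Basis. (Y x \<bullet> e) *\<^sub>R G y e) has_derivative
      (\<lambda>z. \<Sum>e\<in>Basis. (Y x \<bullet> e) *\<^sub>R fderiv x (\<lambda>y. G y e) z)) (at x)"
    by (intro has_derivative_sum has_derivative_scaleR_right fderiv_works G)
  have "((\<lambda>y. G y (Y x)) has_derivative (\<lambda>z. \<Sum>e\<in>Basis. (Y x \<bullet> e) *\<^sub>R fderiv x (\<lambda>y. G y e) z)) (at x)"
    by (rule has_derivative_transform_within_open[OF 2 S]) (simp flip: ex)
  then have 3: "fderiv x (\<lambda>y. G y (Y x)) = (\<lambda>z. \<Sum>e\<in>Basis. (Y x \<bullet> e) *\<^sub>R fderiv x (\<lambda>y. G y e) z)"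
    by (rule fderiv_eq)
  have "((\<lambda>y. G y (Y y)) has_derivative
      (\<lambda>z. \<Sum>e\<in>Basis. (Y x \<bullet> e) *\<^sub>R fderiv x (\<lambda>y. G y e) z + (fderiv x Y z \<bullet> e) *\<^sub>R G x e)) (at x)"
    by (rule has_derivative_transform_within_open[OF 1 S]) (simp flip: ex)
  then show ?thesis unfolding 3 by (simp add: sum.distrib flip: ex[OF S(2)])
qed

lemma has_derivative_wedge23:
  assumes "\<And>a b. ((\<lambda>y. \<beta> y a b) has_derivative (\<lambda>z. \<beta>' z a b)) (at x)"
    and "\<And>a b c. ((\<lambda>y. \<gamma> y a b c) has_derivative (\<lambda>z. \<gamma>' z a b c)) (at x)"
  shows "((\<lambda>y. wedge23 (\<beta> y) (\<gamma> y) a b c d e) has_derivative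
    (\<lambda>z. wedge23 (\<beta>' z) (\<gamma> x) a b c d e + wedge23 (\<beta> x) (\<gamma>' z) a b c d e)) (at x)"
  unfolding wedge23_def
  by (rule has_derivative_eq_rhs, (rule has_derivative_add has_derivative_diff has_derivative_mult assms)+)
    (simp add: fun_eq_iff algebra_simps)

lemma differentiable_wedge:
  assumes "\<And>v. (\<lambda>y. \<alpha> y v) differentiable (at x)" "\<And>v. (\<lambda>y. \<beta> y v) differentiable (at x)"
  shows "(\<lambda>y. wedge p q (\<alpha> y) (\<beta> y) v) differentiable (at x)"
proof -
  have "(\<lambda>y. (\<Sum>\<sigma> | \<sigma> permutes {..<p + q}.
        of_int (sign \<sigma>) * \<alpha> y (\<lambda>i. v (\<sigma> i)) * \<beta> y (\<lambda>i. v (\<sigma> (p + i)))) * (1 / (fact p * fact q))) differentiable (at x)"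
    by (intro differentiable_mult differentiable_sum differentiable_const assms ballI finite_permutations finite_lessThan)
  then show ?thesis by (simp add: wedge_def)
qed

lemma alternating_form_fderiv:
  assumes S: "open S" "x \<in> S" and alt: "\<And>y. y \<in> S \<Longrightarrow> alternating_form k (U y)"
    and d: "\<And>v. (\<lambda>y. U y v) differentiable (at x)"
  shows "alternating_form k (\<lambda>v. fderiv x (\<lambda>y. U y v) z)"
proof -
  have "fderiv x (\<lambda>y. U y v) z = fderiv x (\<lambda>y. U y w) z" if "\<forall>i<k. v i = w i" for v w
    using fderiv_cong[OF S _ d] alternating_form_cong[OF alt] that by metis
  moreover have "linear (\<lambda>u. fderiv x (\<lambda>y. U y (v(i := u))) z)" if "i < k" for v i
  proof (rule linearI)
    fix a b
    have "((\<lambda>y. U y (v(i := a)) + U y (v(i := b))) has_derivative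
       (\<lambda>z. fderiv x (\<lambda>y. U y (v(i := a))) z + fderiv x (\<lambda>y. U y (v(i := b))) z)) (at x)"
      by (intro has_derivative_add fderiv_works d)
    then have "((\<lambda>y. U y (v(i := a + b))) has_derivative
       (\<lambda>z. fderiv x (\<lambda>y. U y (v(i := a))) z + fderiv x (\<lambda>y. U y (v(i := b))) z)) (at x)"
      by (rule has_derivative_transform_within_open[OF _ S])
        (simp add: linear_add[OF alternating_form_linear[OF alt that]])
    from fderiv_eq[OF this] show "fderiv x (\<lambda>y. U y (v(i := a + b))) z =
        fderiv x (\<lambda>y. U y (v(i := a))) z + fderiv x (\<lambda>y. U y (v(i := b))) z" by simp
  next
    fix r a
    have "((\<lambda>y. r * U y (v(i := a))) has_derivative (\<lambda>z. r * fderiv x (\<lambda>y. U y (v(i := a))) z)) (at x)"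
      by (intro has_derivative_mult_right fderiv_works d)
    then have "((\<lambda>y. U y (v(i := r *\<^sub>R a))) has_derivative (\<lambda>z. r * fderiv x (\<lambda>y. U y (v(i := a))) z)) (at x)"
      by (rule has_derivative_transform_within_open[OF _ S])
        (simp add: linear_cmul[OF alternating_form_linear[OF alt that]])
    from fderiv_eq[OF this] show "fderiv x (\<lambda>y. U y (v(i := r *\<^sub>R a))) z = r *\<^sub>R fderiv x (\<lambda>y. U y (v(i := a))) z"
      by simp
  qed
  moreover have "fderiv x (\<lambda>y. U y v) z = 0" if "i < k" "j < k" "i \<noteq> j" "v i = v j" for v i j
  proof -
    have "fderiv x (\<lambda>y. U y v) = fderiv x (\<lambda>y. 0)"
      by (rule fderiv_cong[OF S _ d]) (rule alternating_form_zero[OF alt that])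
    then show ?thesis by (simp add: frechet_derivative_const)
  qed
  ultimately show ?thesis unfolding alternating_form_def by blast
qed

section \<open>Jets of a family of forms on an open set of the model space\<close>

locale local_forms =
  fixes S :: "(real ^ 6) set" and x :: "real ^ 6" and vol Ph :: "real ^ 6 \<Rightarrow> (real ^ 6) form"
  assumes S: "open S" "x \<in> S"
    and volume: "\<And>y. y \<in> S \<Longrightarrow> volume6 (vol y)"
    and three: "\<And>y. y \<in> S \<Longrightarrow> alternating_form 3 (Ph y)"
    and diff_vol: "\<And>v. (\<lambda>y. vol y v) differentiable (at x)"
    and diff_Ph: "\<And>v. (\<lambda>y. Ph y v) differentiable (at x)"
begin

definition "K y = endo (vol y) (Ph y)"
definition "\<phi> y = curry3 (Ph y)"
definition "Vol y = curry6 (vol y)"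
definition "\<psi> y a b c = \<phi> y (K y a) b c"
definition "\<kappa> y = disc (vol y) (Ph y)"

lemma three_form_at: "y \<in> S \<Longrightarrow> three_form (vol y) (\<phi> y) (K y)"
  unfolding \<phi>_def K_def using volume6.three_form_endo[OF volume three] by blast

lemma \<psi>_at: "y \<in> S \<Longrightarrow> three_form.\<psi> (\<phi> y) (K y) = \<psi> y"
  using three_form.\<psi>_def[OF three_form_at] by (simp add: fun_eq_iff \<psi>_def)

lemma K_K_at: "y \<in> S \<Longrightarrow> K y (K y a) = \<kappa> y *\<^sub>R a"
  unfolding K_def \<kappa>_def by (rule volume6.disc_eq(1)[OF volume three])

lemma diff_V: "(\<lambda>y. Vol y a b c d e f) differentiable (at x)"
  unfolding Vol_def curry6_def by (rule diff_vol)

lemma diff_\<phi>: "(\<lambda>y. \<phi> y a b c) differentiable (at x)"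
  unfolding \<phi>_def curry3_def by (rule diff_Ph)

lemma diff_wedge23:
  assumes "\<And>a b. (\<lambda>y. \<beta> y a b) differentiable (at x)" "\<And>a b c. (\<lambda>y. \<gamma> y a b c) differentiable (at x)"
  shows "(\<lambda>y. wedge23 (\<beta> y) (\<gamma> y) a b c d e) differentiable (at x)"
  unfolding wedge23_def by (intro differentiable_add differentiable_diff differentiable_mult assms)

text \<open>One frame serves all of \<open>S\<close>, since a nonzero top form does not vanish on an
  enumeration of the standard basis. Its volume is the denominator in \<open>diff_K\<close> and
  \<open>diff_\<kappa>\<close>.\<close>

lemma ex_basis: "\<exists>a b c d e f. \<forall>y\<in>S. Vol y a b c d e f \<noteq> 0"
proof -
  obtain b :: "nat \<Rightarrow> real ^ 6" where b: "bij_betw b {..<6} Basis"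
    using ex_bij_betw_nat_finite[of "Basis :: (real ^ 6) set"] by (auto simp: atLeast0LessThan)
  have "Vol y (b 0) (b 1) (b 2) (b 3) (b 4) (b 5) \<noteq> 0" if "y \<in> S" for y
  proof -
    interpret volume6 "vol y" by (rule volume[OF that])
    obtain v0 where "vol y v0 \<noteq> 0" using nonzero by blast
    then show ?thesis
      using top_form_basis[of "vol y" v0 b] alternating b curry6_eq[OF alternating, of b] by (simp add: Vol_def)
  qed
  then show ?thesis by blast
qed

text \<open>Cramer's rule: for the linear form \<open>v \<bullet> i\<close>, \<open>V_seven\<close>
  writes each component of \<open>K y u\<close> as a quotient of polynomials in the values of \<phi>
  by a volume that has no zero on \<open>S\<close>.\<close>

lemma diff_K: "(\<lambda>y. K y u) differentiable (at x)"
proof -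
  obtain a b c d e f where nz: "\<And>y. y \<in> S \<Longrightarrow> Vol y a b c d e f \<noteq> 0" using ex_basis by blast
  have "(\<lambda>y. K y u \<bullet> i) differentiable (at x)" for i
  proof (rule differentiable_cong_open[OF S])
    let ?w = "\<lambda>y. wedge23 (\<phi> y u) (\<phi> y)"
    let ?N = "\<lambda>y. - (a \<bullet> i) * ?w y b c d e f + (b \<bullet> i) * ?w y a c d e f - (c \<bullet> i) * ?w y a b d e f
      + (d \<bullet> i) * ?w y a b c e f - (e \<bullet> i) * ?w y a b c d f + (f \<bullet> i) * ?w y a b c d e"
    show "(\<lambda>y. ?N y / Vol y a b c d e f) differentiable (at x)"
      by (intro differentiable_divide differentiable_add differentiable_diff differentiable_mult
          differentiable_const diff_wedge23 diff_\<phi> diff_V nz S)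
    fix y assume y: "y \<in> S"
    interpret f: three_form "vol y" "\<phi> y" "K y" by (rule three_form_at[OF y])
    have "linear (\<lambda>v. v \<bullet> i)" by (rule bounded_linear.linear[OF bounded_linear_inner_left])
    from f.V_seven[OF this, of "K y u" a b c d e f]
    have "K y u \<bullet> i * Vol y a b c d e f = ?N y"
      unfolding f.V_K Vol_def by simp
    then show "?N y / Vol y a b c d e f = K y u \<bullet> i" using nz[OF y] by (simp add: field_simps)
  qed
  then have "(\<lambda>y. \<Sum>i\<in>Basis. (K y u \<bullet> i) *\<^sub>R i) differentiable (at x)"
    by (intro differentiable_sum differentiable_scaleR differentiable_const ballI finite_Basis)
  then show ?thesis by (simp add: euclidean_representation)
qed

lemma deriv_\<psi>:
  "((\<lambda>y. \<psi> y a b c) has_derivative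
     (\<lambda>z. fderiv x (\<lambda>y. \<phi> y (K x a) b c) z + \<phi> x (fderiv x (\<lambda>y. K y a) z) b c)) (at x)"
  unfolding \<psi>_def
  using has_derivative_linear_apply[OF S, of "\<lambda>y u. \<phi> y u b c" "\<lambda>y. K y a"]
    three_form.lin(1)[OF three_form_at] diff_\<phi> diff_K by simp

lemma diff_\<psi>: "(\<lambda>y. \<psi> y a b c) differentiable (at x)"
  using deriv_\<psi> by (auto simp: differentiable_def)

lemma quartic_at:
  assumes "y \<in> S"
  shows "\<kappa> y * Vol y a b c d e f = wedge23 (\<phi> y a) (\<psi> y) b c d e f"
proof -
  interpret f: three_form "vol y" "\<phi> y" "K y" by (rule three_form_at[OF assms])
  show ?thesis
    using f.V_K_K(1)[of a b c d e f] \<psi>_at[OF assms] K_K_at[OF assms, of a]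
    by (simp add: Vol_def linear_cmul[OF f.V_linear(1)])
qed

lemma diff_\<kappa>: "\<kappa> differentiable (at x)"
proof -
  obtain a b c d e f where nz: "\<And>y. y \<in> S \<Longrightarrow> Vol y a b c d e f \<noteq> 0" using ex_basis by blast
  show ?thesis
  proof (rule differentiable_cong_open[OF S])
    show "(\<lambda>y. wedge23 (\<phi> y a) (\<psi> y) b c d e f / Vol y a b c d e f) differentiable (at x)"
      by (intro differentiable_divide diff_wedge23 diff_\<phi> diff_\<psi> diff_V nz S)
    show "wedge23 (\<phi> y a) (\<psi> y) b c d e f / Vol y a b c d e f = \<kappa> y" if "y \<in> S" for y
      using quartic_at[OF that, of a b c d e f] nz[OF that] by (simp add: field_simps)
  qed
qed

definition "T z a b c = fderiv x (\<lambda>y. \<phi> y a b c) z"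
definition "U z a b c = fderiv x (\<lambda>y. \<psi> y a b c) z"
definition "M z a = fderiv x (\<lambda>y. K y a) z"

lemma has_derivative_\<phi>: "((\<lambda>y. \<phi> y a b c) has_derivative (\<lambda>z. T z a b c)) (at x)"
  unfolding T_def by (rule fderiv_works[OF diff_\<phi>])

lemma has_derivative_\<psi>: "((\<lambda>y. \<psi> y a b c) has_derivative (\<lambda>z. U z a b c)) (at x)"
  unfolding U_def by (rule fderiv_works[OF diff_\<psi>])

lemma alt_T: "alt3 (T z)"
  using alt3_curry3[OF alternating_form_fderiv[OF S three diff_Ph, of z]]
  by (simp add: curry3_def[abs_def] T_def[abs_def] \<phi>_def)

lemma alt_U: "alt3 (U z)"
proof -
  have "alternating_form 3 (\<lambda>v. fderiv x (\<lambda>y. \<psi> y (v 0) (v 1) (v 2)) z)"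
  proof (rule alternating_form_fderiv[OF S _ diff_\<psi>])
    show "alternating_form 3 (\<lambda>v. \<psi> y (v 0) (v 1) (v 2))" if "y \<in> S" for y
      using alternating_form_uncurry3[OF three_form.alt_\<psi>[OF three_form_at[OF that]]] by (simp only: \<psi>_at[OF that])
  qed
  from alt3_curry3[OF this] show ?thesis by (simp add: curry3_def[abs_def] U_def[abs_def])
qed

text \<open>The derivative of \<open>vol\<close> in a given direction is again a 6-form, hence
  proportional to \<open>vol x\<close>; evaluating on one frame of nonzero volume shows that the
  factor is linear in the direction.\<close>

lemma ex_\<eta>: "\<exists>\<eta>. linear \<eta> \<and> (\<forall>z a b c d e f. fderiv x (\<lambda>y. Vol y a b c d e f) z = \<eta> z * Vol x a b c d e f)"
proof -
  interpret volume6 "vol x" by (rule volume[OF S(2)])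
  have "\<exists>r. \<forall>v. fderiv x (\<lambda>y. vol y v) z = r * vol x v" for z
    by (rule V_multiple, rule alternating_form_fderiv[OF S _ diff_vol]) (use volume volume6.alternating in blast)
  then obtain \<eta> where \<eta>: "\<And>z v. fderiv x (\<lambda>y. vol y v) z = \<eta> z * vol x v" by metis
  obtain v0 where v0: "vol x v0 \<noteq> 0" using nonzero by blast
  have "\<eta> = (\<lambda>z. (1 / vol x v0) *\<^sub>R fderiv x (\<lambda>y. vol y v0) z)" using \<eta>[where v = v0] v0 by auto
  then have "linear \<eta>"
    using linear_compose_scale_right[OF has_derivative_linear[OF fderiv_works[OF diff_vol]]] by metis
  with \<eta> show ?thesis unfolding Vol_def curry6_def by blast
qed

text \<open>The product rules demanded by \<open>three_form_jet\<close> arise by differentiating the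
  two sides of an identity that holds on all of \<open>S\<close> and comparing the results by
  uniqueness of the derivative.\<close>

lemma jet:
  assumes closed: "\<And>a b c d. T a b c d - T b a c d + T c a b d - T d a b c = 0"
    "\<And>a b c d. U a b c d - U b a c d + U c a b d - U d a b c = 0"
  shows "fderiv x \<kappa> z = 0"
    and "K x (M a b) - K x (M b a) - M (K x a) b + M (K x b) a = 0"
proof -
  interpret f: three_form "vol x" "\<phi> x" "K x" by (rule three_form_at[OF S(2)])
  obtain \<eta> where \<eta>: "linear \<eta>" "\<And>z a b c d e f. fderiv x (\<lambda>y. Vol y a b c d e f) z = \<eta> z * Vol x a b c d e f"
    using ex_\<eta> by blast
  have VK: "fderiv x (\<lambda>y. Vol y (K x a) b c d e f) z + Vol x (M z a) b c d e f =
     - (wedge23 (T z a) (\<phi> x) b c d e f + wedge23 (\<phi> x a) (T z) b c d e f)" for z a b c d e f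
  proof -
    have "((\<lambda>y. Vol y (K y a) b c d e f) has_derivative
        (\<lambda>z. fderiv x (\<lambda>y. Vol y (K x a) b c d e f) z + Vol x (fderiv x (\<lambda>y. K y a) z) b c d e f)) (at x)"
      using volume6.V_linear(1)[OF volume]
      by (intro has_derivative_linear_apply[OF S, of "\<lambda>y u. Vol y u b c d e f"] diff_V diff_K) (simp add: Vol_def)
    moreover have "((\<lambda>y. - wedge23 (\<phi> y a) (\<phi> y) b c d e f) has_derivative
        (\<lambda>z. - (wedge23 (T z a) (\<phi> x) b c d e f + wedge23 (\<phi> x a) (T z) b c d e f))) (at x)"
      by (intro has_derivative_minus has_derivative_wedge23 has_derivative_\<phi>)
    then have "((\<lambda>y. Vol y (K y a) b c d e f) has_derivative
        (\<lambda>z. - (wedge23 (T z a) (\<phi> x) b c d e f + wedge23 (\<phi> x a) (T z) b c d e f))) (at x)"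
      by (rule has_derivative_transform_within_open[OF _ S])
        (simp add: Vol_def three_form.V_K[OF three_form_at])
    ultimately show ?thesis unfolding M_def by (rule fun_cong[OF has_derivative_unique])
  qed
  interpret j: three_form_jet "vol x" "\<phi> x" "K x" T U M \<eta> "fderiv x \<kappa>" "\<kappa> x"
  proof unfold_locales
    show "alt3 (T z)" for z by (rule alt_T)
    show "alt3 (U z)" for z by (rule alt_U)
    show "\<eta> (a + b) = \<eta> a + \<eta> b" for a b by (rule linear_add[OF \<eta>(1)])
    show "\<eta> (r *\<^sub>R a) = r *\<^sub>R \<eta> a" for r a by (rule linear_cmul[OF \<eta>(1)])
    show "curry6 (vol x) (M z a) b c d e f + \<eta> z * curry6 (vol x) (K x a) b c d e f =
      - wedge23 (T z a) (\<phi> x) b c d e f - wedge23 (\<phi> x a) (T z) b c d e f" for z a b c d e f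
      using VK[where z = z and a = a and b = b and c = c and d = d and e = e and f = f] unfolding \<eta> unfolding Vol_def by simp
    show "U z a b c = T z (K x a) b c + \<phi> x (M z a) b c" for z a b c
      unfolding U_def T_def M_def fderiv_eq[OF deriv_\<psi>] ..
    show "K x (K x a) = \<kappa> x *\<^sub>R a" for a by (rule K_K_at[OF S(2)])
    show "K x (M z a) + M z (K x a) = fderiv x \<kappa> z *\<^sub>R a" for z a
    proof -
      have "((\<lambda>y. K y (K y a)) has_derivative (\<lambda>z. fderiv x (\<lambda>y. K y (K x a)) z + K x (fderiv x (\<lambda>y. K y a) z))) (at x)"
        using three_form.linear_K[OF three_form_at]
        by (intro has_derivative_linear_apply[OF S] diff_K)
      moreover have "((\<lambda>y. \<kappa> y *\<^sub>R a) has_derivative (\<lambda>z. fderiv x \<kappa> z *\<^sub>R a)) (at x)"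
        by (intro has_derivative_scaleR_left fderiv_works diff_\<kappa>)
      then have "((\<lambda>y. K y (K y a)) has_derivative (\<lambda>z. fderiv x \<kappa> z *\<^sub>R a)) (at x)"
        by (rule has_derivative_transform_within_open[OF _ S]) (simp add: K_K_at)
      ultimately have "fderiv x (\<lambda>y. K y (K x a)) z + K x (fderiv x (\<lambda>y. K y a) z) = fderiv x \<kappa> z *\<^sub>R a"
        by (rule fun_cong[OF has_derivative_unique])
      then show ?thesis unfolding M_def by (simp add: add.commute)
    qed
    show "wedge23 (T z a) (three_form.\<psi> (\<phi> x) (K x)) b c d e f + wedge23 (\<phi> x a) (U z) b c d e f =
      (fderiv x \<kappa> z + \<kappa> x * \<eta> z) * curry6 (vol x) a b c d e f" for z a b c d e f
    proof -
      have "((\<lambda>y. wedge23 (\<phi> y a) (\<psi> y) b c d e f) has_derivative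
        (\<lambda>z. wedge23 (T z a) (\<psi> x) b c d e f + wedge23 (\<phi> x a) (U z) b c d e f)) (at x)"
        by (intro has_derivative_wedge23 has_derivative_\<phi> has_derivative_\<psi>)
      moreover have "((\<lambda>y. \<kappa> y * Vol y a b c d e f) has_derivative
        (\<lambda>z. \<kappa> x * fderiv x (\<lambda>y. Vol y a b c d e f) z + fderiv x \<kappa> z * Vol x a b c d e f)) (at x)"
        by (intro has_derivative_mult fderiv_works diff_\<kappa> diff_V)
      then have "((\<lambda>y. wedge23 (\<phi> y a) (\<psi> y) b c d e f) has_derivative
        (\<lambda>z. \<kappa> x * fderiv x (\<lambda>y. Vol y a b c d e f) z + fderiv x \<kappa> z * Vol x a b c d e f)) (at x)"
        by (rule has_derivative_transform_within_open[OF _ S]) (simp add: quartic_at)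
      ultimately have "wedge23 (T z a) (\<psi> x) b c d e f + wedge23 (\<phi> x a) (U z) b c d e f =
          \<kappa> x * fderiv x (\<lambda>y. Vol y a b c d e f) z + fderiv x \<kappa> z * Vol x a b c d e f"
        by (rule fun_cong[OF has_derivative_unique])
      then show ?thesis unfolding \<eta> \<psi>_at[OF S(2)] unfolding Vol_def by (simp add: algebra_simps)
    qed
  qed (fact closed)+
  have "linear (fderiv x \<kappa>)" by (rule has_derivative_linear[OF fderiv_works[OF diff_\<kappa>]])
  then show "fderiv x \<kappa> z = 0" "K x (M a b) - K x (M b a) - M (K x a) b + M (K x b) a = 0"
    using j.\<mu>_zero j.nijenhuis_zero by blast+
qed

lemma deriv_K_apply:
  assumes "Y differentiable (at x)"
  shows "fderiv x (\<lambda>y. K y (Y y)) z = M z (Y x) + K x (fderiv x Y z)"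
proof -
  have "((\<lambda>y. K y (Y y)) has_derivative (\<lambda>z. fderiv x (\<lambda>y. K y (Y x)) z + K x (fderiv x Y z))) (at x)"
    using three_form.linear_K[OF three_form_at]
    by (intro has_derivative_linear_apply[OF S] diff_K assms)
  then show ?thesis unfolding M_def by (simp add: fderiv_eq)
qed

text \<open>Tensoriality made explicit: after the product rule all derivatives of \<open>X\<close>
  and \<open>Y\<close> cancel, and the terms in \<open>M\<close> are those of the constant fields
  with values \<open>X x\<close> and \<open>Y x\<close>.\<close>

lemma nijenhuis_at:
  assumes closed: "\<And>a b c d. T a b c d - T b a c d + T c a b d - T d a b c = 0"
    "\<And>a b c d. U a b c d - U b a c d + U c a b d - U d a b c = 0"
    and X: "X differentiable (at x)" and Y: "Y differentiable (at x)"
  defines "JX \<equiv> \<lambda>y. K y (X y)" and "JY \<equiv> \<lambda>y. K y (Y y)"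
  shows "- K x (K x (fderiv x Y (X x) - fderiv x X (Y x)))
    + K x ((fderiv x Y (JX x) - fderiv x JX (Y x)) + (fderiv x JY (X x) - fderiv x X (JY x)))
    - (fderiv x JY (JX x) - fderiv x JX (JY x)) = 0"
proof -
  interpret f: three_form "vol x" "\<phi> x" "K x" by (rule three_form_at[OF S(2)])
  have "K x (M (X x) (Y x)) - K x (M (Y x) (X x)) - M (K x (X x)) (Y x) + M (K x (Y x)) (X x) = 0"
    by (rule jet(2)[OF closed])
  then show ?thesis
    unfolding JX_def JY_def deriv_K_apply[OF X] deriv_K_apply[OF Y]
    by (simp add: linear_add[OF f.linear_K] linear_diff[OF f.linear_K] algebra_simps)
qed

end

section \<open>The Liouville volume and the function Q\<close>

lemma curry2_linear:
  assumes "alternating_form 2 \<alpha>"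
  shows "linear (\<lambda>a. curry2 \<alpha> a b)" "linear (\<lambda>b. curry2 \<alpha> a b)"
proof -
  have "((!) [a, b])(0 := u) = (!) [u, b]" "((!) [a, b])(1 := u) = (!) [a, u]" for a b u :: 'a
    by (auto simp: fun_eq_iff nth_Cons split: nat.split)
  then show "linear (\<lambda>a. curry2 \<alpha> a b)" "linear (\<lambda>b. curry2 \<alpha> a b)"
    using alternating_form_linear[OF assms, of 0 "(!) [a, b]"] alternating_form_linear[OF assms, of 1 "(!) [a, b]"]
    by (simp_all add: curry2_def del: One_nat_def)
qed

text \<open>Symplectic Gram-Schmidt: the hyperbolic pairs (e1, f1), (e2, f2), (e3, f3) are split off
  one after the other. A new start vector exists because at most four vectors do not span a
  six-dimensional space, and nondegeneracy of \<omega> supplies its partner.\<close>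

lemma liouville_volume_nonzero:
  fixes \<omega> :: "(real ^ 6) form"
  assumes "symplectic_form \<omega>"
  shows "\<exists>v. liouville_volume \<omega> v \<noteq> 0"
proof -
  have \<omega>: "alternating_form 2 \<omega>" using assms by (simp add: symplectic_form_def)
  define w where "w = curry2 \<omega>"
  have skew: "w b a = - w a b" for a b unfolding w_def by (rule curry2_alt(1)[OF \<omega>])
  have self: "w a a = 0" for a unfolding w_def by (rule curry2_alt(2)[OF \<omega>])
  have l: "w (a + b) c = w a c + w b c" "w (r *\<^sub>R a) c = r * w a c" "w (a - b) c = w a c - w b c"
    "w a (b + c) = w a b + w a c" "w a (r *\<^sub>R b) = r * w a b" "w a (b - c) = w a b - w a c" for a b c r
    unfolding w_def
    using linear_add[OF curry2_linear(1)[OF \<omega>]] linear_cmul[OF curry2_linear(1)[OF \<omega>]] linear_diff[OF curry2_linear(1)[OF \<omega>]]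
      linear_add[OF curry2_linear(2)[OF \<omega>]] linear_cmul[OF curry2_linear(2)[OF \<omega>]] linear_diff[OF curry2_linear(2)[OF \<omega>]]
    by simp_all
  have nd: "\<exists>b. w a b = 1" if "a \<noteq> 0" for a
  proof -
    have "interior_product a \<omega> \<noteq> zero_form" using assms that by (auto simp: symplectic_form_def)
    then obtain v where "\<omega> (case_nat a v) \<noteq> 0" by (auto simp: interior_product_def zero_form_def fun_eq_iff)
    then have "w a (v 0) \<noteq> 0" unfolding curry2_eq[OF \<omega>, of "case_nat a v"] by (simp add: w_def)
    then show ?thesis by (intro exI[of _ "(1 / w a (v 0)) *\<^sub>R v 0"]) (simp add: l)
  qed
  have out: "\<exists>u. u \<notin> span B" if "finite B" "card B \<le> 4" for B :: "(real ^ 6) set"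
  proof (rule ccontr)
    assume "\<nexists>u. u \<notin> span B"
    then have "span B = UNIV" by blast
    then have "dim (UNIV :: (real ^ 6) set) \<le> card B" using dim_le_card'[OF that(1)] by (metis dim_span)
    then show False using that(2) by (simp add: dim_UNIV)
  qed
  obtain e1 :: "real ^ 6" where "e1 \<noteq> 0" using nonempty_Basis nonzero_Basis by blast
  then obtain f1 where 1: "w e1 f1 = 1" using nd by blast
  \<comment> \<open>The projection to the \<omega>-complement of the plane of \<open>e1\<close> and
    \<open>f1\<close>. Its kernel lies in that plane, so a vector outside the plane has nonzero
    image.\<close>
  define P where "P u = u - w e1 u *\<^sub>R f1 + w f1 u *\<^sub>R e1" for u
  have P: "w e1 (P u) = 0" "w f1 (P u) = 0" for u
    using 1 skew[of f1 e1] by (simp_all add: P_def l self)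
  have "card {e1, f1} \<le> 4" by (simp add: card_insert_if)
  then obtain u where u: "u \<notin> span {e1, f1}" using out[of "{e1, f1}"] by auto
  define e2 where "e2 = P u"
  have "e2 \<noteq> 0"
  proof
    assume "e2 = 0"
    then have "u = w e1 u *\<^sub>R f1 - w f1 u *\<^sub>R e1" by (simp add: e2_def P_def algebra_simps)
    also have "\<dots> \<in> span {e1, f1}" by (intro span_diff span_scale span_base) auto
    finally show False using u by simp
  qed
  then obtain z where z: "w e2 z = 1" using nd by blast
  \<comment> \<open>\<open>P z\<close> differs from \<open>z\<close> by a combination of
    \<open>e1\<close> and \<open>f1\<close>, to which \<open>e2\<close> is \<omega>-orthogonal, so
    the pairing with \<open>e2\<close> is still 1.\<close>
  define f2 where "f2 = P z"
  have e2: "w e1 e2 = 0" "w f1 e2 = 0" and f2: "w e1 f2 = 0" "w f1 f2 = 0" unfolding e2_def f2_def by (rule P)+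
  have 2: "w e2 f2 = 1"
    using z e2 skew[of e2 f1] skew[of e2 e1] by (simp add: f2_def P_def l)
  define R where "R u = P u - w e2 u *\<^sub>R f2 + w f2 u *\<^sub>R e2" for u
  have R: "w e1 (R u) = 0" "w f1 (R u) = 0" "w e2 (R u) = 0" "w f2 (R u) = 0" for u
    using P[of u] e2 f2 2 skew[of f2 e2] skew[of e2 f1] skew[of e2 e1] skew[of f2 f1] skew[of f2 e1]
    by (simp_all add: R_def l self P_def)
  have "card {e1, f1, e2, f2} \<le> 4" by (simp add: card_insert_if)
  then obtain u' where u': "u' \<notin> span {e1, f1, e2, f2}" using out[of "{e1, f1, e2, f2}"] by auto
  define e3 where "e3 = R u'"
  have "e3 \<noteq> 0"
  proof
    assume "e3 = 0"
    then have "u' = w e1 u' *\<^sub>R f1 - w f1 u' *\<^sub>R e1 + w e2 u' *\<^sub>R f2 - w f2 u' *\<^sub>R e2"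
      by (simp add: e3_def R_def P_def algebra_simps)
    also have "\<dots> \<in> span {e1, f1, e2, f2}" by (intro span_add span_diff span_scale span_base) auto
    finally show False using u' by simp
  qed
  then obtain z' where z': "w e3 z' = 1" using nd by blast
  define f3 where "f3 = R z'"
  have e3: "w e1 e3 = 0" "w f1 e3 = 0" "w e2 e3 = 0" "w f2 e3 = 0"
    and f3: "w e1 f3 = 0" "w f1 f3 = 0" "w e2 f3 = 0" "w f2 f3 = 0" unfolding e3_def f3_def by (rule R)+
  have 3: "w e3 f3 = 1"
    using z' e3 skew[of e3 f1] skew[of e3 e1] skew[of e3 f2] skew[of e3 e2] by (simp add: f3_def R_def P_def l)
  have "liouville_volume \<omega> ((!) [e1, f1, e2, f2, e3, f3]) = 1"
    by (rule liouville_volume_symplectic_basis[OF \<omega>])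
      (use 1 2 3 e2 f2 e3 f3 in \<open>simp_all add: w_def\<close>)
  then show ?thesis by (metis zero_neq_one)
qed

lemma volume6_liouville:
  fixes \<omega> :: "(real ^ 6) form"
  assumes "symplectic_form \<omega>"
  shows "volume6 (liouville_volume \<omega>)"
proof
  have \<omega>: "alternating_form 2 \<omega>" using assms by (simp add: symplectic_form_def)
  have "alternating_form (4 + 2) (wedge 4 2 (wedge 2 2 \<omega> \<omega>) \<omega>)"
    by (rule alternating_form_wedge[OF alternating_form_wedge[OF \<omega> \<omega>, unfolded numeral_plus_numeral add_num_simps] \<omega>])
  from alternating_form_scale[OF this, of "1 / fact 3"] show "alternating_form 6 (liouville_volume \<omega>)"
    by (simp only: liouville_volume_def[abs_def] numeral_plus_numeral add_num_simps times_divide_eq_left mult_1)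
  show "\<exists>v. liouville_volume \<omega> v \<noteq> 0" by (rule liouville_volume_nonzero[OF assms])
qed

lemma liouville_volume_pullback: "liouville_volume (pullback g \<omega>) = pullback g (liouville_volume \<omega>)"
  unfolding liouville_volume_def[abs_def] wedge_pullback unfolding pullback_def ..

lemma K_form_endo: "K_form \<omega> \<alpha> = endo (liouville_volume \<omega>) \<alpha>"
  by (rule ext) (simp only: K_form_def endo_def)

lemma F_form_eq:
  assumes "alternating_form 3 \<alpha>"
  shows "F_form \<omega> \<alpha> v = - 2 * curry3 \<alpha> (K_form \<omega> \<alpha> (v 0)) (v 1) (v 2)"
  unfolding F_form_def by (subst curry3_eq[OF assms]) simp

lemma wedge33_scale: "wedge33 \<gamma> (\<lambda>a b c. r * \<delta> a b c) a b c d e f = r * wedge33 \<gamma> \<delta> a b c d e f"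
  by (simp add: wedge33_def wedge23_def algebra_simps)

text \<open>The constant 4 is 2 times 2: one factor from F = -2 \<psi>, one from \<phi> \<and>
  \<psi> = 2 \<kappa> vol in \<open>disc_eq\<close>. The sign of F cancels the one in the definition
  of Q.\<close>

lemma Q_form_eq:
  fixes \<omega> :: "(real ^ 6) form"
  assumes "symplectic_form \<omega>" and \<alpha>: "alternating_form 3 \<alpha>"
  shows "Q_form \<omega> \<alpha> = 4 * disc (liouville_volume \<omega>) \<alpha>"
proof -
  interpret volume6 "liouville_volume \<omega>" by (rule volume6_liouville[OF assms(1)])
  interpret f: three_form "liouville_volume \<omega>" "curry3 \<alpha>" "K_form \<omega> \<alpha>"
    unfolding K_form_endo by (rule three_form_endo[OF \<alpha>])
  have F: "F_form \<omega> \<alpha> = (\<lambda>v. - 2 * f.\<psi> (v 0) (v 1) (v 2))"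
    unfolding f.\<psi>_def by (simp add: fun_eq_iff F_form_eq[OF \<alpha>] del: One_nat_def)
  have altF: "alternating_form 3 (F_form \<omega> \<alpha>)"
    unfolding F by (rule alternating_form_scale[OF alternating_form_uncurry3[OF f.alt_\<psi>]])
  have cF: "curry3 (F_form \<omega> \<alpha>) = (\<lambda>a b c. - 2 * f.\<psi> a b c)"
    unfolding F by (intro ext) (simp add: curry3_def)
  have W: "wedge 3 3 \<alpha> (F_form \<omega> \<alpha>) v = - (4 * disc (liouville_volume \<omega>) \<alpha>) * liouville_volume \<omega> v" for v
  proof -
    have "wedge 3 3 \<alpha> (F_form \<omega> \<alpha>) v = - 2 * wedge33 (curry3 \<alpha>) f.\<psi> (v 0) (v 1) (v 2) (v 3) (v 4) (v 5)"
      using wedge33_scale[of "curry3 \<alpha>" "- 2" f.\<psi> "v 0" "v 1" "v 2" "v 3" "v 4" "v 5"]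
      by (simp only: wedge_3_3[OF \<alpha> altF] cF wedge33_def[of "curry3 \<alpha>" "\<lambda>a b c. - 2 * f.\<psi> a b c"])
    then show ?thesis
      using disc_eq(2)[OF \<alpha>, of "v 0" "v 1" "v 2" "v 3" "v 4" "v 5"] curry6_eq[OF alternating, of v]
      by (simp add: K_form_endo)
  qed
  obtain v where v: "liouville_volume \<omega> v \<noteq> 0" using nonzero by blast
  show ?thesis
    unfolding Q_form_def
  proof (rule the_equality)
    show "wedge 3 3 \<alpha> (F_form \<omega> \<alpha>) = (\<lambda>v. - (4 * disc (liouville_volume \<omega>) \<alpha>) * liouville_volume \<omega> v)"
      using W by (rule ext)
    fix q assume q: "wedge 3 3 \<alpha> (F_form \<omega> \<alpha>) = (\<lambda>v. - q * liouville_volume \<omega> v)"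
    show "q = 4 * disc (liouville_volume \<omega>) \<alpha>"
      using fun_cong[OF q, of v] W[of v] v by simp
  qed
qed

lemma smooth_on_differentiable: "smooth_on S f \<Longrightarrow> x \<in> S \<Longrightarrow> f differentiable (at x)"
  unfolding smooth_on_def by (drule spec[of _ "Suc 0"]) simp

section \<open>Symplectic six-manifolds\<close>

locale symplectic_chart =
  fixes M :: "'a topology" and A :: "('a, real ^ 6) chart set"
    and \<omega> \<phi> :: "('a, real ^ 6, (real ^ 6) form) field" and c :: "('a, real ^ 6) chart"
  assumes symplectic: "symplectic_manifold M A \<omega>" and smooth: "smooth_form A 3 \<phi>"
    and closed: "integrable_form A \<phi>" and F_closed: "F_integrable A \<omega> \<phi>" and c: "c \<in> A"
begin

definition S where "S = snd c ` fst c"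

lemma chart: "openin M (fst c)" "open S" "homeomorphic_map (subtopology M (fst c)) (top_of_set S) (snd c)"
  using symplectic c unfolding symplectic_manifold_def smooth_manifold_def S_def by auto

lemma inj: "inj_on (snd c) (fst c)"
  using homeomorphic_imp_injective_map[OF chart(3)] openin_subset[OF chart(1)]
  by (simp add: Int_absorb1)

lemma parametrization: "p \<in> fst c \<Longrightarrow> parametrization c (snd c p) = p" "x \<in> S \<Longrightarrow> parametrization c x \<in> fst c"
  unfolding parametrization_def S_def using inj by (auto intro: inv_into_into)

abbreviation "vol y \<equiv> liouville_volume (in_coords \<omega> c y)"
abbreviation "Ph y \<equiv> in_coords \<phi> c y"

lemma local_forms:
  assumes x: "x \<in> S"
  shows "local_forms S x vol Ph"
proof (rule local_forms.intro)
  show "open S" by (rule chart(2))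
  show "x \<in> S" by (rule x)
  show "volume6 (vol y)" if "y \<in> S" for y
    using symplectic c parametrization(2)[OF that] unfolding symplectic_manifold_def in_coords_def
    by (intro volume6_liouville) blast
  show "alternating_form 3 (Ph y)" if "y \<in> S" for y
    using smooth c parametrization(2)[OF that] unfolding smooth_form_def in_coords_def by blast
  have \<omega>: "(\<lambda>y. in_coords \<omega> c y v) differentiable (at x)" for v
    using symplectic c x unfolding symplectic_manifold_def smooth_form_def S_def
    by (blast intro: smooth_on_differentiable)
  have "(\<lambda>y. wedge 4 2 (wedge 2 2 (in_coords \<omega> c y) (in_coords \<omega> c y)) (in_coords \<omega> c y) v / fact 3) differentiable (at x)" for v
    by (intro differentiable_divide differentiable_wedge \<omega> differentiable_const) simp
  then show "(\<lambda>y. vol y v) differentiable (at x)" for v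
    unfolding liouville_volume_def .
  show "(\<lambda>y. Ph y v) differentiable (at x)" for v
    using smooth c x unfolding smooth_form_def S_def by (blast intro: smooth_on_differentiable)
qed

text \<open>The components of \<tau> are described by \<open>g\<close> only on the chart image;
  since that image is open, this determines their derivatives.\<close>

lemma ext_deriv_3:
  assumes p: "p \<in> fst c" and g: "\<And>y v. y \<in> S \<Longrightarrow> in_coords \<tau> c y v = g y (v 0) (v 1) (v 2)"
    and d: "\<And>b1 b2 b3. (\<lambda>y. g y b1 b2 b3) differentiable (at (snd c p))"
  shows "ext_deriv 3 \<tau> c p ((!) [a1, a2, a3, a4]) =
    fderiv (snd c p) (\<lambda>y. g y a2 a3 a4) a1 - fderiv (snd c p) (\<lambda>y. g y a1 a3 a4) a2
    + fderiv (snd c p) (\<lambda>y. g y a1 a2 a4) a3 - fderiv (snd c p) (\<lambda>y. g y a1 a2 a3) a4"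
proof -
  have x: "snd c p \<in> S" using p by (simp add: S_def)
  have fd: "fderiv (snd c p) (\<lambda>y. in_coords \<tau> c y v) = fderiv (snd c p) (\<lambda>y. g y (v 0) (v 1) (v 2))" for v
    using fderiv_cong[OF chart(2) x _ d] g by metis
  have s: "(\<Sum>i\<le>3. h i) = h 0 + h 1 + h 2 + h 3" for h :: "nat \<Rightarrow> real"
    by (simp add: eval_nat_numeral)
  show ?thesis unfolding ext_deriv_def fd s by (simp add: numeral_3_eq_3 numeral_2_eq_2)
qed

context
  fixes p assumes p: "p \<in> fst c"
begin

interpretation l: local_forms S "snd c p" vol Ph
  by (rule local_forms) (simp add: S_def p)

lemma in_coords_\<phi>: "y \<in> S \<Longrightarrow> in_coords \<phi> c y v = l.\<phi> y (v 0) (v 1) (v 2)"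
  unfolding l.\<phi>_def by (rule curry3_eq[OF l.three])

lemma in_coords_F: "y \<in> S \<Longrightarrow> in_coords (F_field \<omega> \<phi>) c y v = - 2 * l.\<psi> y (v 0) (v 1) (v 2)"
proof -
  assume y: "y \<in> S"
  have "in_coords (F_field \<omega> \<phi>) c y = F_form (in_coords \<omega> c y) (Ph y)"
    by (simp add: in_coords_def F_field_def)
  then show ?thesis
    by (simp only: F_form_eq[OF l.three[OF y]] l.\<psi>_def l.\<phi>_def l.K_def K_form_endo)
qed

lemma closed_T: "l.T a1 a2 a3 a4 - l.T a2 a1 a3 a4 + l.T a3 a1 a2 a4 - l.T a4 a1 a2 a3 = 0"
proof -
  have "ext_deriv 3 \<phi> c p = zero_form"
    using closed c p by (simp add: integrable_form_def closed_form_def)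
  then have "ext_deriv 3 \<phi> c p ((!) [a1, a2, a3, a4]) = 0" by (simp add: zero_form_def)
  moreover have "ext_deriv 3 \<phi> c p ((!) [a1, a2, a3, a4]) = l.T a1 a2 a3 a4 - l.T a2 a1 a3 a4 + l.T a3 a1 a2 a4 - l.T a4 a1 a2 a3"
    unfolding l.T_def by (rule ext_deriv_3[OF p in_coords_\<phi> l.diff_\<phi>])
  ultimately show ?thesis by simp
qed

lemma closed_U: "l.U a1 a2 a3 a4 - l.U a2 a1 a3 a4 + l.U a3 a1 a2 a4 - l.U a4 a1 a2 a3 = 0"
proof -
  have "ext_deriv 3 (F_field \<omega> \<phi>) c p = zero_form"
    using F_closed c p by (simp add: F_integrable_def closed_form_def)
  then have 0: "ext_deriv 3 (F_field \<omega> \<phi>) c p ((!) [a1, a2, a3, a4]) = 0" by (simp add: zero_form_def)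
  have d: "((\<lambda>y. - 2 * l.\<psi> y b1 b2 b3) has_derivative (\<lambda>z. - 2 * l.U z b1 b2 b3)) (at (snd c p))" for b1 b2 b3
    by (intro has_derivative_mult_right l.has_derivative_\<psi>)
  have "ext_deriv 3 (F_field \<omega> \<phi>) c p ((!) [a1, a2, a3, a4]) =
    - 2 * l.U a1 a2 a3 a4 - - 2 * l.U a2 a1 a3 a4 + - 2 * l.U a3 a1 a2 a4 - - 2 * l.U a4 a1 a2 a3"
    unfolding fderiv_eq[OF d, symmetric, THEN fun_cong] by (rule ext_deriv_3[OF p in_coords_F differentiableI[OF d]])
  with 0 show ?thesis by simp
qed

lemma nijenhuis_zero:
  assumes X: "in_coords X c differentiable (at (snd c p))" and Y: "in_coords Y c differentiable (at (snd c p))"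
  shows "nijenhuis (K_field \<omega> \<phi>) X Y c p = 0"
proof -
  have K: "in_coords (\<lambda>c p. K_field \<omega> \<phi> c p (Z c p)) c = (\<lambda>y. l.K y (in_coords Z c y))" for Z
    unfolding l.K_def unfolding in_coords_def K_field_def K_form_endo ..
  have Kp: "K_field \<omega> \<phi> c p = l.K (snd c p)"
    unfolding l.K_def unfolding in_coords_def K_field_def K_form_endo parametrization(1)[OF p] ..
  have Zp: "Z c p = in_coords Z c (snd c p)" for Z :: "('a, real ^ 6, real ^ 6) field"
    using parametrization(1)[OF p] by (simp add: in_coords_def)
  show ?thesis
    using l.nijenhuis_at[OF closed_T closed_U X Y]
    unfolding nijenhuis_def Let_def lie_bracket_def K Kp Zp[of X] Zp[of Y] .
qed

lemma Q_at: "y \<in> S \<Longrightarrow> Q_form (in_coords \<omega> c y) (Ph y) = 4 * l.\<kappa> y"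
proof -
  assume y: "y \<in> S"
  have "symplectic_form (in_coords \<omega> c y)"
    using symplectic c parametrization(2)[OF y] unfolding symplectic_manifold_def in_coords_def by blast
  then show ?thesis unfolding l.\<kappa>_def using Q_form_eq l.three[OF y] by blast
qed

lemma has_derivative_Q: "((\<lambda>y. Q_form (in_coords \<omega> c y) (Ph y)) has_derivative (\<lambda>z. 0)) (at (snd c p))"
proof -
  have "((\<lambda>y. 4 * l.\<kappa> y) has_derivative (\<lambda>z. 4 * fderiv (snd c p) l.\<kappa> z)) (at (snd c p))"
    by (intro has_derivative_mult_right fderiv_works l.diff_\<kappa>)
  then have "((\<lambda>y. 4 * l.\<kappa> y) has_derivative (\<lambda>z. 0)) (at (snd c p))"
    using l.jet(1)[OF closed_T closed_U] by simp
  then show ?thesis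
    by (rule has_derivative_transform_within_open[OF _ l.S]) (simp add: Q_at)
qed

end

section \<open>Comparison of neighbouring points and of charts\<close>

lemma Q_locally_constant:
  assumes p: "p \<in> fst c"
  shows "\<exists>U. openin M U \<and> p \<in> U \<and> U \<subseteq> fst c \<and> (\<forall>q\<in>U. Q_field \<omega> \<phi> c q = Q_field \<omega> \<phi> c p)"
proof -
  let ?Q = "\<lambda>y. Q_form (in_coords \<omega> c y) (Ph y)"
  \<comment> \<open>A ball is convex, so a vanishing derivative makes Q constant on it; each of its
    points is the image of a chart point, where \<open>has_derivative_Q\<close> applies.\<close>
  obtain e where e: "e > 0" "ball (snd c p) e \<subseteq> S"
    using chart(2) p unfolding S_def open_contains_ball by blast
  have "(?Q has_derivative (\<lambda>z. 0)) (at y within ball (snd c p) e)" if "y \<in> ball (snd c p) e" for y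
  proof -
    have "y \<in> S" using that e(2) by blast
    then obtain q where "q \<in> fst c" "y = snd c q" unfolding S_def by blast
    then show ?thesis using has_derivative_at_withinI[OF has_derivative_Q] by blast
  qed
  then obtain r where r: "\<And>y. y \<in> ball (snd c p) e \<Longrightarrow> ?Q y = r"
    using has_derivative_zero_constant[OF convex_ball, of "snd c p" e ?Q] by blast
  define U where "U = {q \<in> fst c. snd c q \<in> ball (snd c p) e}"
  have "openin (subtopology M (fst c)) {q \<in> topspace (subtopology M (fst c)). snd c q \<in> ball (snd c p) e}"
    using open_subset[OF e(2) open_ball] by (rule openin_continuous_map_preimage[OF homeomorphic_imp_continuous_map[OF chart(3)]])
  also have "{q \<in> topspace (subtopology M (fst c)). snd c q \<in> ball (snd c p) e} = U"
    using openin_subset[OF chart(1)] by (auto simp: U_def)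
  finally have "openin (subtopology M (fst c)) U" .
  then have "openin M U" using chart(1) by (rule openin_trans_full)
  moreover have "Q_field \<omega> \<phi> c q = r" if "q \<in> U" for q
    using r[of "snd c q"] that parametrization(1)[of q] by (simp add: U_def Q_field_def in_coords_def)
  moreover have "p \<in> U" using p e(1) by (simp add: U_def)
  moreover have "U \<subseteq> fst c" by (auto simp: U_def)
  ultimately show ?thesis by (intro exI[of _ U]) auto
qed

text \<open>By \<open>disc_pullback\<close> it suffices that the Jacobian is invertible. This is
  read off from \<omega>: a vector killed by the Jacobian lies in the kernel of the pulled-back
  form, which is \<omega> in the first chart and nondegenerate.\<close>

lemma Q_chart_independent:
  assumes c': "c' \<in> A" and p: "p \<in> fst c \<inter> fst c'"
  shows "Q_field \<omega> \<phi> c p = Q_field \<omega> \<phi> c' p"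
proof -
  define J where "J = jacobian c c' p"
  have sy: "symplectic_form (\<omega> c p)" "symplectic_form (\<omega> c' p)"
    using symplectic c c' p unfolding symplectic_manifold_def by blast+
  have al: "alternating_form 3 (\<phi> c' p)" "alternating_form 3 (\<phi> c p)"
    using smooth c c' p unfolding smooth_form_def by blast+
  have pb: "\<omega> c p = pullback J (\<omega> c' p)" "\<phi> c p = pullback J (\<phi> c' p)"
    using symplectic smooth c c' p unfolding symplectic_manifold_def smooth_form_def J_def by blast+
  have "smooth_on (snd c ` (fst c \<inter> fst c')) (transition c c')"
    using symplectic c c' unfolding symplectic_manifold_def smooth_manifold_def by blast
  then have "transition c c' differentiable (at (snd c p))"
    using p by (intro smooth_on_differentiable) auto
  then have J: "linear J"
    unfolding J_def jacobian_def by (rule has_derivative_linear[OF fderiv_works])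
  have "u = 0" if "J u = 0" for u
  proof -
    have "interior_product u (\<omega> c p) = zero_form"
    proof
      fix v
      have "\<omega> c' p (\<lambda>i. J (case_nat u v i)) = 0"
      proof -
        have "alternating_form 2 (\<omega> c' p)" using sy(2) by (simp add: symplectic_form_def)
        then have "linear (\<lambda>w. \<omega> c' p ((\<lambda>i. J (case_nat u v i))(0 := w)))"
          by (rule alternating_form_linear) simp
        from linear_0[OF this] have "\<omega> c' p ((\<lambda>i. J (case_nat u v i))(0 := 0)) = 0" .
        moreover have "(\<lambda>i. J (case_nat u v i))(0 := 0) = (\<lambda>i. J (case_nat u v i))"
          using that by (auto simp: fun_eq_iff)
        ultimately show ?thesis by simp
      qed
      then show "interior_product u (\<omega> c p) v = zero_form v"
        unfolding pb(1) by (simp add: interior_product_def pullback_def zero_form_def)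
    qed
    then show ?thesis using sy(1) by (simp add: symplectic_form_def)
  qed
  then have "inj J" using linear_injective_0[OF J] by blast
  then have "bij J" using linear_injective_imp_surjective[OF J] by (simp add: bij_def)
  have "disc (liouville_volume (\<omega> c p)) (\<phi> c p) = disc (liouville_volume (\<omega> c' p)) (\<phi> c' p)"
    unfolding pb liouville_volume_pullback
    by (rule disc_pullback[OF volume6_liouville[OF sy(2)] J \<open>bij J\<close> al(1)])
  then show ?thesis unfolding Q_field_def by (simp add: Q_form_eq sy al)
qed

lemma stable_iff:
  assumes p: "p \<in> fst c"
  shows "stable_form (\<phi> c p) \<longleftrightarrow> Q_field \<omega> \<phi> c p \<noteq> 0"
proof -
  have sy: "symplectic_form (\<omega> c p)" and al: "alternating_form 3 (\<phi> c p)"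
    using symplectic smooth c p unfolding symplectic_manifold_def smooth_form_def by blast+
  show ?thesis
    unfolding Q_field_def Q_form_eq[OF sy al]
    using volume6.stable_iff_disc[OF volume6_liouville[OF sy] al] by simp
qed

end

theorem theorem3p7:
  fixes M :: "'a topology"
    and A :: "('a, real ^ 6) chart set"
    and \<omega> \<phi> :: "('a, real ^ 6, (real ^ 6) form) field"
  assumes "symplectic_manifold M A \<omega>"
    and "connected_space M"
    and "smooth_form A 3 \<phi>"
    and "primitive A \<omega> \<phi>"
    and "integrable_form A \<phi>"
    and "F_integrable A \<omega> \<phi>"
  shows "K_integrable M A \<omega> \<phi> \<and>
         Q_integrable A \<omega> \<phi> \<and>
         (\<exists>q. \<forall>c\<in>A. \<forall>p\<in>fst c. Q_field \<omega> \<phi> c p = q) \<and>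
         ((\<forall>p\<in>topspace M. stable_at A \<phi> p) \<or> (\<forall>p\<in>topspace M. \<not> stable_at A \<phi> p))"
proof -
  have ch: "symplectic_chart M A \<omega> \<phi> c" if "c \<in> A" for c
    using assms that by unfold_locales
  have top: "topspace M = (\<Union>c\<in>A. fst c)"
    using assms(1) by (simp add: symplectic_manifold_def smooth_manifold_def)
  have K: "K_integrable M A \<omega> \<phi>"
    unfolding K_integrable_def
  proof (intro allI impI ballI)
    fix W X Y c p
    assume W: "openin M W \<and> smooth_vector_field A W X \<and> smooth_vector_field A W Y" and c: "c \<in> A" and p: "p \<in> fst c \<inter> W"
    have "in_coords Z c differentiable (at (snd c p))" if "smooth_vector_field A W Z" for Z
      using that c p unfolding smooth_vector_field_def by (blast intro: smooth_on_differentiable)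
    then show "nijenhuis (K_field \<omega> \<phi>) X Y c p = 0"
      using symplectic_chart.nijenhuis_zero[OF ch[OF c]] W p by blast
  qed
  have Q: "Q_integrable A \<omega> \<phi>"
    unfolding Q_integrable_def closed_form_def
  proof (intro ballI)
    fix c p assume c: "c \<in> A" and p: "p \<in> fst c"
    show "ext_deriv 0 (\<lambda>c p v. Q_field \<omega> \<phi> c p) c p = zero_form"
      using fderiv_eq[OF symplectic_chart.has_derivative_Q[OF ch[OF c] p]]
      by (simp add: ext_deriv_def zero_form_def in_coords_def Q_field_def)
  qed
  \<comment> \<open>A chart-free version of Q, obtained by choosing some chart at each point;
    \<open>Q_chart_independent\<close> makes the choice immaterial.\<close>
  define q where "q p = Q_field \<omega> \<phi> (SOME c. c \<in> A \<and> p \<in> fst c) p" for p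
  have q: "Q_field \<omega> \<phi> c p = q p" if "c \<in> A" "p \<in> fst c" for c p
  proof -
    have "(SOME c. c \<in> A \<and> p \<in> fst c) \<in> A \<and> p \<in> fst (SOME c. c \<in> A \<and> p \<in> fst c)"
      by (rule someI[of _ c]) (use that in simp)
    then show ?thesis
      unfolding q_def using that by (intro symplectic_chart.Q_chart_independent[OF ch]) auto
  qed
  \<comment> \<open>Any condition on a locally constant function defines an open set. The conditions
    \<open>=\<close> and \<open>\<noteq>\<close> for a fixed value then show that a level set is
    both open and closed.\<close>
  have open_q: "openin M {p \<in> topspace M. P (q p)}" for P
  proof (subst openin_subopen, intro ballI)
    fix p assume p: "p \<in> {p \<in> topspace M. P (q p)}"
    then obtain c where c: "c \<in> A" "p \<in> fst c" unfolding top by blast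
    obtain U where U: "openin M U" "p \<in> U" "U \<subseteq> fst c" "\<forall>r\<in>U. Q_field \<omega> \<phi> c r = Q_field \<omega> \<phi> c p"
      using symplectic_chart.Q_locally_constant[OF ch[OF c(1)] c(2)] by blast
    have "q r = q p" if "r \<in> U" for r
      using U that q[OF c] q[OF c(1), of r] by auto
    then have "U \<subseteq> {p \<in> topspace M. P (q p)}" using p openin_subset[OF U(1)] by auto
    with U show "\<exists>T. openin M T \<and> p \<in> T \<and> T \<subseteq> {p \<in> topspace M. P (q p)}" by blast
  qed
  have "\<exists>r. \<forall>p\<in>topspace M. q p = r"
  proof (cases "topspace M = {}")
    case False
    then obtain p0 where p0: "p0 \<in> topspace M" by blast
    let ?T = "{p \<in> topspace M. q p = q p0}"
    have "topspace M - ?T = {p \<in> topspace M. q p \<noteq> q p0}" by blast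
    then have "closedin M ?T" using open_q[of "\<lambda>t. t \<noteq> q p0"] by (simp add: closedin_def)
    then have "?T = {} \<or> ?T = topspace M"
      using assms(2) open_q[of "\<lambda>t. t = q p0"] unfolding connected_space_clopen_in by blast
    then have "?T = topspace M" using p0 by blast
    then show ?thesis by blast
  qed simp
  then obtain r where r: "\<forall>p\<in>topspace M. q p = r" by blast
  have const: "\<forall>c\<in>A. \<forall>p\<in>fst c. Q_field \<omega> \<phi> c p = r"
    using q r unfolding top by auto
  \<comment> \<open>\<open>stable_at\<close> asks for one suitable chart; as Q equals
    \<open>r\<close> in every chart, all charts at \<open>p\<close> give the same answer.\<close>
  have "stable_at A \<phi> p \<longleftrightarrow> r \<noteq> 0" if "p \<in> topspace M" for p
    using that const symplectic_chart.stable_iff[OF ch] unfolding stable_at_def top by auto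
  with K Q const show ?thesis by blast
qed

end
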